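(* Let $T>0$, let $V\in C^1(\mathbb{R}^2)$ with $V\ge 0$ be a potential such that $\nabla_x V$ is Lipschitz continuous. Assume that $f_0\in L^1\cap L^\infty(\mathbb{R}^2\times\mathbb{R}^2)$, $f_0\ge 0$, $\iint f_0\,dx\,dv=1$, and that $f_0$ has compact support in phase space $\mathbb{R}^2\times\mathbb{R}^2$. Let $f$ be a weak solution on $[0,T]$, with initial datum $f_0$, of the mean-field equation $\partial_t f+v\cdot\nabla_x f+\nabla_v\cdot(\mathcal{F}(f)f)=0$ (in the sense given in the context). Then the force field $\mathcal{F}(f)$ generated by $f$ is locally Lipschitz continuous in phase space, uniformly on $[0,T]$. More precisely, there exists a constant $C>0$ depending on $\|f\|_{L^1\cap L^\infty}$ and on the support of $f$ in phase space such that $$|\mathcal{F}(f)(t,x,v)-\mathcal{F}(f)(t,\tilde x,\tilde v)|\le C(1+\|v\|)\left\|\begin{pmatrix}x\\ v\end{pmatrix}-\begin{pmatrix}\tilde x\\ \tilde v\end{pmatrix}\right\|$$ for all $x,v,\tilde x,\tilde v\in\mathbb{R}^2$ and $t\in[0,T]$.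
   Context: Parameters: $\kappa\in[-1,1]$; $C_0,\dots,C_5,\delta_0,\delta_1,\beta,\sigma,\varepsilon>0$; $R>0$, $R_0^{Im}\in(0,R)$, $R^{Im}>0$, $R^{Fo}>0$. They are fixed, and constants may depend on them and on $V$. Notation: $\langle\cdot,\cdot\rangle$ and $\|\cdot\|$ are the Euclidean scalar product and norm; $u\times v=u_1v_2-u_2v_1$ for $u,v\in\mathbb{R}^2$; $v^\bot$ is $v$ rotated counterclockwise by $\pi/2$; $\alpha(u,v)$ is the signed angle (counterclockwise positive) from $v$ to $u$; $\mathbb{1}_A$ is the indicator function of $A$. For $z,u\in\mathbb{R}^2$ let $D(z,u)=\big(\|z\|^2-(\langle z,u\rangle/\|u\|)^2\big)^{1/2}$, $\tau(z,u)=-\langle z,u\rangle/\|u\|^2$, $\dot\alpha(z,u)=(z\times u)/\|z\|^2$, and $\mathcal{C}(v)=\{z\in\mathbb{R}^2:\langle z,v\rangle\ge\kappa\|z\|\|v\|\}$. Define $I^{Co}(u)=\{z:\tau(z,u)\ge0,\ D(z,u)<R\}$, $I^{Im}(u)=\{z:\tau(z,u)\ge0,\ D(z,u)<R_0^{Im},\ \|z\|<R^{Im}\}$, $I^{Fo}(u)=\{z:\tau(z,u)<0,\ \|z\|<R^{Fo}\}$, and for $\ast\in\{Co,Im,Fo\}$, $\mathcal{K}^{\ast}(v,w)=I^{\ast}(w-v)\cap\mathcal{C}(v)$. Mollifier: $\eta_\varepsilon(y,w)=\varepsilon^{-4}c\exp\!\big(\frac{1}{(\|y\|^2+\|w\|^2)/\varepsilon^2-1}\big)$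 if $\|y\|^2+\|w\|^2<\varepsilon^2$ and $0$ otherwise, with $c$ such that $\iint\eta_\varepsilon=1$. $\cos^\varepsilon(\alpha(z,v))$ and $\sin^\varepsilon(2\alpha(z,v))$ denote the convolutions over $\mathbb{R}^2\times\mathbb{R}^2$ of $(z,v)\mapsto\cos\alpha(z,v)$, respectively $(z,v)\mapsto\sin(2\alpha(z,v))$, with $\eta_\varepsilon$. Let $g(s)=\frac{2}{1+e^{-s/\delta_0}}-1+\delta_1$. Kernels (the particle volume radius is set to $0$ in the mean-field limit, so the time to collide coincides with $\tau$): $m^{Co}(z,v,w)=-C_0\cos^\varepsilon(\alpha(z,v))\,e^{-\tau(z,w-v)/C_1}\,g\big(\tfrac{(w-v)\times z}{\|z\|^2}\big)$, $m^{Im}(z,v,w)=C_2e^{-\|z\|\tau(z,w-v)/C_3}$, $m^{Fo}(z,v,w)=C_4e^{-|\dot\alpha(z,w-v)|\|z\|^2/C_5}\sin^\varepsilon(2\alpha(z,v))$. For $\ast\in\{Co,Im,Fo\}$: $\lambda^\ast(t,x,v)=\iint_{\mathbb{R}^2\times\mathbb{R}^2}\mathbb{1}_{\mathcal{K}^\ast(v,w)}(y-x)f(t,y,w)\,dy\,dw+\beta$, $\Omega_\ast(t,x,v)=\frac{1}{\lambda^\ast(t,x,v)}\iint_{\mathbb{R}^2\times\mathbb{R}^2}m^\ast(y-x,v,w)\mathbb{1}_{\mathcal{K}^\ast(v,w)}(y-x)f(t,y,w)\,dy\,dw$. Force field: $\mathcal{F}(f)=-\nabla_xV+\Omega_{Co}v^\bot-\Omega_{Im}v+\Omega_{Fo}v^\bot-\sigma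 v$. Weak solution: a nonnegative $f$ with $f(t)\in L^1\cap L^\infty(\mathbb{R}^2\times\mathbb{R}^2)$ and $\iint(|x|^2+|v|^2)f(t,x,v)\,dx\,dv<C(T,f_0)$ for a.e. $t\in[0,T]$, such that for every $\varphi\in C_c^\infty([0,T)\times\mathbb{R}^2\times\mathbb{R}^2)$ $$\int_0^T\!\!\iint f\big(\partial_t\varphi+v\cdot\nabla_x\varphi-(\nabla_xV-\Omega_{Co}v^\bot+\Omega_{Im}v-\Omega_{Fo}v^\bot+\sigma v)\cdot\nabla_v\varphi\big)\,dx\,dv\,dt+\iint f_0\,\varphi(0)\,dx\,dv=0,$$ and satisfying the energy inequality $\frac{d}{dt}\iint(\frac{|v|^2}{2}+V(x))f\,dx\,dv\le-\iint(\sigma+\Omega_{Im})|v|^2f\,dx\,dv$. *)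

theory Defs
  imports "HOL-Analysis.Analysis" "HOL-Probability.Essential_Supremum"
begin

type_synonym plane = "real^2"
type_synonym phase = "(real^2) \<times> (real^2)"

section \<open>Parameters\<close>

record params =
  kappa :: real
  C0 :: real
  C1 :: real
  C2 :: real
  C3 :: real
  C4 :: real
  C5 :: real
  delta0 :: real
  delta1 :: real
  beta :: real
  sigma :: real
  epsil :: real
  Rad :: real
  RadIm0 :: real
  RadIm :: real
  RadFo :: real

definition valid_params :: "params \<Rightarrow> bool" where
  "valid_params P \<longleftrightarrow>
     -1 \<le> kappa P \<and> kappa P \<le> 1 \<and>
     0 < C0 P \<and> 0 < C1 P \<and> 0 < C2 P \<and> 0 < C3 P \<and> 0 < C4 P \<and> 0 < C5 P \<and>
     0 < delta0 P \<and> 0 < delta1 P \<and> 0 < beta P \<and> 0 < sigma P \<and> 0 < epsil P \<and>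
     0 < Rad P \<and> 0 < RadIm0 P \<and> RadIm0 P < Rad P \<and> 0 < RadIm P \<and> 0 < RadFo P"

section \<open>Planar geometry\<close>

definition cross2 :: "plane \<Rightarrow> plane \<Rightarrow> real" where
  "cross2 u v = u$1 * v$2 - u$2 * v$1"

definition perp :: "plane \<Rightarrow> plane" where
  "perp v = vector [- (v$2), v$1]"

definition plane_complex :: "plane \<Rightarrow> complex" where
  "plane_complex u = Complex (u$1) (u$2)"

text \<open>The signed angle from \<open>v\<close> to \<open>u\<close>, in \<open>(-\<pi>, \<pi>]\<close>. It is \<open>0\<close> if one of the vectors vanishes;
  below it occurs only under an integral, where this convention is immaterial.\<close>

definition signed_angle :: "plane \<Rightarrow> plane \<Rightarrow> real" where
  "signed_angle u v = Arg (plane_complex u / plane_complex v)"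

text \<open>For \<open>u = 0\<close> (respectively \<open>z = 0\<close>) the quotients below are \<open>0\<close> by the convention on division.
  This concerns only null sets of the integrations that follow.\<close>

definition dist_closest :: "plane \<Rightarrow> plane \<Rightarrow> real" where
  "dist_closest z u = sqrt ((norm z)\<^sup>2 - (inner z u / norm u)\<^sup>2)"

definition tau :: "plane \<Rightarrow> plane \<Rightarrow> real" where
  "tau z u = - inner z u / (norm u)\<^sup>2"

definition alpha_dot :: "plane \<Rightarrow> plane \<Rightarrow> real" where
  "alpha_dot z u = cross2 z u / (norm z)\<^sup>2"

definition vision_cone :: "params \<Rightarrow> plane \<Rightarrow> plane set" where
  "vision_cone P v = {z. inner z v \<ge> kappa P * norm z * norm v}"

datatype interaction = Co | Imm | Fo

fun region :: "params \<Rightarrow> interaction \<Rightarrow> plane \<Rightarrow> plane set" where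
  "region P Co u = {z. tau z u \<ge> 0 \<and> dist_closest z u < Rad P}"
| "region P Imm u = {z. tau z u \<ge> 0 \<and> dist_closest z u < RadIm0 P \<and> norm z < RadIm P}"
| "region P Fo u = {z. tau z u < 0 \<and> norm z < RadFo P}"

definition inter_set :: "params \<Rightarrow> interaction \<Rightarrow> plane \<Rightarrow> plane \<Rightarrow> plane set" where
  "inter_set P k v w = region P k (w - v) \<inter> vision_cone P v"

section \<open>Mollification\<close>

definition bump :: "real \<Rightarrow> phase \<Rightarrow> real" where
  "bump e = (\<lambda>(y, w).
     if (norm y)\<^sup>2 + (norm w)\<^sup>2 < e\<^sup>2
     then e powi (-4) * exp (1 / (((norm y)\<^sup>2 + (norm w)\<^sup>2) / e\<^sup>2 - 1)) else 0)"

definition mollifier :: "real \<Rightarrow> phase \<Rightarrow> real" where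
  "mollifier e q = bump e q / (LINT p|lborel. bump e p)"

definition mollify :: "real \<Rightarrow> (plane \<Rightarrow> plane \<Rightarrow> real) \<Rightarrow> plane \<Rightarrow> plane \<Rightarrow> real" where
  "mollify e h z v = (LINT (y, w)|lborel. h (z - y) (v - w) * mollifier e (y, w))"

section \<open>Interaction kernels and force field\<close>

definition gfun :: "params \<Rightarrow> real \<Rightarrow> real" where
  "gfun P s = 2 / (1 + exp (- s / delta0 P)) - 1 + delta1 P"

fun kernel :: "params \<Rightarrow> interaction \<Rightarrow> plane \<Rightarrow> plane \<Rightarrow> plane \<Rightarrow> real" where
  "kernel P Co z v w =
     - C0 P * mollify (epsil P) (\<lambda>z v. cos (signed_angle z v)) z v
       * exp (- tau z (w - v) / C1 P) * gfun P (cross2 (w - v) z / (norm z)\<^sup>2)"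
| "kernel P Imm z v w = C2 P * exp (- norm z * tau z (w - v) / C3 P)"
| "kernel P Fo z v w =
     C4 P * exp (- \<bar>alpha_dot z (w - v)\<bar> * (norm z)\<^sup>2 / C5 P)
       * mollify (epsil P) (\<lambda>z v. sin (2 * signed_angle z v)) z v"

text \<open>The argument \<open>h\<close> is the phase space density \<open>f(t)\<close> at a fixed time.\<close>

definition rate :: "params \<Rightarrow> interaction \<Rightarrow> (phase \<Rightarrow> real) \<Rightarrow> plane \<Rightarrow> plane \<Rightarrow> real" where
  "rate P k h x v =
     (LINT (y, w)|lborel. indicat_real (inter_set P k v w) (y - x) * h (y, w)) + beta P"

definition Omega :: "params \<Rightarrow> interaction \<Rightarrow> (phase \<Rightarrow> real) \<Rightarrow> plane \<Rightarrow> plane \<Rightarrow> real" where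
  "Omega P k h x v =
     1 / rate P k h x v *
     (LINT (y, w)|lborel.
        kernel P k (y - x) v w * indicat_real (inter_set P k v w) (y - x) * h (y, w))"

definition grad :: "('a::euclidean_space \<Rightarrow> real) \<Rightarrow> 'a \<Rightarrow> 'a" where
  "grad V x = (THE D. GDERIV V x :> D)"

definition force :: "params \<Rightarrow> (plane \<Rightarrow> real) \<Rightarrow> (phase \<Rightarrow> real) \<Rightarrow> plane \<Rightarrow> plane \<Rightarrow> plane" where
  "force P V h x v =
     - grad V x + Omega P Co h x v *\<^sub>R perp v - Omega P Imm h x v *\<^sub>R v
     + Omega P Fo h x v *\<^sub>R perp v - sigma P *\<^sub>R v"

section \<open>Function spaces\<close>

definition L1_Linf_norm :: "(phase \<Rightarrow> real) \<Rightarrow> ennreal" where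
  "L1_Linf_norm h =
     (\<integral>\<^sup>+ p. ennreal \<bar>h p\<bar> \<partial>lborel) + esssup lborel (\<lambda>p. ennreal \<bar>h p\<bar>)"

definition in_L1_Linf :: "(phase \<Rightarrow> real) \<Rightarrow> bool" where
  "in_L1_Linf h \<longleftrightarrow> h \<in> borel_measurable lborel \<and> L1_Linf_norm h < \<infinity>"

definition ess_supp :: "(phase \<Rightarrow> real) \<Rightarrow> phase set" where
  "ess_supp h = {p. \<forall>U. open U \<and> p \<in> U \<longrightarrow> \<not> (AE q in lborel. q \<in> U \<longrightarrow> h q = 0)}"

text \<open>Norm in \<open>L\<^sup>\<infinity>(0, T; L\<^sup>1 \<inter> L\<^sup>\<infinity>)\<close>, and essential support in phase space over the whole of \<open>[0, T]\<close>
  of a time dependent density.\<close>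

definition sup_L1_Linf_norm :: "real \<Rightarrow> (real \<Rightarrow> phase \<Rightarrow> real) \<Rightarrow> ennreal" where
  "sup_L1_Linf_norm T f = esssup (restrict_space lborel {0..T}) (\<lambda>t. L1_Linf_norm (f t))"

definition phase_supp :: "real \<Rightarrow> (real \<Rightarrow> phase \<Rightarrow> real) \<Rightarrow> phase set" where
  "phase_supp T f = {p. \<forall>U. open U \<and> p \<in> U \<longrightarrow>
     \<not> (AE t in lborel. t \<in> {0..T} \<longrightarrow> (AE q in lborel. q \<in> U \<longrightarrow> f t q = 0))}"

text \<open>A density that is only specified for almost every time has a meaningful value \<open>f(t)\<close> only at
  the times at which it shares the properties that hold almost everywhere.\<close>

definition regular_time :: "real \<Rightarrow> (real \<Rightarrow> phase \<Rightarrow> real) \<Rightarrow> real \<Rightarrow> bool" where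
  "regular_time T f t \<longleftrightarrow>
     in_L1_Linf (f t) \<and> (AE p in lborel. 0 \<le> f t p) \<and>
     L1_Linf_norm (f t) \<le> sup_L1_Linf_norm T f \<and> ess_supp (f t) \<subseteq> phase_supp T f"

primrec Ck :: "nat \<Rightarrow> ('a::euclidean_space \<Rightarrow> real) \<Rightarrow> bool" where
  "Ck 0 f \<longleftrightarrow> continuous_on UNIV f"
| "Ck (Suc k) f \<longleftrightarrow>
     f differentiable_on UNIV \<and> (\<forall>h. Ck k (\<lambda>x. frechet_derivative f (at x) h))"

text \<open>Smooth functions on the whole space with compact support inside \<open>S\<close>. The elements of
  \<open>C\<^sub>c\<^sup>\<infinity>([0, T) \<times> \<real>\<^sup>2 \<times> \<real>\<^sup>2)\<close> are the restrictions to \<open>t \<ge> 0\<close> of such functions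
  for \<open>S = (-\<infinity>, T) \<times> \<real>\<^sup>2 \<times> \<real>\<^sup>2\<close>.\<close>

definition test_function :: "'a::euclidean_space set \<Rightarrow> ('a \<Rightarrow> real) \<Rightarrow> bool" where
  "test_function S \<phi> \<longleftrightarrow>
     (\<forall>k. Ck k \<phi>) \<and> compact (closure {p. \<phi> p \<noteq> 0}) \<and> closure {p. \<phi> p \<noteq> 0} \<subseteq> S"

section \<open>Weak solutions\<close>

definition weak_formulation ::
    "params \<Rightarrow> (plane \<Rightarrow> real) \<Rightarrow> real \<Rightarrow> (phase \<Rightarrow> real) \<Rightarrow> (real \<Rightarrow> phase \<Rightarrow> real) \<Rightarrow> bool" where
  "weak_formulation P V T f0 f \<longleftrightarrow>
     (\<forall>\<phi> :: real \<times> phase \<Rightarrow> real. test_function ({..<T} \<times> UNIV) \<phi> \<longrightarrow>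
        (LINT t:{0..T}|lborel. LINT (x, v)|lborel.
           f t (x, v) *
           (let D\<phi> = frechet_derivative \<phi> (at (t, x, v)) in
              D\<phi> (1, 0, 0) + D\<phi> (0, v, 0)
              - D\<phi> (0, 0, grad V x - Omega P Co (f t) x v *\<^sub>R perp v + Omega P Imm (f t) x v *\<^sub>R v
                         - Omega P Fo (f t) x v *\<^sub>R perp v + sigma P *\<^sub>R v)))
        + (LINT p|lborel. f0 p * \<phi> (0, p)) = 0)"

text \<open>The differential inequality for the energy is understood in the sense of distributions on
  \<open>(0, T)\<close>.\<close>

definition energy_inequality ::
    "params \<Rightarrow> (plane \<Rightarrow> real) \<Rightarrow> real \<Rightarrow> (real \<Rightarrow> phase \<Rightarrow> real) \<Rightarrow> bool" where
  "energy_inequality P V T f \<longleftrightarrow>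
     (\<forall>\<psi> :: real \<Rightarrow> real. test_function {0<..<T} \<psi> \<and> (\<forall>t. 0 \<le> \<psi> t) \<longrightarrow>
        - (LINT t:{0..T}|lborel.
             (LINT (x, v)|lborel. ((norm v)\<^sup>2 / 2 + V x) * f t (x, v)) * deriv \<psi> t)
        \<le> - (LINT t:{0..T}|lborel.
             (LINT (x, v)|lborel. (sigma P + Omega P Imm (f t) x v) * (norm v)\<^sup>2 * f t (x, v)) * \<psi> t))"

definition weak_solution ::
    "params \<Rightarrow> (plane \<Rightarrow> real) \<Rightarrow> real \<Rightarrow> (phase \<Rightarrow> real) \<Rightarrow> (real \<Rightarrow> phase \<Rightarrow> real) \<Rightarrow> bool" where
  "weak_solution P V T f0 f \<longleftrightarrow>
     set_borel_measurable lborel ({0..T} \<times> UNIV) (\<lambda>(t, p). f t p) \<and>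
     (\<exists>M. AE t in lborel. t \<in> {0..T} \<longrightarrow>
        (AE p in lborel. 0 \<le> f t p) \<and> in_L1_Linf (f t) \<and>
        integrable lborel (\<lambda>(x, v). ((norm x)\<^sup>2 + (norm v)\<^sup>2) * f t (x, v)) \<and>
        (LINT (x, v)|lborel. ((norm x)\<^sup>2 + (norm v)\<^sup>2) * f t (x, v)) < M) \<and>
     weak_formulation P V T f0 f \<and>
     energy_inequality P V T f"

end

theory Submission
  imports Defs
begin

text \<open>
  Fix a time and write \<open>h\<close> for the density, \<open>z = y - x\<close> and \<open>u = w - v\<close>. The rates and the numerators of
  \<open>Omega\<close> are integrals of \<open>a(z, v) 1\<^sub>C\<^sub>(\<^sub>v\<^sub>)(z) E(z, u) h(y, w)\<close> over \<open>(y, w)\<close>, where \<open>a\<close> is a mollified function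
  of the angle, \<open>C(v)\<close> is the vision cone, and \<open>E\<close> contains the interaction region and the exponentials. A
  displacement of \<open>(x, v)\<close> has three effects.

  It translates the argument of \<open>E\<close>. This function is discontinuous, and singular at \<open>u = 0\<close> and \<open>z = 0\<close>,
  but it is made of bounded monotone functions of ratios of polynomials. On each line, each of its
  superlevel sets is given by polynomial inequalities of bounded degree and therefore switches at most
  a fixed number of times (\<open>few_switches_poly\<close>). Hence the variation of \<open>E\<close> is bounded uniformly over all
  lines (\<open>profile_line_variation\<close>), and averaging over translations converts this into an \<open>L\<^sup>1\<close> bound for
  increments on balls (\<open>nn_integral_shift_ball\<close>), uniformly in \<open>x\<close> and \<open>v\<close>. Neither the kernels nor the
  boundaries of the regions are differentiated.

  It changes \<open>a\<close>, which is Lipschitz by the same principle applied to the mollifier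
  (\<open>mollify_bounded_lipschitz\<close>).

  It rotates the cone, by an angle of order \<open>\<parallel>v - v'\<parallel> / \<parallel>v\<parallel>\<close>. This is Lipschitz only after multiplication
  with \<open>\<parallel>v\<parallel>\<close>, which suffices because \<open>Omega\<close> occurs in the force as a factor of \<open>v\<close> or of its rotation. At
  distance \<open>\<parallel>z\<parallel>\<close> the cone sweeps an area proportional to \<open>\<parallel>z\<parallel>\<close>, while the velocities \<open>w\<close> that lead to a
  collision with a particle at this distance fill a strip of width of order \<open>(1 + \<parallel>v\<parallel>) / \<parallel>z\<parallel>\<close>. The product
  is bounded by a multiple of \<open>1 + \<parallel>v\<parallel>\<close> (\<open>cone_difference_bound\<close>), whence the factor in the theorem.

  These estimates require \<open>h\<close> to be bounded and to vanish outside a ball. The second property has to be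
  derived from the weak formulation (\<open>support_propagation\<close>). The drift is of linear growth, because the
  interaction coefficients are bounded, and so it changes \<open>1 + \<parallel>x\<parallel>\<^sup>2 + \<parallel>v\<parallel>\<^sup>2\<close> at most at an exponential rate
  \<open>K\<close>. Test functions that are cutoffs to balls expanding, respectively shrinking, at this rate show that
  the mass which starts in a ball never leaves the expanding ball, and that no further mass comes in
  from infinity.
\<close>

section \<open>Subsets of the line with few switches\<close>

text \<open>The indicator of \<open>A\<close> can change only across one of at most \<open>N\<close> points. This is all that is
  retained of semialgebraicity: it is stable under Boolean operations, it holds for polynomial
  inequalities, and it bounds the \<open>L\<^sup>1\<close> size of the increments of the indicator.\<close>

definition few_switches :: "nat \<Rightarrow> real set \<Rightarrow> bool" where
  "few_switches N A \<longleftrightarrow> (\<exists>E. finite E \<and> card E \<le> N \<and>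
     (\<forall>s t. s \<le> t \<longrightarrow> {s..t} \<inter> E = {} \<longrightarrow> (s \<in> A \<longleftrightarrow> t \<in> A)))"

lemma few_switches_const [simp]: "few_switches n {}" "few_switches n UNIV" "few_switches n {t. P}"
  unfolding few_switches_def by (auto intro: exI[of _ "{}"])

lemma few_switches_Compl: "few_switches n A \<Longrightarrow> few_switches n (- A)"
  unfolding few_switches_def by auto

lemma few_switches_Int:
  assumes "few_switches m A" "few_switches n B"
  shows "few_switches (m + n) (A \<inter> B)"
proof -
  obtain E where E: "finite E" "card E \<le> m"
    "\<And>s t. s \<le> t \<Longrightarrow> {s..t} \<inter> E = {} \<Longrightarrow> (s \<in> A \<longleftrightarrow> t \<in> A)"
    using assms(1) unfolding few_switches_def by blast
  obtain F where F: "finite F" "card F \<le> n"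
    "\<And>s t. s \<le> t \<Longrightarrow> {s..t} \<inter> F = {} \<Longrightarrow> (s \<in> B \<longleftrightarrow> t \<in> B)"
    using assms(2) unfolding few_switches_def by blast
  have "card (E \<union> F) \<le> m + n"
    using card_Un_le[of E F] E(2) F(2) by linarith
  moreover have "s \<in> A \<inter> B \<longleftrightarrow> t \<in> A \<inter> B" if "s \<le> t" "{s..t} \<inter> (E \<union> F) = {}" for s t
    using E(3)[of s t] F(3)[of s t] that by blast
  ultimately show ?thesis
    unfolding few_switches_def using E(1) F(1) by (intro exI[of _ "E \<union> F"]) auto
qed

lemma few_switches_Un:
  assumes "few_switches m A" "few_switches n B"
  shows "few_switches (m + n) (A \<union> B)"
  using few_switches_Compl[OF few_switches_Int[OF few_switches_Compl[OF assms(1)] few_switches_Compl[OF assms(2)]]]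
  by simp

text \<open>By the intermediate value theorem the sign can only change across a root; if \<open>p\<close> vanishes
  identically, it never does.\<close>

lemma few_switches_poly:
  fixes p :: "real poly"
  assumes "degree p \<le> n"
  shows "few_switches n {t. poly p t > 0}"
proof (cases "p = 0")
  case False
  let ?E = "{t. poly p t = 0}"
  have "finite ?E" using False by (rule poly_roots_finite)
  moreover have "card ?E \<le> n" using card_poly_roots_bound[OF False] assms by linarith
  moreover have "s \<in> {t. poly p t > 0} \<longleftrightarrow> t \<in> {t. poly p t > 0}" if "s \<le> t" "{s..t} \<inter> ?E = {}" for s t
  proof -
    have nz: "poly p x \<noteq> 0" if "s \<le> x" "x \<le> t" for x
      using that \<open>{s..t} \<inter> ?E = {}\<close> by auto
    have c: "continuous_on {s..t} (poly p)" by (intro continuous_intros)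
    have "\<not> (poly p s > 0 \<and> poly p t \<le> 0)"
      using IVT2'[of "poly p" t 0 s] c nz that(1) by auto
    moreover have "\<not> (poly p s \<le> 0 \<and> poly p t > 0)"
      using IVT'[of "poly p" s 0 t] c nz that(1) by auto
    ultimately show ?thesis by auto
  qed
  ultimately show ?thesis unfolding few_switches_def by blast
qed simp

text \<open>A convex set of reals is an interval, so it switches at most at its infimum and its supremum.\<close>

lemma few_switches_convex:
  fixes A :: "real set"
  assumes "convex A"
  shows "few_switches 2 A"
proof -
  let ?E = "(if bdd_below A then {Inf A} else {}) \<union> (if bdd_above A then {Sup A} else {})"
  have "card ?E \<le> 2" by (auto simp: card_insert_if)
  moreover have "finite ?E" by auto
  moreover have "s \<in> A \<longleftrightarrow> t \<in> A" if st: "s \<le> t" "{s..t} \<inter> ?E = {}" for s t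
  proof -
    have conv: "x \<in> A" if "a \<in> A" "b \<in> A" "a \<le> x" "x \<le> b" for a b x
      using mem_is_interval_1_I[of A a b x] assms that by (simp add: is_interval_convex_1)
    show ?thesis
    proof
      assume s: "s \<in> A"
      show "t \<in> A"
      proof (rule ccontr)
        assume t: "t \<notin> A"
        have ub: "x \<le> t" if "x \<in> A" for x
          using conv[OF s that st(1)] t by (meson linear)
        then have "bdd_above A" "Sup A \<le> t" "s \<le> Sup A"
          using s by (auto intro!: cSup_least cSup_upper bdd_aboveI)
        then show False using st(2) by auto
      qed
    next
      assume t: "t \<in> A"
      show "s \<in> A"
      proof (rule ccontr)
        assume s: "s \<notin> A"
        have lb: "s \<le> x" if "x \<in> A" for x
          using conv[OF that t _ st(1)] s by (meson linear)
        then have "bdd_below A" "s \<le> Inf A" "Inf A \<le> t"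
          using t by (auto intro!: cInf_greatest cInf_lower bdd_belowI)
        then show False using st(2) by auto
      qed
    qed
  qed
  ultimately show ?thesis unfolding few_switches_def by blast
qed

text \<open>If the indicator differs at \<open>t\<close> and \<open>t + d\<close>, then a switching point \<open>e\<close> lies in between, that is,
  \<open>t \<in> {e - d..e}\<close>; these \<open>N\<close> intervals have total length \<open>N * d\<close>.\<close>

lemma few_switches_shift:
  assumes "few_switches N A" "d \<ge> 0"
  shows "(\<integral>\<^sup>+ t. ennreal \<bar>indicat_real A (t + d) - indicat_real A t\<bar> \<partial>lborel) \<le> ennreal (real N * d)"
proof -
  obtain E where E: "finite E" "card E \<le> N"
    "\<And>s t. s \<le> t \<Longrightarrow> {s..t} \<inter> E = {} \<Longrightarrow> (s \<in> A \<longleftrightarrow> t \<in> A)"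
    using assms(1) unfolding few_switches_def by blast
  have "ennreal \<bar>indicat_real A (t + d) - indicat_real A t\<bar> \<le> (\<Sum>e\<in>E. indicator {e - d..e} t)" for t
  proof (cases "{t..t + d} \<inter> E = {}")
    case True
    then show ?thesis using E(3)[of t "t + d"] assms(2) by (auto simp: indicator_def)
  next
    case False
    then obtain e where e: "e \<in> E" "t \<le> e" "e \<le> t + d" by auto
    then have "(1::ennreal) \<le> (\<Sum>e\<in>E. indicator {e - d..e} t)"
      using sum_mono2[of E "{e}" "\<lambda>e. indicator {e - d..e} t :: ennreal"] E(1) by auto
    moreover have "ennreal \<bar>indicat_real A (t + d) - indicat_real A t\<bar> \<le> 1"
      by (auto simp: indicator_def)
    ultimately show ?thesis by (rule order_trans[rotated])
  qed
  then have "(\<integral>\<^sup>+ t. ennreal \<bar>indicat_real A (t + d) - indicat_real A t\<bar> \<partial>lborel)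
      \<le> (\<integral>\<^sup>+ t. (\<Sum>e\<in>E. indicator {e - d..e} t) \<partial>lborel)"
    by (intro nn_integral_mono)
  also have "\<dots> = (\<Sum>e\<in>E. ennreal d)"
    using assms(2) by (subst nn_integral_sum) auto
  also have "\<dots> = ennreal (real (card E) * d)"
    using assms(2) by (simp add: ennreal_mult ennreal_of_nat_eq_real_of_nat)
  also have "\<dots> \<le> ennreal (real N * d)"
    using E(2) assms(2) by (intro ennreal_leI mult_right_mono) auto
  finally show ?thesis .
qed

lemma layer_cake_diff:
  fixes a b B :: real
  assumes "0 \<le> a" "a \<le> B" "0 \<le> b" "b \<le> B"
  shows "ennreal \<bar>a - b\<bar> = (\<integral>\<^sup>+ c. ennreal \<bar>indicat_real {c<..} a - indicat_real {c<..} b\<bar> * indicator {0..B} c \<partial>lborel)"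
proof -
  have "(\<integral>\<^sup>+ c. ennreal \<bar>indicat_real {c<..} a - indicat_real {c<..} b\<bar> * indicator {0..B} c \<partial>lborel)
     = (\<integral>\<^sup>+ c. indicator {min a b..<max a b} c \<partial>lborel)"
    using assms by (intro nn_integral_cong) (auto simp: indicator_def)
  also have "\<dots> = ennreal \<bar>a - b\<bar>" by (auto simp: min_def max_def abs_if)
  finally show ?thesis by simp
qed

text \<open>Layer cake: the increment of \<open>h\<close> is the integral over the levels \<open>c \<in> {0..B}\<close> of the increment of the
  indicator of \<open>{h > c}\<close>, and each of these contributes at most \<open>N * d\<close>.\<close>

lemma level_switches_shift:
  fixes h :: "real \<Rightarrow> real"
  assumes [measurable]: "h \<in> borel_measurable borel"
    and B: "\<And>t. 0 \<le> h t" "\<And>t. h t \<le> B"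
    and sw: "\<And>c. few_switches N {t. h t > c}" and d: "d \<ge> 0"
  shows "(\<integral>\<^sup>+ t. ennreal \<bar>h (t + d) - h t\<bar> \<partial>lborel) \<le> ennreal (B * real N * d)"
proof -
  have "B \<ge> 0" using B[of 0] by linarith
  have "(\<integral>\<^sup>+ t. ennreal \<bar>h (t + d) - h t\<bar> \<partial>lborel) =
    (\<integral>\<^sup>+ t. (\<integral>\<^sup>+ c. ennreal \<bar>indicat_real {c<..} (h (t + d)) - indicat_real {c<..} (h t)\<bar> * indicator {0..B} c \<partial>lborel) \<partial>lborel)"
    using B by (intro nn_integral_cong layer_cake_diff) auto
  also have "\<dots> = (\<integral>\<^sup>+ c. (\<integral>\<^sup>+ t. ennreal \<bar>indicat_real {c<..} (h (t + d)) - indicat_real {c<..} (h t)\<bar> * indicator {0..B} c \<partial>lborel) \<partial>lborel)"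
  proof (rule lborel_pair.Fubini')
    have [measurable]: "(\<lambda>(c, t). indicat_real {c<..} (h (t + d))) \<in> borel_measurable (lborel \<Otimes>\<^sub>M lborel)"
      "(\<lambda>(c, t). indicat_real {c<..} (h t)) \<in> borel_measurable (lborel \<Otimes>\<^sub>M lborel)"
      unfolding indicator_def greaterThan_iff by measurable
    show "(\<lambda>(c, t). ennreal \<bar>indicat_real {c<..} (h (t + d)) - indicat_real {c<..} (h t)\<bar> * indicator {0..B} c)
       \<in> borel_measurable (lborel \<Otimes>\<^sub>M lborel)"
      by measurable
  qed
  also have "\<dots> \<le> (\<integral>\<^sup>+ c. ennreal (real N * d) * indicator {0..B} c \<partial>lborel)"
  proof (intro nn_integral_mono)
    fix c
    have "(\<integral>\<^sup>+ t. ennreal \<bar>indicat_real {c<..} (h (t + d)) - indicat_real {c<..} (h t)\<bar> \<partial>lborel) \<le> ennreal (real N * d)"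
      using few_switches_shift[OF sw[of c] d] by (simp add: indicator_def)
    then show "(\<integral>\<^sup>+ t. ennreal \<bar>indicat_real {c<..} (h (t + d)) - indicat_real {c<..} (h t)\<bar> * indicator {0..B} c \<partial>lborel)
        \<le> ennreal (real N * d) * indicator {0..B} c"
      by (auto simp: indicator_def)
  qed
  also have "\<dots> = ennreal (B * real N * d)"
    using \<open>B \<ge> 0\<close> d by (simp add: nn_integral_cmult ennreal_mult[symmetric] mult.commute mult.assoc)
  finally show ?thesis .
qed

section \<open>Polynomial inequalities along lines\<close>

lemma few_switches_poly_compl: "degree (p :: real poly) \<le> n \<Longrightarrow> few_switches n {t. \<not> poly p t > 0}"
  using few_switches_Compl[OF few_switches_poly] by (simp add: Compl_eq)

text \<open>Polynomials on a vector space are used only through their restrictions to lines. What matters is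
  that one degree bound serves all lines.\<close>

definition line_poly :: "('a::real_vector \<Rightarrow> real) \<Rightarrow> bool" where
  "line_poly P \<longleftrightarrow> (\<exists>d. \<forall>p e. \<exists>r. degree r \<le> d \<and> (\<forall>t. P (p + t *\<^sub>R e) = poly r t))"

lemma line_poly_const: "line_poly (\<lambda>_. c)"
  unfolding line_poly_def by (intro exI[of _ 0] allI exI[of _ "[:c:]"]) auto

lemma line_poly_linear:
  assumes "linear f" shows "line_poly f"
  unfolding line_poly_def
proof (intro exI[of _ "1::nat"] allI)
  fix p e
  show "\<exists>r. degree r \<le> 1 \<and> (\<forall>t. f (p + t *\<^sub>R e) = poly r t)"
    by (intro exI[of _ "[:f p, f e:]"]) (auto simp: linear_add[OF assms] linear_cmul[OF assms])
qed

lemma line_poly_add: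
  assumes "line_poly P" "line_poly Q" shows "line_poly (\<lambda>x. P x + Q x)"
proof -
  obtain d1 d2 where
    1: "\<And>p e. \<exists>r. degree r \<le> d1 \<and> (\<forall>t. P (p + t *\<^sub>R e) = poly r t)" and
    2: "\<And>p e. \<exists>r. degree r \<le> d2 \<and> (\<forall>t. Q (p + t *\<^sub>R e) = poly r t)"
    using assms unfolding line_poly_def by metis
  show ?thesis unfolding line_poly_def
  proof (intro exI[of _ "max d1 d2"] allI)
    fix p e
    obtain r s where "degree r \<le> d1" "\<And>t. P (p + t *\<^sub>R e) = poly r t"
      "degree s \<le> d2" "\<And>t. Q (p + t *\<^sub>R e) = poly s t"
      using 1[of p e] 2[of p e] by blast
    then show "\<exists>q. degree q \<le> max d1 d2 \<and> (\<forall>t. P (p + t *\<^sub>R e) + Q (p + t *\<^sub>R e) = poly q t)"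
      by (intro exI[of _ "r + s"]) (auto intro!: degree_add_le)
  qed
qed

lemma line_poly_mult:
  assumes "line_poly P" "line_poly Q" shows "line_poly (\<lambda>x. P x * Q x)"
proof -
  obtain d1 d2 where
    1: "\<And>p e. \<exists>r. degree r \<le> d1 \<and> (\<forall>t. P (p + t *\<^sub>R e) = poly r t)" and
    2: "\<And>p e. \<exists>r. degree r \<le> d2 \<and> (\<forall>t. Q (p + t *\<^sub>R e) = poly r t)"
    using assms unfolding line_poly_def by metis
  show ?thesis unfolding line_poly_def
  proof (intro exI[of _ "d1 + d2"] allI)
    fix p e
    obtain r s where "degree r \<le> d1" "\<And>t. P (p + t *\<^sub>R e) = poly r t"
      "degree s \<le> d2" "\<And>t. Q (p + t *\<^sub>R e) = poly s t"
      using 1[of p e] 2[of p e] by blast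
    then show "\<exists>q. degree q \<le> d1 + d2 \<and> (\<forall>t. P (p + t *\<^sub>R e) * Q (p + t *\<^sub>R e) = poly q t)"
      by (intro exI[of _ "r * s"]) (auto intro: order_trans[OF degree_mult_le])
  qed
qed

lemma line_poly_minus: "line_poly P \<Longrightarrow> line_poly (\<lambda>x. - P x)"
  using line_poly_mult[OF line_poly_const[of "-1"]] by simp

lemma line_poly_diff: "line_poly P \<Longrightarrow> line_poly Q \<Longrightarrow> line_poly (\<lambda>x. P x - Q x)"
  using line_poly_add[OF _ line_poly_minus] by force

lemma line_poly_power: "line_poly P \<Longrightarrow> line_poly (\<lambda>x. P x ^ n)"
  by (induction n) (auto intro: line_poly_const line_poly_mult)

lemmas line_poly_intros = line_poly_const line_poly_add line_poly_mult line_poly_minus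
  line_poly_diff line_poly_power

text \<open>One bound for all lines: the uniformity in \<open>x\<close>, \<open>v\<close> and \<open>w\<close> of the final estimates stems from here.\<close>

definition tame_set :: "'a::real_vector set \<Rightarrow> bool" where
  "tame_set S \<longleftrightarrow> (\<exists>N. \<forall>p e. few_switches N {t. p + t *\<^sub>R e \<in> S})"

lemma tame_set_Compl:
  assumes "tame_set S" shows "tame_set (- S)"
proof -
  have *: "{t. p + t *\<^sub>R e \<in> - S} = - {t. p + t *\<^sub>R e \<in> S}" for p e by auto
  show ?thesis using assms unfolding tame_set_def * by (blast intro: few_switches_Compl)
qed

lemma tame_set_Int:
  assumes "tame_set S" "tame_set T" shows "tame_set (S \<inter> T)"
proof -
  obtain m n where "\<And>p e. few_switches m {t. p + t *\<^sub>R e \<in> S}" "\<And>p e. few_switches n {t. p + t *\<^sub>R e \<in> T}"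
    using assms unfolding tame_set_def by blast
  then have "few_switches (m + n) {t. p + t *\<^sub>R e \<in> S \<inter> T}" for p e
    using few_switches_Int[of m "{t. p + t *\<^sub>R e \<in> S}" n "{t. p + t *\<^sub>R e \<in> T}"]
    by (simp add: Int_def)
  then show ?thesis unfolding tame_set_def by blast
qed

lemma tame_set_Un: "tame_set S \<Longrightarrow> tame_set T \<Longrightarrow> tame_set (S \<union> T)"
  using tame_set_Compl[OF tame_set_Int[OF tame_set_Compl tame_set_Compl]] by fastforce

lemma tame_set_pos:
  assumes "line_poly P" shows "tame_set {x. P x > 0}"
proof -
  obtain d where d: "\<And>p e. \<exists>r. degree r \<le> d \<and> (\<forall>t. P (p + t *\<^sub>R e) = poly r t)"
    using assms unfolding line_poly_def by metis
  have "few_switches d {t. p + t *\<^sub>R e \<in> {x. P x > 0}}" for p e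
  proof -
    obtain r where r: "degree r \<le> d" "\<And>t. P (p + t *\<^sub>R e) = poly r t" using d by metis
    then show ?thesis using few_switches_poly[OF r(1)] by simp
  qed
  then show ?thesis unfolding tame_set_def by blast
qed

lemma tame_set_less: "line_poly P \<Longrightarrow> line_poly Q \<Longrightarrow> tame_set {x. P x < Q x}"
  using tame_set_pos[OF line_poly_diff[of Q P]] by simp

text \<open>Strict and weak superlevel sets are both required, because a superlevel set of \<open>\<phi> \<circ> h\<close> with \<open>\<phi>\<close> monotone
  is a superlevel set of \<open>h\<close> of one of the two kinds (or trivial).\<close>

definition tame_fun :: "('a::real_vector \<Rightarrow> real) \<Rightarrow> bool" where
  "tame_fun h \<longleftrightarrow> (\<exists>N. \<forall>p e c. few_switches N {t. h (p + t *\<^sub>R e) > c} \<and> few_switches N {t. h (p + t *\<^sub>R e) \<ge> c})"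

text \<open>Multiplication with the denominator turns \<open>P / Q > c\<close> into a polynomial inequality. Where \<open>Q\<close>
  vanishes the quotient is \<open>0\<close> by convention, and the set of these points is itself polynomial.\<close>

lemma tame_fun_ratio:
  assumes "line_poly P" "line_poly Q" and nonneg: "\<And>x. Q x \<ge> 0"
  shows "tame_fun (\<lambda>x. P x / Q x)"
proof -
  obtain d1 d2 where
    1: "\<And>p e. \<exists>r. degree r \<le> d1 \<and> (\<forall>t. P (p + t *\<^sub>R e) = poly r t)" and
    2: "\<And>p e. \<exists>r. degree r \<le> d2 \<and> (\<forall>t. Q (p + t *\<^sub>R e) = poly r t)"
    using assms unfolding line_poly_def by metis
  let ?N = "(d2 + max d1 d2) + (d2 + 0)"
  have "few_switches ?N {t. P (p + t *\<^sub>R e) / Q (p + t *\<^sub>R e) > c} \<and>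
        few_switches ?N {t. P (p + t *\<^sub>R e) / Q (p + t *\<^sub>R e) \<ge> c}" for p e c
  proof -
    obtain r s where r: "degree r \<le> d1" "\<And>t. P (p + t *\<^sub>R e) = poly r t"
      and s: "degree s \<le> d2" "\<And>t. Q (p + t *\<^sub>R e) = poly s t"
      using 1[of p e] 2[of p e] by blast
    have s0: "poly s t \<ge> 0" for t using nonneg[of "p + t *\<^sub>R e"] s(2) by simp
    have dg: "degree (r - smult c s) \<le> max d1 d2" "degree (smult c s - r) \<le> max d1 d2"
      using r(1) s(1) by (auto intro!: degree_diff_le order_trans[OF degree_smult_le])
    have a: "{t. P (p + t *\<^sub>R e) / Q (p + t *\<^sub>R e) > c} =
      ({t. poly s t > 0} \<inter> {t. poly (r - smult c s) t > 0}) \<union> ({t. \<not> poly s t > 0} \<inter> {t. 0 > c})" (is "?L = ?R")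
    proof (intro set_eqI)
      fix t
      show "t \<in> ?L \<longleftrightarrow> t \<in> ?R"
        using s0[of t] by (cases "poly s t = 0") (auto simp: r(2) s(2) pos_less_divide_eq pos_le_divide_eq)
    qed
    have b: "{t. P (p + t *\<^sub>R e) / Q (p + t *\<^sub>R e) \<ge> c} =
      ({t. poly s t > 0} \<inter> {t. \<not> poly (smult c s - r) t > 0}) \<union> ({t. \<not> poly s t > 0} \<inter> {t. 0 \<ge> c})" (is "?L = ?R")
    proof (intro set_eqI)
      fix t
      show "t \<in> ?L \<longleftrightarrow> t \<in> ?R"
        using s0[of t] by (cases "poly s t = 0") (auto simp: r(2) s(2) pos_less_divide_eq pos_le_divide_eq)
    qed
    show ?thesis
      unfolding a b
      by (intro conjI few_switches_Un few_switches_Int few_switches_poly few_switches_poly_compl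
          s(1) dg few_switches_const)
  qed
  then show ?thesis unfolding tame_fun_def by blast
qed

lemma upper_set_real:
  fixes U :: "real set"
  assumes "\<And>x y. x \<in> U \<Longrightarrow> x \<le> y \<Longrightarrow> y \<in> U"
  obtains "U = {}" | "U = UNIV" | a where "U = {a<..}" | a where "U = {a..}"
proof -
  consider "U = {}" | "U = UNIV" | "U \<noteq> {}" "U \<noteq> UNIV" by blast
  then show ?thesis
  proof cases
    case 3
    then obtain z where z: "z \<notin> U" by blast
    have bb: "bdd_below U" using assms z by (intro bdd_belowI[of _ z]) (meson linear)
    have "x \<in> U" if "Inf U < x" for x
      using that assms bb 3(1) by (meson cInf_less_iff less_imp_le)
    moreover have "Inf U \<le> x" if "x \<in> U" for x using that bb by (rule cInf_lower)
    ultimately have "U = {Inf U<..} \<or> U = {Inf U..}"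
      by (cases "Inf U \<in> U") (auto simp: order.order_iff_strict)
    then show ?thesis using that by blast
  qed (use that in auto)
qed

text \<open>A superlevel set of \<open>\<phi>\<close> is upward closed, hence a half-line, everything or nothing.\<close>

lemma tame_fun_mono:
  assumes "tame_fun h" "mono \<phi>"
  shows "tame_fun (\<lambda>x. \<phi> (h x))"
proof -
  obtain N where N: "\<And>p e c. few_switches N {t. h (p + t *\<^sub>R e) > c}" "\<And>p e c. few_switches N {t. h (p + t *\<^sub>R e) \<ge> c}"
    using assms unfolding tame_fun_def by blast
  have up: "few_switches N {t. h (p + t *\<^sub>R e) \<in> U}" if U: "\<And>x y. x \<in> U \<Longrightarrow> x \<le> y \<Longrightarrow> y \<in> U" for U p e
    by (rule upper_set_real[of U]) (use U N in auto)
  have "few_switches N {t. \<phi> (h (p + t *\<^sub>R e)) > c}" "few_switches N {t. \<phi> (h (p + t *\<^sub>R e)) \<ge> c}" for p e c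
    using up[of "{x. \<phi> x > c}" p e] up[of "{x. \<phi> x \<ge> c}" p e] assms(2)
    by (auto simp: mono_def intro: order_trans less_le_trans)
  then show ?thesis unfolding tame_fun_def by blast
qed

lemma tame_fun_uminus:
  assumes "tame_fun h"
  shows "tame_fun (\<lambda>x. - h x)"
proof -
  obtain N where N: "\<And>p e c. few_switches N {t. h (p + t *\<^sub>R e) > c}" "\<And>p e c. few_switches N {t. h (p + t *\<^sub>R e) \<ge> c}"
    using assms unfolding tame_fun_def by blast
  have a: "{t. - h (p + t *\<^sub>R e) > c} = - {t. h (p + t *\<^sub>R e) \<ge> - c}"
    "{t. - h (p + t *\<^sub>R e) \<ge> c} = - {t. h (p + t *\<^sub>R e) > - c}" for p e c by auto
  show ?thesis unfolding tame_fun_def a using N by (intro exI[of _ N]) (auto intro: few_switches_Compl)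
qed

lemma tame_fun_antimono:
  assumes "tame_fun h" "antimono \<phi>"
  shows "tame_fun (\<lambda>x. \<phi> (h x))"
proof -
  have "mono (\<lambda>x. \<phi> (- x))" using assms(2) by (auto simp: mono_def antimono_def)
  from tame_fun_mono[OF tame_fun_uminus[OF assms(1)] this] show ?thesis by simp
qed

section \<open>Variation along lines\<close>

text \<open>If the restrictions of \<open>F\<close> to all lines had total variation at most \<open>A\<close>, their increments would be
  bounded in this way. The increments are what the averaging argument below needs.\<close>

definition line_variation :: "real \<Rightarrow> ('a::euclidean_space \<Rightarrow> real) \<Rightarrow> bool" where
  "line_variation A F \<longleftrightarrow> F \<in> borel_measurable borel \<and>
     (\<forall>p e d. 0 \<le> d \<longrightarrow>
        (\<integral>\<^sup>+ t. ennreal \<bar>F (p + (t + d) *\<^sub>R e) - F (p + t *\<^sub>R e)\<bar> \<partial>lborel) \<le> ennreal (A * d))"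

lemma tame_fun_line_variation:
  fixes h :: "'a::euclidean_space \<Rightarrow> real"
  assumes "tame_fun h" and [measurable]: "h \<in> borel_measurable borel"
    and B: "\<And>x. 0 \<le> h x" "\<And>x. h x \<le> B"
  obtains A where "A \<ge> 0" "line_variation A h"
proof -
  obtain N where N: "\<And>p e c. few_switches N {t. h (p + t *\<^sub>R e) > c}"
    using assms unfolding tame_fun_def by blast
  have "B \<ge> 0" using B[of 0] by linarith
  have "line_variation (B * real N) h"
    unfolding line_variation_def
  proof (intro conjI allI impI)
    fix p e :: 'a and d :: real assume "0 \<le> d"
    then show "(\<integral>\<^sup>+ t. ennreal \<bar>h (p + (t + d) *\<^sub>R e) - h (p + t *\<^sub>R e)\<bar> \<partial>lborel) \<le> ennreal (B * real N * d)"
      using N B by (intro level_switches_shift[of "\<lambda>t. h (p + t *\<^sub>R e)"]) auto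
  qed simp
  then show ?thesis using that[of "B * real N"] \<open>B \<ge> 0\<close> by simp
qed

lemma switches_line_variation:
  fixes S :: "'a::euclidean_space set"
  assumes "\<And>p e. few_switches N {t. p + t *\<^sub>R e \<in> S}" "S \<in> sets borel"
  shows "line_variation (real N) (indicat_real S)"
  unfolding line_variation_def
proof (intro conjI allI impI)
  fix p e :: 'a and d :: real assume "0 \<le> d"
  then show "(\<integral>\<^sup>+ t. ennreal \<bar>indicat_real S (p + (t + d) *\<^sub>R e) - indicat_real S (p + t *\<^sub>R e)\<bar> \<partial>lborel) \<le> ennreal (real N * d)"
    using few_switches_shift[OF assms(1)[of p e], of d] by (simp add: indicator_def)
qed (use assms(2) in simp)

lemma tame_set_line_variation:
  fixes S :: "'a::euclidean_space set"
  assumes "tame_set S" "S \<in> sets borel"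
  obtains A where "A \<ge> 0" "line_variation A (indicat_real S)"
proof -
  obtain N where "\<And>p e. few_switches N {t. p + t *\<^sub>R e \<in> S}"
    using assms unfolding tame_set_def by blast
  from switches_line_variation[OF this assms(2)] show ?thesis using that[of "real N"] by simp
qed

lemma few_switches_line_convex:
  assumes "convex S"
  shows "few_switches 2 {t. p + t *\<^sub>R e \<in> S}"
proof (rule few_switches_convex, rule convexI)
  fix x y u v :: real
  assume *: "x \<in> {t. p + t *\<^sub>R e \<in> S}" "y \<in> {t. p + t *\<^sub>R e \<in> S}" "0 \<le> u" "0 \<le> v" "u + v = 1"
  then have "u *\<^sub>R (p + x *\<^sub>R e) + v *\<^sub>R (p + y *\<^sub>R e) \<in> S"
    using assms by (auto intro!: convexD)
  moreover have "u *\<^sub>R (p + x *\<^sub>R e) + v *\<^sub>R (p + y *\<^sub>R e) = (u + v) *\<^sub>R p + (u * x + v * y) *\<^sub>R e"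
    by (simp add: algebra_simps)
  ultimately show "u *\<^sub>R x + v *\<^sub>R y \<in> {t. p + t *\<^sub>R e \<in> S}" using *(5) by simp
qed

text \<open>Increments of a product obey the Leibniz rule.\<close>

lemma line_variation_mult:
  assumes F: "line_variation A F" and G: "line_variation B G"
    and M: "\<And>x. \<bar>F x\<bar> \<le> M" and K: "\<And>x. \<bar>G x\<bar> \<le> K" and "A \<ge> 0" "B \<ge> 0"
  shows "line_variation (K * A + M * B) (\<lambda>x. F x * G x)"
  unfolding line_variation_def
proof (intro conjI allI impI)
  have [measurable]: "F \<in> borel_measurable borel" "G \<in> borel_measurable borel"
    using F G unfolding line_variation_def by auto
  show "(\<lambda>x. F x * G x) \<in> borel_measurable borel" by measurable
  fix p e and d :: real assume d: "0 \<le> d"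
  have "0 \<le> M" "0 \<le> K" using M[of 0] K[of 0] by linarith+
  let ?f = "\<lambda>t. F (p + t *\<^sub>R e)" and ?g = "\<lambda>t. G (p + t *\<^sub>R e)"
  have "(\<integral>\<^sup>+ t. ennreal \<bar>?f (t + d) * ?g (t + d) - ?f t * ?g t\<bar> \<partial>lborel)
     \<le> (\<integral>\<^sup>+ t. ennreal K * ennreal \<bar>?f (t + d) - ?f t\<bar> + ennreal M * ennreal \<bar>?g (t + d) - ?g t\<bar> \<partial>lborel)"
  proof (intro nn_integral_mono)
    fix t
    have "?f (t + d) * ?g (t + d) - ?f t * ?g t = ?g (t + d) * (?f (t + d) - ?f t) + ?f t * (?g (t + d) - ?g t)"
      by (simp add: algebra_simps)
    then have "\<bar>?f (t + d) * ?g (t + d) - ?f t * ?g t\<bar> \<le> \<bar>?g (t + d)\<bar> * \<bar>?f (t + d) - ?f t\<bar> + \<bar>?f t\<bar> * \<bar>?g (t + d) - ?g t\<bar>"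
      by (metis abs_mult abs_triangle_ineq)
    also have "\<dots> \<le> K * \<bar>?f (t + d) - ?f t\<bar> + M * \<bar>?g (t + d) - ?g t\<bar>"
      using M K by (intro add_mono mult_right_mono) auto
    finally show "ennreal \<bar>?f (t + d) * ?g (t + d) - ?f t * ?g t\<bar>
        \<le> ennreal K * ennreal \<bar>?f (t + d) - ?f t\<bar> + ennreal M * ennreal \<bar>?g (t + d) - ?g t\<bar>"
      using \<open>0 \<le> M\<close> \<open>0 \<le> K\<close> by (simp add: ennreal_mult[symmetric] ennreal_plus[symmetric] ennreal_leI del: ennreal_plus)
  qed
  also have "\<dots> = ennreal K * (\<integral>\<^sup>+ t. ennreal \<bar>?f (t + d) - ?f t\<bar> \<partial>lborel)
      + ennreal M * (\<integral>\<^sup>+ t. ennreal \<bar>?g (t + d) - ?g t\<bar> \<partial>lborel)"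
    by (subst nn_integral_add) (auto simp: nn_integral_cmult)
  also have "\<dots> \<le> ennreal K * ennreal (A * d) + ennreal M * ennreal (B * d)"
    using F G d unfolding line_variation_def by (intro add_mono mult_left_mono) auto
  also have "\<dots> = ennreal ((K * A + M * B) * d)"
    using \<open>0 \<le> M\<close> \<open>0 \<le> K\<close> d assms by (simp add: ennreal_mult[symmetric] ennreal_plus[symmetric] algebra_simps del: ennreal_plus)
  finally show "(\<integral>\<^sup>+ t. ennreal \<bar>?f (t + d) * ?g (t + d) - ?f t * ?g t\<bar> \<partial>lborel) \<le> ennreal ((K * A + M * B) * d)" .
qed

section \<open>Averaging along a direction\<close>

lemma nn_integral_lborel_shift:
  fixes c :: "'a::euclidean_space"
  assumes [measurable]: "f \<in> borel_measurable borel"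
  shows "(\<integral>\<^sup>+ x. f (x + c) \<partial>lborel) = (\<integral>\<^sup>+ x. f x \<partial>lborel)"
proof -
  have "(\<integral>\<^sup>+ x. f x \<partial>lborel) = (\<integral>\<^sup>+ x. f x \<partial>distr lborel borel ((+) c))"
    by (simp add: lborel_distr_plus)
  also have "\<dots> = (\<integral>\<^sup>+ x. f (c + x) \<partial>lborel)" by (subst nn_integral_distr) auto
  finally show ?thesis by (simp add: add.commute)
qed

text \<open>Lebesgue measure is invariant under translations, so an integral over a ball is at most its average
  over the translates by \<open>t *\<^sub>R e\<close> with \<open>t \<in> {0..1}\<close>, taken over the ball enlarged by one. By Fubini
  it then suffices to estimate integrals along segments of unit length in one well chosen direction.\<close>

lemma nn_integral_ball_le_average:
  fixes e c :: "'a::euclidean_space"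
  assumes [measurable]: "G \<in> borel_measurable borel" and e: "norm e \<le> 1"
    and K: "\<And>p. p \<in> cball c (r + 1) \<Longrightarrow> (\<integral>\<^sup>+ t. G (p + t *\<^sub>R e) * indicator {0..1} t \<partial>lborel) \<le> H p"
  shows "(\<integral>\<^sup>+ p. G p * indicator (cball c r) p \<partial>lborel) \<le> (\<integral>\<^sup>+ p. H p * indicator (cball c (r + 1)) p \<partial>lborel)"
proof -
  let ?I = "\<integral>\<^sup>+ p. G p * indicator (cball c r) p \<partial>lborel"
  have [measurable]: "cball c r \<in> sets borel" "cball c (r + 1) \<in> sets borel" by auto
  have "?I = (\<integral>\<^sup>+ t. ?I * indicator {0..1::real} t \<partial>lborel)"
    by (subst nn_integral_cmult) auto
  also have "\<dots> \<le> (\<integral>\<^sup>+ t. (\<integral>\<^sup>+ p. G (p + t *\<^sub>R e) * indicator {0..1} t * indicator (cball c (r + 1)) p \<partial>lborel) \<partial>lborel)"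
  proof (rule nn_integral_mono)
    fix t :: real
    show "?I * indicator {0..1} t \<le> (\<integral>\<^sup>+ p. G (p + t *\<^sub>R e) * indicator {0..1} t * indicator (cball c (r + 1)) p \<partial>lborel)"
    proof (cases "t \<in> {0..1}")
      case True
      have "?I = (\<integral>\<^sup>+ p. G (p + t *\<^sub>R e) * indicator (cball c r) (p + t *\<^sub>R e) \<partial>lborel)"
        by (rule nn_integral_lborel_shift[symmetric]) measurable
      also have "\<dots> \<le> (\<integral>\<^sup>+ p. G (p + t *\<^sub>R e) * indicator (cball c (r + 1)) p \<partial>lborel)"
      proof (intro nn_integral_mono mult_left_mono)
        fix p
        have "norm (t *\<^sub>R e) \<le> 1" using True e by (simp add: mult_le_one)
        then have "p \<in> cball c (r + 1)" if "p + t *\<^sub>R e \<in> cball c r"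
          using that norm_triangle_ineq4[of "c - p" "0"] norm_triangle_ineq[of "c - (p + t *\<^sub>R e)" "t *\<^sub>R e"]
          by (auto simp: dist_norm)
        then show "indicator (cball c r) (p + t *\<^sub>R e) \<le> (indicator (cball c (r + 1)) p :: ennreal)"
          by (auto simp: indicator_def)
      qed auto
      finally show ?thesis using True by simp
    qed simp
  qed
  also have "\<dots> = (\<integral>\<^sup>+ p. (\<integral>\<^sup>+ t. G (p + t *\<^sub>R e) * indicator {0..1} t * indicator (cball c (r + 1)) p \<partial>lborel) \<partial>lborel)"
    by (rule lborel_pair.Fubini') measurable
  also have "\<dots> = (\<integral>\<^sup>+ p. (\<integral>\<^sup>+ t. G (p + t *\<^sub>R e) * indicator {0..1} t \<partial>lborel) * indicator (cball c (r + 1)) p \<partial>lborel)"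
    by (intro nn_integral_cong nn_integral_multc) measurable
  also have "\<dots> \<le> (\<integral>\<^sup>+ p. H p * indicator (cball c (r + 1)) p \<partial>lborel)"
    using K by (intro nn_integral_mono) (auto simp: indicator_def)
  finally show ?thesis .
qed

text \<open>The averaging direction is that of \<open>d\<close> itself. The constant depends on the radius only, not on the
  centre \<open>c\<close>.\<close>

lemma nn_integral_shift_ball:
  fixes d c :: "'a::euclidean_space"
  assumes F: "line_variation A F" and "A \<ge> 0"
  shows "(\<integral>\<^sup>+ p. ennreal \<bar>F (p + d) - F p\<bar> * indicator (cball c r) p \<partial>lborel)
    \<le> ennreal (A * norm d) * emeasure lborel (cball c (r + 1))"
proof (cases "d = 0")
  case False
  define e where "e = d /\<^sub>R norm d"
  have e: "norm e \<le> 1" "d = norm d *\<^sub>R e" using False by (auto simp: e_def)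
  have [measurable]: "F \<in> borel_measurable borel" using F unfolding line_variation_def by auto
  have "(\<integral>\<^sup>+ p. ennreal \<bar>F (p + d) - F p\<bar> * indicator (cball c r) p \<partial>lborel)
     \<le> (\<integral>\<^sup>+ p. ennreal (A * norm d) * indicator (cball c (r + 1)) p \<partial>lborel)"
  proof (rule nn_integral_ball_le_average[OF _ e(1)])
    fix p :: 'a
    have "(\<integral>\<^sup>+ t. ennreal \<bar>F (p + t *\<^sub>R e + d) - F (p + t *\<^sub>R e)\<bar> * indicator {0..1} t \<partial>lborel)
       \<le> (\<integral>\<^sup>+ t. ennreal \<bar>F (p + (t + norm d) *\<^sub>R e) - F (p + t *\<^sub>R e)\<bar> \<partial>lborel)"
      using e(2) by (intro nn_integral_mono) (auto simp: indicator_def scaleR_add_left add.assoc[symmetric])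
    also have "\<dots> \<le> ennreal (A * norm d)" using F unfolding line_variation_def by auto
    finally show "(\<integral>\<^sup>+ t. ennreal \<bar>F (p + t *\<^sub>R e + d) - F (p + t *\<^sub>R e)\<bar> * indicator {0..1} t \<partial>lborel) \<le> ennreal (A * norm d)" .
  qed measurable
  also have "\<dots> = ennreal (A * norm d) * emeasure lborel (cball c (r + 1))"
    by (subst nn_integral_cmult_indicator) auto
  finally show ?thesis .
qed simp

section \<open>Plane geometry\<close>

lemma inner_plane: "inner u v = u$1 * v$1 + u$2 * v$2" for u v :: plane
  by (simp add: inner_vec_def sum_2)

lemma norm_plane_sq: "(norm u)\<^sup>2 = (u$1)\<^sup>2 + (u$2)\<^sup>2" for u :: plane
  unfolding power2_norm_eq_inner inner_plane by (simp add: power2_eq_square)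

lemma perp_nth [simp]: "perp v $ 1 = - (v$2)" "perp v $ 2 = v$1"
  by (simp_all add: perp_def)

lemma lagrange_plane: "(cross2 z u)\<^sup>2 + (inner z u)\<^sup>2 = (norm z)\<^sup>2 * (norm u)\<^sup>2"
  unfolding cross2_def inner_plane norm_plane_sq by (simp add: power2_eq_square algebra_simps)

lemma norm_perp [simp]: "norm (perp v) = norm v"
proof -
  have "(norm (perp v))\<^sup>2 = (norm v)\<^sup>2" by (simp add: norm_plane_sq)
  then show ?thesis by simp
qed

lemma measurable_plane_nth [measurable]: "(\<lambda>x::plane. x $ i) \<in> borel_measurable borel"
  by (intro borel_measurable_continuous_onI continuous_intros)

lemma measurable_fst_snd_phase [measurable]:
  "(fst :: phase \<Rightarrow> plane) \<in> borel_measurable borel" "(snd :: phase \<Rightarrow> plane) \<in> borel_measurable borel"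
  by (intro borel_measurable_continuous_onI continuous_intros)+

lemma measurable_geometry [measurable (raw)]:
  assumes [measurable]: "f \<in> borel_measurable M" "g \<in> borel_measurable M"
  shows "(\<lambda>x. cross2 (f x) (g x)) \<in> borel_measurable M" "(\<lambda>x. tau (f x) (g x)) \<in> borel_measurable M"
    "(\<lambda>x. dist_closest (f x) (g x)) \<in> borel_measurable M" "(\<lambda>x. alpha_dot (f x) (g x)) \<in> borel_measurable M"
  unfolding cross2_def tau_def dist_closest_def alpha_dot_def by measurable

lemma measurable_gfun [measurable (raw)]:
  assumes [measurable]: "f \<in> borel_measurable M"
  shows "(\<lambda>x. gfun P (f x)) \<in> borel_measurable M"
  unfolding gfun_def by measurable

lemma measurable_interaction_sets [measurable (raw)]:
  assumes [measurable]: "f \<in> borel_measurable M" "g \<in> borel_measurable M"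
  shows "Measurable.pred M (\<lambda>x. f x \<in> region P k (g x))" "Measurable.pred M (\<lambda>x. f x \<in> vision_cone P (g x))"
  by (cases k) (simp_all add: vision_cone_def)

section \<open>Interaction regions\<close>

abbreviation region_ind :: "params \<Rightarrow> interaction \<Rightarrow> phase \<Rightarrow> real" where
  "region_ind P k \<equiv> indicat_real {q. fst q \<in> region P k (snd q)}"

lemma line_poly_coord: "line_poly (\<lambda>q::phase. fst q $ i)" "line_poly (\<lambda>q::phase. snd q $ i)"
  by (intro line_poly_linear; simp add: linear_iff)+

lemma line_poly_products:
  "line_poly (\<lambda>q::phase. inner (fst q) (snd q))"
  "line_poly (\<lambda>q::phase. (norm (fst q))\<^sup>2)"
  "line_poly (\<lambda>q::phase. (norm (snd q))\<^sup>2)"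
  "line_poly (\<lambda>q::phase. cross2 (fst q) (snd q))"
  "line_poly (\<lambda>q::phase. cross2 (snd q) (fst q))"
  unfolding inner_plane norm_plane_sq cross2_def
  by (intro line_poly_intros line_poly_coord)+

lemma tame_tau_neg: "tame_set {q::phase. tau (fst q) (snd q) < 0}"
proof -
  have "tau z u < 0 \<longleftrightarrow> 0 < inner z u" for z u :: plane
    by (cases "u = 0") (auto simp: tau_def zero_less_divide_iff)
  then show ?thesis using tame_set_pos[OF line_poly_products(1)] by simp
qed

lemma tame_tau_nonneg: "tame_set {q::phase. tau (fst q) (snd q) \<ge> 0}"
  using tame_set_Compl[OF tame_tau_neg] by (simp add: Compl_eq not_less)

text \<open>By Lagrange's identity the squared distance at closest approach is \<open>(z \<times> u)\<^sup>2 / \<parallel>u\<parallel>\<^sup>2\<close>, so the condition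
  is polynomial; for \<open>u = 0\<close> the convention on division makes it a condition on \<open>norm z\<close>.\<close>

lemma dist_closest_less_iff:
  assumes "R > 0"
  shows "dist_closest z u < R \<longleftrightarrow>
    (if u = 0 then (norm z)\<^sup>2 < R\<^sup>2 else (cross2 z u)\<^sup>2 < R\<^sup>2 * (norm u)\<^sup>2)"
proof -
  have "dist_closest z u < R \<longleftrightarrow> (norm z)\<^sup>2 - (inner z u / norm u)\<^sup>2 < R\<^sup>2"
    unfolding dist_closest_def using assms real_sqrt_less_iff[of _ "R\<^sup>2"] by simp
  also have "\<dots> \<longleftrightarrow> (if u = 0 then (norm z)\<^sup>2 < R\<^sup>2 else (cross2 z u)\<^sup>2 < R\<^sup>2 * (norm u)\<^sup>2)"
  proof (cases "u = 0")
    case False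
    then have "(norm z)\<^sup>2 - (inner z u / norm u)\<^sup>2 = (cross2 z u)\<^sup>2 / (norm u)\<^sup>2"
      using lagrange_plane[of z u] by (simp add: field_simps power_divide)
    then show ?thesis using False by (simp add: pos_divide_less_eq)
  qed simp
  finally show ?thesis .
qed

lemma tame_dist_closest:
  assumes "R > 0"
  shows "tame_set {q::phase. dist_closest (fst q) (snd q) < R}"
proof -
  have "{q::phase. dist_closest (fst q) (snd q) < R} =
    ({q. (norm (snd q))\<^sup>2 > 0} \<inter> {q. (cross2 (fst q) (snd q))\<^sup>2 < R\<^sup>2 * (norm (snd q))\<^sup>2}) \<union>
    (- {q. (norm (snd q))\<^sup>2 > 0} \<inter> {q. (norm (fst q))\<^sup>2 < R\<^sup>2})"
    by (auto simp: dist_closest_less_iff[OF assms])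
  also have "tame_set \<dots>"
    by (intro tame_set_Un tame_set_Int tame_set_Compl tame_set_pos tame_set_less line_poly_intros line_poly_products)
  finally show ?thesis .
qed

lemma tame_norm_less: "R > 0 \<Longrightarrow> tame_set {q::phase. norm (fst q) < R}"
proof -
  assume R: "R > 0"
  have "norm z < R \<longleftrightarrow> (norm z)\<^sup>2 < R\<^sup>2" for z :: plane
    using R by (metis abs_norm_cancel abs_of_pos abs_square_less_1 power2_less_imp_less power_strict_mono norm_ge_zero less_imp_le zero_less_numeral)
  then show ?thesis using tame_set_less[OF line_poly_products(2) line_poly_const] by simp
qed

lemma tame_region:
  assumes "valid_params P"
  shows "tame_set {q::phase. fst q \<in> region P k (snd q)}"
  using assms tame_set_Int[OF tame_tau_nonneg tame_dist_closest]
    tame_set_Int[OF tame_tau_neg tame_norm_less]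
    tame_set_Int[OF tame_tau_nonneg tame_set_Int[OF tame_dist_closest tame_norm_less]]
  by (cases k) (simp_all add: valid_params_def Int_def)

text \<open>The absolute values agree with the kernels, in which the time \<open>tau\<close> is nonnegative on the regions
  \<open>Co\<close> and \<open>Imm\<close>; they keep the exponentials bounded by \<open>1\<close> on the whole phase space.\<close>

fun profile :: "params \<Rightarrow> interaction \<Rightarrow> phase \<Rightarrow> real" where
  "profile P Co (z, u) = exp (- (\<bar>tau z u\<bar> / C1 P)) * gfun P (cross2 u z / (norm z)\<^sup>2)"
| "profile P Imm (z, u) = exp (- (norm z * \<bar>tau z u\<bar> / C3 P))"
| "profile P Fo (z, u) = exp (- (\<bar>alpha_dot z u\<bar> * (norm z)\<^sup>2 / C5 P))"

lemma profile_eq: "profile P k = (\<lambda>q. case k of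
    Co \<Rightarrow> exp (- (\<bar>tau (fst q) (snd q)\<bar> / C1 P)) * gfun P (cross2 (snd q) (fst q) / (norm (fst q))\<^sup>2)
  | Imm \<Rightarrow> exp (- (norm (fst q) * \<bar>tau (fst q) (snd q)\<bar> / C3 P))
  | Fo \<Rightarrow> exp (- (\<bar>alpha_dot (fst q) (snd q)\<bar> * (norm (fst q))\<^sup>2 / C5 P)))"
proof
  fix q show "profile P k q = (case k of
    Co \<Rightarrow> exp (- (\<bar>tau (fst q) (snd q)\<bar> / C1 P)) * gfun P (cross2 (snd q) (fst q) / (norm (fst q))\<^sup>2)
  | Imm \<Rightarrow> exp (- (norm (fst q) * \<bar>tau (fst q) (snd q)\<bar> / C3 P))
  | Fo \<Rightarrow> exp (- (\<bar>alpha_dot (fst q) (snd q)\<bar> * (norm (fst q))\<^sup>2 / C5 P)))"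
    by (cases k; cases q) auto
qed

lemma measurable_profile [measurable]: "profile P k \<in> borel_measurable borel"
  unfolding profile_eq by (cases k) simp_all

text \<open>For \<open>delta1 P < 1\<close> the function \<open>gfun P\<close> takes negative values; adding \<open>1\<close> makes it nonnegative, as
  the layer cake formula demands.\<close>

lemma gfun_bounds:
  assumes "valid_params P"
  shows "0 \<le> gfun P s + 1" "gfun P s + 1 \<le> 2 + delta1 P" "\<bar>gfun P s\<bar> \<le> 1 + delta1 P"
proof -
  let ?e = "exp (- s / delta0 P)"
  have e: "?e > 0" by simp
  have d: "delta1 P > 0" using assms by (simp add: valid_params_def)
  have "2 / (1 + ?e) \<le> 2" using e by (simp add: divide_le_eq del: exp_gt_zero)
  moreover have "0 \<le> 2 / (1 + ?e)" using e by (intro divide_nonneg_nonneg) auto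
  ultimately show "0 \<le> gfun P s + 1" "gfun P s + 1 \<le> 2 + delta1 P" "\<bar>gfun P s\<bar> \<le> 1 + delta1 P"
    unfolding gfun_def using d by linarith+
qed

lemma mono_gfun_shift:
  assumes "valid_params P"
  shows "mono (\<lambda>s. gfun P s + 1)"
proof (rule monoI)
  fix x y :: real assume "x \<le> y"
  have d: "delta0 P > 0" using assms by (simp add: valid_params_def)
  have "exp (- y / delta0 P) \<le> exp (- x / delta0 P)"
    using \<open>x \<le> y\<close> d by (simp add: divide_right_mono)
  moreover have "0 < 1 + exp (- y / delta0 P)" "0 < 1 + exp (- x / delta0 P)" by (auto intro: add_pos_pos)
  ultimately have "2 / (1 + exp (- x / delta0 P)) \<le> 2 / (1 + exp (- y / delta0 P))"
    by (intro divide_left_mono) auto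
  then show "gfun P x + 1 \<le> gfun P y + 1" by (simp add: gfun_def)
qed

lemma line_variation_add_const:
  assumes "line_variation A F" shows "line_variation A (\<lambda>x. F x + c)"
  using assms unfolding line_variation_def by auto

lemma antimono_exp_sqrt:
  assumes "C > 0"
  shows "antimono (\<lambda>s. exp (- (sqrt s / C)))"
  using assms by (auto simp: antimono_def divide_right_mono)

lemma profile_abs_le:
  assumes "valid_params P"
  shows "\<bar>profile P k q\<bar> \<le> 1 + delta1 P"
proof -
  have pos: "C1 P > 0" "C3 P > 0" "C5 P > 0" "delta1 P > 0" using assms by (auto simp: valid_params_def)
  obtain z u where q: "q = (z, u)" by (cases q)
  show ?thesis
  proof (cases k)
    case Co
    have "exp (- (\<bar>tau z u\<bar> / C1 P)) * \<bar>gfun P (cross2 u z / (norm z)\<^sup>2)\<bar> \<le> 1 * (1 + delta1 P)"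
      using pos gfun_bounds(3)[OF assms] by (intro mult_mono) auto
    then show ?thesis by (simp add: q Co abs_mult)
  qed (use pos in \<open>auto simp: q intro!: order_trans[of "exp _" 1 "1 + delta1 P"]\<close>)
qed

text \<open>The exponents are square roots of ratios of polynomials in \<open>(z, u)\<close>, and the argument of \<open>gfun\<close> is such a
  ratio; the functions applied to them are monotone. As no derivative is taken, the singularities at
  \<open>u = 0\<close> and \<open>z = 0\<close> do no harm.\<close>

lemma profile_line_variation:
  assumes P: "valid_params P"
  obtains A where "A \<ge> 0" "line_variation A (profile P k)"
proof -
  have pos: "C1 P > 0" "C3 P > 0" "C5 P > 0" using P by (auto simp: valid_params_def)
  show ?thesis
  proof (cases k)
    case Co
    have "\<bar>tau z u\<bar> = sqrt ((inner z u)\<^sup>2 / ((norm u)\<^sup>2)\<^sup>2)" for z u :: plane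
      by (simp only: tau_def real_sqrt_divide real_sqrt_abs) simp
    then have "tame_fun (\<lambda>q::phase. exp (- (\<bar>tau (fst q) (snd q)\<bar> / C1 P)))"
      using tame_fun_antimono[OF tame_fun_ratio[OF line_poly_power[OF line_poly_products(1), of 2]
          line_poly_power[OF line_poly_products(3), of 2]] antimono_exp_sqrt[OF pos(1)]] by simp
    then obtain A1 where A1: "A1 \<ge> 0" "line_variation A1 (\<lambda>q::phase. exp (- (\<bar>tau (fst q) (snd q)\<bar> / C1 P)))"
      by (rule tame_fun_line_variation[where B = 1]) (use pos in auto)
    have "tame_fun (\<lambda>q::phase. gfun P (cross2 (snd q) (fst q) / (norm (fst q))\<^sup>2) + 1)"
      by (intro tame_fun_mono[OF tame_fun_ratio mono_gfun_shift[OF P]] line_poly_products) auto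
    then obtain A2 where A2: "A2 \<ge> 0" "line_variation A2 (\<lambda>q::phase. gfun P (cross2 (snd q) (fst q) / (norm (fst q))\<^sup>2) + 1)"
      by (rule tame_fun_line_variation[where B = "2 + delta1 P"]) (use gfun_bounds[OF P] in auto)
    have "line_variation A2 (\<lambda>q::phase. gfun P (cross2 (snd q) (fst q) / (norm (fst q))\<^sup>2))"
      using line_variation_add_const[OF A2(2), of "-1"] by simp
    from line_variation_mult[OF A1(2) this, of 1 "1 + delta1 P"] A1(1) A2(1) pos gfun_bounds(3)[OF P]
    have "line_variation ((1 + delta1 P) * A1 + 1 * A2) (profile P k)"
      unfolding Co profile_eq by auto
    moreover have "(1 + delta1 P) * A1 + 1 * A2 \<ge> 0"
      using A1(1) A2(1) P by (simp add: valid_params_def)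
    ultimately show ?thesis by (rule that[rotated])
  next
    case Imm
    have "norm z * \<bar>tau z u\<bar> = sqrt ((norm z)\<^sup>2 * (inner z u)\<^sup>2 / ((norm u)\<^sup>2)\<^sup>2)" for z u :: plane
      by (simp only: tau_def real_sqrt_divide real_sqrt_abs real_sqrt_mult) simp
    then have "tame_fun (profile P k)"
      using tame_fun_antimono[OF tame_fun_ratio[OF line_poly_mult[OF line_poly_products(2) line_poly_power[OF line_poly_products(1), of 2]]
          line_poly_power[OF line_poly_products(3), of 2]] antimono_exp_sqrt[OF pos(2)]] unfolding profile_eq Imm by simp
    then show ?thesis
      by (rule tame_fun_line_variation[where B = 1]) (use pos that in \<open>auto simp: profile_eq Imm\<close>)
  next
    case Fo
    have "\<bar>alpha_dot z u\<bar> * (norm z)\<^sup>2 = sqrt ((cross2 z u)\<^sup>2 / 1)" for z u :: plane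
      by (cases "z = 0") (auto simp: alpha_dot_def cross2_def abs_mult)
    then have "tame_fun (profile P k)"
      using tame_fun_antimono[OF tame_fun_ratio[OF line_poly_power[OF line_poly_products(4), of 2]
          line_poly_const[of 1]] antimono_exp_sqrt[OF pos(3)]] unfolding profile_eq Fo by simp
    then show ?thesis
      by (rule tame_fun_line_variation[where B = 1]) (use pos that in \<open>auto simp: profile_eq Fo\<close>)
  qed
qed

lemma measurable_region_set [measurable]: "{q::phase. fst q \<in> region P k (snd q)} \<in> sets borel"
  by measurable

lemma region_line_variation:
  assumes P: "valid_params P"
  obtains A where "A \<ge> 0" "line_variation A (region_ind P k)"
  by (rule tame_set_line_variation[OF tame_region[OF P]]) measurable

section \<open>Vision cone\<close>

text \<open>The cone is convex if \<open>\<kappa> \<ge> 0\<close>, and its complement is convex if \<open>\<kappa> < 0\<close>. A description by polynomials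
  would degenerate here: for \<open>\<bar>\<kappa>\<bar> = 1\<close> the polynomial \<open>(inner z v)\<^sup>2 - \<kappa>\<^sup>2 \<parallel>z\<parallel>\<^sup>2 \<parallel>v\<parallel>\<^sup>2\<close> vanishes along the line
  spanned by \<open>v\<close>. The bound \<open>2\<close> is uniform in \<open>v\<close>.\<close>

lemma few_switches_cone: "few_switches 2 {t. p + t *\<^sub>R e \<in> vision_cone P v}"
proof (cases "kappa P \<ge> 0")
  case True
  have "convex (vision_cone P v)"
  proof (rule convexI)
    fix x y and a b :: real
    assume *: "x \<in> vision_cone P v" "y \<in> vision_cone P v" "0 \<le> a" "0 \<le> b"
    have "kappa P * norm (a *\<^sub>R x + b *\<^sub>R y) * norm v \<le> kappa P * (a * norm x + b * norm y) * norm v"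
      using True * norm_triangle_ineq[of "a *\<^sub>R x" "b *\<^sub>R y"] by (intro mult_right_mono mult_left_mono) auto
    also have "\<dots> = a * (kappa P * norm x * norm v) + b * (kappa P * norm y * norm v)" by (simp add: algebra_simps)
    also have "\<dots> \<le> a * inner x v + b * inner y v"
      using * by (intro add_mono mult_left_mono) (auto simp: vision_cone_def)
    finally show "a *\<^sub>R x + b *\<^sub>R y \<in> vision_cone P v" by (simp add: vision_cone_def inner_add_left)
  qed
  then show ?thesis by (rule few_switches_line_convex)
next
  case False
  have "convex (- vision_cone P v)"
  proof (rule convexI)
    fix x y and a b :: real
    assume *: "x \<in> - vision_cone P v" "y \<in> - vision_cone P v" "0 \<le> a" "0 \<le> b" "a + b = 1"
    have "a * inner x v + b * inner y v < a * (kappa P * norm x * norm v) + b * (kappa P * norm y * norm v)"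
    proof (cases "a = 0")
      case True then show ?thesis using * by (simp add: vision_cone_def)
    next
      case False
      then show ?thesis
        using * by (intro add_less_le_mono mult_left_mono mult_strict_left_mono) (auto simp: vision_cone_def)
    qed
    also have "\<dots> = kappa P * (a * norm x + b * norm y) * norm v" by (simp add: algebra_simps)
    also have "\<dots> \<le> kappa P * norm (a *\<^sub>R x + b *\<^sub>R y) * norm v"
      using False * norm_triangle_ineq[of "a *\<^sub>R x" "b *\<^sub>R y"] by (intro mult_right_mono mult_left_mono_neg) auto
    finally show "a *\<^sub>R x + b *\<^sub>R y \<in> - vision_cone P v" by (simp add: vision_cone_def inner_add_left)
  qed
  from few_switches_Compl[OF few_switches_line_convex[OF this, of p e]] show ?thesis
    by (simp add: Compl_eq)
qed

lemma cone_line_variation: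
  "line_variation 2 (indicat_real {q::phase. fst q \<in> vision_cone P v})"
proof -
  have "line_variation (real 2) (indicat_real {q::phase. fst q \<in> vision_cone P v})"
    by (rule switches_line_variation) (simp_all add: few_switches_cone)
  then show ?thesis by simp
qed

section \<open>The region swept by a rotating vision cone\<close>

lemma measure_diameter:
  fixes A :: "real set"
  assumes "\<And>s t. s \<in> A \<Longrightarrow> t \<in> A \<Longrightarrow> s \<le> t \<Longrightarrow> t - s \<le> l" "l \<ge> 0"
  shows "(\<integral>\<^sup>+ t. indicator A t \<partial>lborel) \<le> ennreal (2 * l)"
proof (cases "A = {}")
  case False
  then obtain a where a: "a \<in> A" by blast
  have "A \<subseteq> {a - l..a + l}" using assms(1)[OF _ a] assms(1)[OF a] assms(2) by (auto simp: algebra_simps) (smt (verit))+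
  then have "(\<integral>\<^sup>+ t. indicator A t \<partial>lborel) \<le> (\<integral>\<^sup>+ t. indicator {a - l..a + l} t \<partial>lborel)"
    by (intro nn_integral_mono) (auto simp: indicator_def)
  also have "\<dots> = ennreal (2 * l)" using assms(2) by simp
  finally show ?thesis .
qed simp

lemma ball_volume:
  obtains K where "K \<ge> 0" "emeasure lborel (cball (0::'a::euclidean_space) r) = ennreal K"
proof
  show "emeasure lborel (cball (0::'a) r) = ennreal (measure lborel (cball (0::'a) r))"
    using emeasure_lborel_cball_finite[of "0::'a" r] by (intro emeasure_eq_ennreal_measure) auto
qed simp

text \<open>In the regions \<open>Co\<close> and \<open>Imm\<close> the distance of closest approach is below \<open>R\<close>, so that
  \<open>\<bar>z \<times> u\<bar> \<le> R * norm u\<close>: the velocity \<open>w\<close> lies in a strip parallel to \<open>z\<close> whose width is of order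
  \<open>(1 + norm v) / norm z\<close>, and averaging orthogonally to \<open>z\<close> measures this strip. In the region \<open>Fo\<close> the
  vector \<open>z\<close> is bounded. The decay in \<open>z\<close> makes up for the area that a rotating cone sweeps at distance
  \<open>norm z\<close>; the price is the factor \<open>1 + norm v\<close>, which reappears in the theorem.\<close>

lemma region_slice_bound:
  assumes P: "valid_params P" and "\<rho> \<ge> 0"
  obtains C where "C \<ge> 0"
    "\<And>z v. (\<integral>\<^sup>+ w. indicator {w. z \<in> region P k (w - v)} w * indicator (cball 0 \<rho>) w \<partial>lborel)
        \<le> ennreal (C * (1 + norm v) / (1 + norm z))"
proof -
  have pos: "Rad P > 0" "RadFo P > 0" "RadIm0 P > 0" "RadIm0 P < Rad P" using P by (auto simp: valid_params_def)
  obtain K where K: "K \<ge> 0" "emeasure lborel (cball (0::plane) (\<rho> + 1)) = ennreal K" by (rule ball_volume)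
  have le_vol: "(\<integral>\<^sup>+ w. indicator S w * indicator (cball 0 \<rho>) w \<partial>lborel) \<le> ennreal K" for S :: "plane set"
  proof -
    have "(\<integral>\<^sup>+ w. indicator S w * indicator (cball 0 \<rho>) w \<partial>lborel) \<le> (\<integral>\<^sup>+ w. indicator (cball (0::plane) (\<rho> + 1)) w \<partial>lborel)"
      by (intro nn_integral_mono) (auto simp: indicator_def)
    then show ?thesis using K by simp
  qed
  let ?I = "\<lambda>z v. \<integral>\<^sup>+ w. indicator {w. z \<in> region P k (w - v)} w * indicator (cball 0 \<rho>) w \<partial>lborel"
  show ?thesis
  proof (cases "k = Fo")
    case True
    have "?I z v \<le> ennreal (K * (1 + RadFo P) * (1 + norm v) / (1 + norm z))" for z v
    proof (cases "norm z < RadFo P")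
      case lt: True
      have "K * (1 + norm z) \<le> K * (1 + RadFo P) * 1"
        using lt K(1) by (simp add: mult_left_mono)
      also have "\<dots> \<le> K * (1 + RadFo P) * (1 + norm v)"
        using K(1) pos by (intro mult_left_mono) auto
      finally have "K * (1 + norm z) \<le> K * (1 + RadFo P) * (1 + norm v)" .
      moreover have "0 < 1 + norm z" by (simp add: add_pos_nonneg)
      ultimately have "K \<le> K * (1 + RadFo P) * (1 + norm v) / (1 + norm z)" by (simp add: pos_le_divide_eq)
      then show ?thesis using le_vol by (meson ennreal_leI order_trans)
    qed (simp add: True)
    then show ?thesis using that[of "K * (1 + RadFo P)"] K(1) pos by simp
  next
    case False
    have strip: "\<bar>cross2 z u\<bar> \<le> Rad P * norm u" if "z \<in> region P k u" for z u
    proof -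
      have d: "dist_closest z u < Rad P" using that False pos by (cases k) auto
      have "(cross2 z u)\<^sup>2 \<le> (Rad P * norm u)\<^sup>2"
        using d dist_closest_less_iff[OF pos(1), of z u]
        by (cases "u = 0") (auto simp: cross2_def power_mult_distrib)
      then show ?thesis using pos by (simp add: abs_le_square_iff[symmetric] abs_mult)
    qed
    define C where "C = K * (2 + 8 * Rad P * (\<rho> + 1))"
    have C: "K * 2 \<le> C" "K * (8 * Rad P * (\<rho> + 1)) \<le> C" "C \<ge> 0"
      using K(1) pos assms(2) by (auto simp: C_def distrib_left)
    have "?I z v \<le> ennreal (C * (1 + norm v) / (1 + norm z))" for z v
    proof (cases "norm z \<le> 1")
      case True
      have "K * (1 + norm z) \<le> K * 2 * 1" using True K(1) by (simp add: mult_left_mono)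
      also have "\<dots> \<le> C * (1 + norm v)" using C K(1) by (intro mult_mono) auto
      finally have "K \<le> C * (1 + norm v) / (1 + norm z)" by (simp add: pos_le_divide_eq add_pos_nonneg)
      then show ?thesis using le_vol by (meson ennreal_leI order_trans)
    next
      case False
      define Q where "Q = Rad P * (\<rho> + norm v)"
      have Q: "Q \<ge> 0" using pos assms by (simp add: Q_def)
      \<comment> \<open>In this direction \<open>cross2 z\<close> grows at rate \<open>norm z\<close>.\<close>
      define e where "e = perp z /\<^sub>R norm z"
      have z: "norm z > 1" using False by simp
      then have "norm z \<noteq> 0" by linarith
      then have e: "norm e \<le> 1" by (simp add: e_def)
      have crossz: "cross2 z (w + t *\<^sub>R e - v) = cross2 z (w - v) + t * norm z" for w t
      proof -
        have "cross2 z (w + t *\<^sub>R e - v) = cross2 z (w - v) + t * (cross2 z (perp z) / norm z)"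
          using \<open>norm z \<noteq> 0\<close> by (simp add: cross2_def e_def field_simps)
        moreover have "cross2 z (perp z) = (norm z)\<^sup>2" unfolding cross2_def norm_plane_sq by (simp add: power2_eq_square)
        ultimately show ?thesis using \<open>norm z \<noteq> 0\<close> by (simp add: power2_eq_square)
      qed
      have "?I z v \<le> (\<integral>\<^sup>+ w. indicator {w. \<bar>cross2 z (w - v)\<bar> \<le> Q} w * indicator (cball 0 \<rho>) w \<partial>lborel)"
      proof (intro nn_integral_mono)
        fix w
        have "\<bar>cross2 z (w - v)\<bar> \<le> Q" if "z \<in> region P k (w - v)" "w \<in> cball 0 \<rho>"
          using strip[OF that(1)] that(2) norm_triangle_ineq4[of w v] pos unfolding Q_def
          by (smt (verit) mem_cball_0 mult_left_mono)
        then show "indicator {w. z \<in> region P k (w - v)} w * indicator (cball 0 \<rho>) w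
          \<le> (indicator {w. \<bar>cross2 z (w - v)\<bar> \<le> Q} w * indicator (cball 0 \<rho>) w :: ennreal)"
          by (auto simp: indicator_def)
      qed
      also have "\<dots> \<le> (\<integral>\<^sup>+ w. ennreal (2 * (2 * Q / norm z)) * indicator (cball (0::plane) (\<rho> + 1)) w \<partial>lborel)"
      proof (rule nn_integral_ball_le_average[where e = e and G = "indicator {w. \<bar>cross2 z (w - v)\<bar> \<le> Q}" and H = "\<lambda>_. ennreal (2 * (2 * Q / norm z))"])
        fix p
        have "(\<integral>\<^sup>+ t. indicator {w. \<bar>cross2 z (w - v)\<bar> \<le> Q} (p + t *\<^sub>R e) * indicator {0..1} t \<partial>lborel)
          \<le> (\<integral>\<^sup>+ t. indicator {t. \<bar>cross2 z (p - v) + t * norm z\<bar> \<le> Q} t \<partial>lborel)"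
          by (intro nn_integral_mono) (auto simp: indicator_def crossz)
        also have "\<dots> \<le> ennreal (2 * (2 * Q / norm z))"
        proof (rule measure_diameter)
          fix s t assume "s \<in> {t. \<bar>cross2 z (p - v) + t * norm z\<bar> \<le> Q}" "t \<in> {t. \<bar>cross2 z (p - v) + t * norm z\<bar> \<le> Q}"
          then have "t * norm z - s * norm z \<le> 2 * Q" by auto
          then show "t - s \<le> 2 * Q / norm z" using \<open>norm z \<noteq> 0\<close> by (simp add: pos_le_divide_eq left_diff_distrib)
        qed (use Q in auto)
        finally show "(\<integral>\<^sup>+ t. indicator {w. \<bar>cross2 z (w - v)\<bar> \<le> Q} (p + t *\<^sub>R e) * indicator {0..1} t \<partial>lborel)
          \<le> ennreal (2 * (2 * Q / norm z))" .
      qed (use e in measurable)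
      also have "\<dots> = ennreal (2 * (2 * Q / norm z) * K)"
        using Q K by (subst nn_integral_cmult_indicator) (auto simp: ennreal_mult[symmetric])
      also have "\<dots> \<le> ennreal (C * (1 + norm v) / (1 + norm z))"
      proof (rule ennreal_leI)
        have "2 * (2 * Q / norm z) * K \<le> 2 * (2 * Q) * K * (2 / (1 + norm z))"
        proof -
          have "1 / norm z \<le> 2 / (1 + norm z)"
            using z(1) \<open>norm z \<noteq> 0\<close> by (simp add: pos_divide_le_eq pos_le_divide_eq add_pos_nonneg)
          then have "2 * (2 * Q) * K * (1 / norm z) \<le> 2 * (2 * Q) * K * (2 / (1 + norm z))"
            using Q K by (intro mult_left_mono) auto
          then show ?thesis by (simp add: field_simps)
        qed
        also have "\<dots> = K * (8 * Rad P * (\<rho> + norm v)) / (1 + norm z)" by (simp add: Q_def)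
        also have "\<dots> \<le> C * (1 + norm v) / (1 + norm z)"
        proof (rule divide_right_mono)
          have "\<rho> + norm v \<le> (\<rho> + 1) * (1 + norm v)" using assms(2) by (simp add: algebra_simps)
          then have "K * (8 * Rad P * (\<rho> + norm v)) \<le> K * (8 * Rad P * ((\<rho> + 1) * (1 + norm v)))"
            using K pos by (intro mult_left_mono) auto
          also have "\<dots> = K * (8 * Rad P * (\<rho> + 1)) * (1 + norm v)" by simp
          also have "\<dots> \<le> C * (1 + norm v)" using C by (intro mult_right_mono) auto
          finally show "K * (8 * Rad P * (\<rho> + norm v)) \<le> C * (1 + norm v)" .
        qed simp
        finally show "2 * (2 * Q / norm z) * K \<le> C * (1 + norm v) / (1 + norm z)" .
      qed
      finally show ?thesis .
    qed
    then show ?thesis using that C by blast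
  qed
qed

text \<open>Since the norm is \<open>1\<close>-Lipschitz, \<open>inner z a - \<kappa> * norm z\<close> grows at rate at least \<open>1 - \<bar>\<kappa>\<bar>\<close> in the
  direction \<open>a\<close>. Hence a unit segment in this direction spends a length of order
  \<open>\<Delta> * (norm z + 1) / (1 - \<bar>\<kappa>\<bar>)\<close> in the set, and the weight cancels the growth in \<open>z\<close>.\<close>

lemma cone_boundary_bound:
  fixes a :: plane
  assumes k: "\<bar>\<kappa>\<bar> < 1" and a: "norm a = 1" and \<Delta>: "\<Delta> \<ge> 0"
  shows "(\<integral>\<^sup>+ y. (indicator {z. \<bar>inner z a - \<kappa> * norm z\<bar> \<le> \<Delta> * norm z} (y - x) * ennreal (1 / (1 + norm (y - x))))
            * indicator (cball 0 \<rho>) y \<partial>lborel)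
     \<le> ennreal (8 * \<Delta> / (1 - \<bar>\<kappa>\<bar>)) * emeasure lborel (cball (0::plane) (\<rho> + 1))"
proof -
  define S where "S = {z. \<bar>inner z a - \<kappa> * norm z\<bar> \<le> \<Delta> * norm z}"
  have [measurable]: "S \<in> sets borel" unfolding S_def by measurable
  have "(\<integral>\<^sup>+ y. (indicator S (y - x) * ennreal (1 / (1 + norm (y - x)))) * indicator (cball 0 \<rho>) y \<partial>lborel)
    \<le> (\<integral>\<^sup>+ y. ennreal (8 * \<Delta> / (1 - \<bar>\<kappa>\<bar>)) * indicator (cball (0::plane) (\<rho> + 1)) y \<partial>lborel)"
  proof (rule nn_integral_ball_le_average[where e = a
        and G = "\<lambda>y. indicator S (y - x) * ennreal (1 / (1 + norm (y - x)))" and H = "\<lambda>_. ennreal (8 * \<Delta> / (1 - \<bar>\<kappa>\<bar>))"])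
    fix p
    define z where "z = p - x"
    define l where "l = 2 * \<Delta> * (norm z + 1) / (1 - \<bar>\<kappa>\<bar>)"
    have l: "l \<ge> 0" using k \<Delta> by (simp add: l_def)
    have sh: "p + t *\<^sub>R a - x = z + t *\<^sub>R a" for t by (simp add: z_def)
    have nz: "norm (z + t *\<^sub>R a) \<le> norm z + 1" "norm z \<le> norm (z + t *\<^sub>R a) + 1" if "t \<in> {0..1}" for t
      using norm_triangle_ineq[of z "t *\<^sub>R a"] norm_triangle_ineq4[of "z + t *\<^sub>R a" "t *\<^sub>R a"] that a by auto
    let ?T = "{t \<in> {0..1}. z + t *\<^sub>R a \<in> S}"
    have "(\<integral>\<^sup>+ t. indicator S (p + t *\<^sub>R a - x) * ennreal (1 / (1 + norm (p + t *\<^sub>R a - x))) * indicator {0..1} t \<partial>lborel)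
      \<le> (\<integral>\<^sup>+ t. ennreal (2 / (1 + norm z)) * indicator ?T t \<partial>lborel)"
    proof (rule nn_integral_mono)
      fix t
      have "1 / (1 + norm (z + t *\<^sub>R a)) \<le> 2 / (1 + norm z)" if "t \<in> {0..1}"
      proof -
        have "1 * (1 + norm z) \<le> 2 * (1 + norm (z + t *\<^sub>R a))" using order_trans[OF nz(2)[OF that], of "1 + 2 * norm (z + t *\<^sub>R a)"] by simp
        moreover have "0 < 1 + norm z" "0 < 1 + norm (z + t *\<^sub>R a)" by (simp_all add: add_pos_nonneg)
        ultimately show ?thesis by (simp add: pos_divide_le_eq pos_le_divide_eq)
      qed
      then show "indicator S (p + t *\<^sub>R a - x) * ennreal (1 / (1 + norm (p + t *\<^sub>R a - x))) * indicator {0..1} t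
        \<le> ennreal (2 / (1 + norm z)) * indicator ?T t"
        unfolding sh by (auto simp: indicator_def intro: ennreal_leI)
    qed
    also have "\<dots> = ennreal (2 / (1 + norm z)) * (\<integral>\<^sup>+ t. indicator ?T t \<partial>lborel)"
      by (rule nn_integral_cmult) measurable
    also have "\<dots> \<le> ennreal (2 / (1 + norm z)) * ennreal (2 * l)"
    proof (intro mult_left_mono measure_diameter)
      fix s t assume st: "s \<in> ?T" "t \<in> ?T" "s \<le> t"
      have "\<bar>norm (z + t *\<^sub>R a) - norm (z + s *\<^sub>R a)\<bar> \<le> t - s"
        using norm_triangle_ineq3[of "z + t *\<^sub>R a" "z + s *\<^sub>R a"] a st(3)
        by (simp add: scaleR_diff_left[symmetric])
      then have "\<bar>\<kappa>\<bar> * \<bar>norm (z + t *\<^sub>R a) - norm (z + s *\<^sub>R a)\<bar> \<le> \<bar>\<kappa>\<bar> * (t - s)"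
        by (intro mult_left_mono) auto
      then have g: "\<bar>\<kappa> * (norm (z + t *\<^sub>R a) - norm (z + s *\<^sub>R a))\<bar> \<le> \<bar>\<kappa>\<bar> * (t - s)"
        by (simp add: abs_mult)
      have i: "inner (z + t *\<^sub>R a) a - inner (z + s *\<^sub>R a) a = t - s"
        using a by (simp add: inner_add_left dot_square_norm)
      have "\<Delta> * norm (z + t *\<^sub>R a) \<le> \<Delta> * (norm z + 1)" "\<Delta> * norm (z + s *\<^sub>R a) \<le> \<Delta> * (norm z + 1)"
        using nz(1) st \<Delta> by (auto intro!: mult_left_mono)
      moreover have "\<bar>inner (z + t *\<^sub>R a) a - \<kappa> * norm (z + t *\<^sub>R a)\<bar> \<le> \<Delta> * norm (z + t *\<^sub>R a)"
        "\<bar>inner (z + s *\<^sub>R a) a - \<kappa> * norm (z + s *\<^sub>R a)\<bar> \<le> \<Delta> * norm (z + s *\<^sub>R a)"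
        using st(1,2) by (auto simp: S_def)
      ultimately have "t - s - \<bar>\<kappa>\<bar> * (t - s) \<le> 2 * (\<Delta> * (norm z + 1))"
        using g unfolding right_diff_distrib i[symmetric] by linarith
      then have "(1 - \<bar>\<kappa>\<bar>) * (t - s) \<le> 2 * \<Delta> * (norm z + 1)"
        by (simp add: left_diff_distrib mult.assoc)
      then show "t - s \<le> l" using k by (simp add: l_def pos_le_divide_eq mult.commute)
    qed (use l in auto)
    also have "\<dots> = ennreal (8 * \<Delta> / (1 - \<bar>\<kappa>\<bar>))"
    proof -
      have "2 / n * (2 * (2 * \<Delta> * n / m)) = 8 * \<Delta> / m" if "n > 0" for n m :: real
        using that by simp
      from this[of "1 + norm z" "1 - \<bar>\<kappa>\<bar>"]
      have "2 / (1 + norm z) * (2 * l) = 8 * \<Delta> / (1 - \<bar>\<kappa>\<bar>)"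
        by (simp add: l_def add_pos_nonneg add.commute[of _ 1])
      then show ?thesis using l by (simp add: ennreal_mult[symmetric])
    qed
    finally show "(\<integral>\<^sup>+ t. indicator S (p + t *\<^sub>R a - x) * ennreal (1 / (1 + norm (p + t *\<^sub>R a - x))) * indicator {0..1} t \<partial>lborel)
      \<le> ennreal (8 * \<Delta> / (1 - \<bar>\<kappa>\<bar>))" .
  qed (simp_all add: a)
  also have "\<dots> = ennreal (8 * \<Delta> / (1 - \<bar>\<kappa>\<bar>)) * emeasure lborel (cball (0::plane) (\<rho> + 1))"
    by (subst nn_integral_cmult_indicator) auto
  finally show ?thesis unfolding S_def .
qed

lemma unit_vector_dist:
  fixes v v' :: "'a::real_normed_vector"
  assumes "v \<noteq> 0" "v' \<noteq> 0"
  shows "norm v * norm (v /\<^sub>R norm v - v' /\<^sub>R norm v') \<le> 2 * norm (v - v')"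
proof -
  have "norm v * norm (v /\<^sub>R norm v - v' /\<^sub>R norm v') = norm (norm v *\<^sub>R (v /\<^sub>R norm v - v' /\<^sub>R norm v'))" by simp
  also have "norm v *\<^sub>R (v /\<^sub>R norm v - v' /\<^sub>R norm v') = (v - v') + (norm v' - norm v) *\<^sub>R (v' /\<^sub>R norm v')"
    using assms by (simp add: algebra_simps)
  also have "norm \<dots> \<le> norm (v - v') + \<bar>norm v' - norm v\<bar>"
  proof -
    have "norm (v' /\<^sub>R norm v') = 1" using assms by simp
    then have "norm ((norm v' - norm v) *\<^sub>R (v' /\<^sub>R norm v')) = \<bar>norm v' - norm v\<bar>" by (simp only: norm_scaleR mult_1_right)
    then show ?thesis using norm_triangle_ineq[of "v - v'" "(norm v' - norm v) *\<^sub>R (v' /\<^sub>R norm v')"] by simp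
  qed
  also have "\<dots> \<le> 2 * norm (v - v')"
    using norm_triangle_ineq3[of v' v] by (simp add: norm_minus_commute)
  finally show ?thesis .
qed

text \<open>The cone depends on \<open>v\<close> through its direction only, and the direction turns by about
  \<open>norm (v - v') / norm v\<close>; multiplication with \<open>norm v\<close> makes this Lipschitz up to \<open>v = 0\<close>. For
  \<open>\<bar>\<kappa>\<bar> < 1\<close> two cones differ only near their boundaries, for \<open>\<kappa> = 1\<close> they are rays and therefore null sets,
  and for \<open>\<kappa> = -1\<close> they are the whole plane.\<close>

lemma weighted_cone_difference:
  assumes P: "valid_params P"
  obtains A where "A \<ge> 0"
    "\<And>x v v'. ennreal (norm v) * (\<integral>\<^sup>+ y.
        ennreal \<bar>indicat_real (vision_cone P v) (y - x) - indicat_real (vision_cone P v') (y - x)\<bar>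
        * ennreal (1 / (1 + norm (y - x))) * indicator (cball 0 \<rho>) y \<partial>lborel) \<le> ennreal (A * norm (v - v'))"
proof -
  obtain K where K: "K \<ge> 0" "emeasure lborel (cball (0::plane) (\<rho> + 1)) = ennreal K" by (rule ball_volume)
  obtain K0 where K0: "K0 \<ge> 0" "emeasure lborel (cball (0::plane) \<rho>) = ennreal K0" by (rule ball_volume)
  let ?D = "\<lambda>v v' z. \<bar>indicat_real (vision_cone P v) z - indicat_real (vision_cone P v') z\<bar>"
  define A where "A = (if \<bar>kappa P\<bar> < 1 then 16 * K / (1 - \<bar>kappa P\<bar>) else 0)"
  have A: "A \<ge> 0" using K by (simp add: A_def)
  define J where "J x v v' = (\<integral>\<^sup>+ y. ennreal (?D v v' (y - x)) * ennreal (1 / (1 + norm (y - x))) * indicator (cball 0 \<rho>) y \<partial>lborel)" for x v v'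
  have "ennreal (norm v) * J x v v' \<le> ennreal ((A + K0) * norm (v - v'))" for x v v'
  proof -
    consider "v = 0" | "v \<noteq> 0" "v' = 0" | "v \<noteq> 0" "v' \<noteq> 0" by blast
    then show ?thesis
    proof cases
      case 2
      have "J x v v' \<le> (\<integral>\<^sup>+ y. indicator (cball (0::plane) \<rho>) y \<partial>lborel)"
        unfolding J_def
      proof (intro nn_integral_mono)
        fix y
        have "ennreal (?D v v' (y - x)) * ennreal (1 / (1 + norm (y - x))) \<le> 1 * 1"
          by (intro mult_mono) (auto simp: indicator_def pos_divide_le_eq add_pos_nonneg)
        then show "ennreal (?D v v' (y - x)) * ennreal (1 / (1 + norm (y - x))) * indicator (cball 0 \<rho>) y \<le> indicator (cball 0 \<rho>) y"
          by (auto simp: indicator_def)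
      qed
      also have "\<dots> = ennreal K0" using K0 by simp
      finally have "ennreal (norm v) * J x v v' \<le> ennreal (norm v) * ennreal K0" by (rule mult_left_mono) simp
      also have "\<dots> = ennreal (K0 * norm (v - v'))" using 2 K0 by (simp add: ennreal_mult mult.commute)
      also have "\<dots> \<le> ennreal ((A + K0) * norm (v - v'))" using A K0 by (intro ennreal_leI mult_right_mono) auto
      finally show ?thesis .
    next
      case 3
      consider "\<bar>kappa P\<bar> < 1" | "kappa P = 1" | "kappa P = -1"
        using P by (fastforce simp: valid_params_def)
      then show ?thesis
      proof cases
        case 1
        define a where "a = v /\<^sub>R norm v"
        define \<Delta> where "\<Delta> = norm (a - v' /\<^sub>R norm v')"
        have a: "norm a = 1" "v = norm v *\<^sub>R a" using 3 by (auto simp: a_def)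
        have D: "?D v v' z \<le> indicat_real {z. \<bar>inner z a - kappa P * norm z\<bar> \<le> \<Delta> * norm z} z" for z
        proof -
          have 11: "z \<in> vision_cone P u \<longleftrightarrow> inner z (u /\<^sub>R norm u) \<ge> kappa P * norm z" if "u \<noteq> 0" for u
            using that by (simp add: vision_cone_def field_simps)
          have "\<bar>inner z a - inner z (v' /\<^sub>R norm v')\<bar> \<le> \<Delta> * norm z"
            using Cauchy_Schwarz_ineq2[of z "a - v' /\<^sub>R norm v'"] by (simp add: inner_diff_right \<Delta>_def mult.commute)
          then show ?thesis
            using 11[OF 3(1)] 11[OF 3(2)] unfolding a_def[symmetric] by (auto simp: indicator_def)
        qed
        have "J x v v' \<le> (\<integral>\<^sup>+ y. (indicator {z. \<bar>inner z a - kappa P * norm z\<bar> \<le> \<Delta> * norm z} (y - x) * ennreal (1 / (1 + norm (y - x))))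
          * indicator (cball 0 \<rho>) y \<partial>lborel)"
          unfolding J_def
          by (intro nn_integral_mono mult_right_mono order_trans[OF ennreal_leI[OF D]])
            (auto simp: ennreal_indicator)
        also have "\<dots> \<le> ennreal (8 * \<Delta> / (1 - \<bar>kappa P\<bar>)) * ennreal K"
          using cone_boundary_bound[OF 1 a(1), of \<Delta> x \<rho>] K by (simp add: \<Delta>_def)
        also have "\<dots> = ennreal (8 * K / (1 - \<bar>kappa P\<bar>) * \<Delta>)"
          using 1 K by (simp add: ennreal_mult[symmetric] \<Delta>_def mult_ac)
        finally have "ennreal (norm v) * J x v v' \<le> ennreal (norm v) * ennreal (8 * K / (1 - \<bar>kappa P\<bar>) * \<Delta>)"
          by (rule mult_left_mono) simp
        also have "\<dots> = ennreal (8 * K / (1 - \<bar>kappa P\<bar>) * (norm v * \<Delta>))"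
          using 1 K by (simp add: ennreal_mult[symmetric] \<Delta>_def mult_ac)
        also have "\<dots> \<le> ennreal (8 * K / (1 - \<bar>kappa P\<bar>) * (2 * norm (v - v')))"
          using 1 K unit_vector_dist[OF 3] unfolding \<Delta>_def a_def
          by (intro ennreal_leI mult_left_mono) auto
        also have "\<dots> \<le> ennreal ((A + K0) * norm (v - v'))"
          using K0 1 by (intro ennreal_leI) (simp add: A_def algebra_simps)
        finally show ?thesis .
      next
        case 2
        \<comment> \<open>For \<open>\<kappa> = 1\<close> the condition is the equality case of Cauchy-Schwarz.\<close>
        have line: "indicat_real (vision_cone P u) z = 0" if "u \<noteq> 0" "inner (perp u) z \<noteq> 0" for u z
        proof -
          have "cross2 z u \<noteq> 0" using that(2) by (simp add: cross2_def inner_plane mult.commute)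
          then have "(cross2 z u)\<^sup>2 > 0" by simp
          then have "(inner z u)\<^sup>2 < (norm z * norm u)\<^sup>2" 
            using lagrange_plane[of z u] unfolding power_mult_distrib by linarith
          then have "inner z u < norm z * norm u"
            by (rule power2_less_imp_less) simp
          then show ?thesis using 2 by (simp add: vision_cone_def)
        qed
        have np: "perp u \<noteq> 0" if "u \<noteq> 0" for u using that norm_perp[of u] by (metis norm_eq_zero)
        have ae: "AE y in lborel. inner (perp u) (y - x) \<noteq> 0" if "u \<noteq> 0" for u :: plane
        proof -
          have "negligible {y. inner (perp u) y = inner (perp u) x}"
            using np[OF that] by (intro negligible_hyperplane) auto
          then have "AE y in lebesgue. y \<notin> {y. inner (perp u) y = inner (perp u) x}"
            unfolding negligible_iff_null_sets by (rule AE_not_in)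
          then have "AE y in lebesgue. inner (perp u) (y - x) \<noteq> 0"
            by eventually_elim (simp add: inner_diff_right)
          then show ?thesis by (simp add: AE_completion_iff)
        qed
        have "J x v v' = (\<integral>\<^sup>+ y. 0 \<partial>(lborel :: plane measure))"
          unfolding J_def using ae[OF 3(1)] ae[OF 3(2)]
          by (intro nn_integral_cong_AE, eventually_elim) (simp add: line 3)
        then show ?thesis by simp
      next
        case 3
        have "vision_cone P u = UNIV" for u
        proof -
          have "- (norm z * norm u) \<le> inner z u" for z using Cauchy_Schwarz_ineq2[of z u] by linarith
          then show ?thesis using 3 by (auto simp: vision_cone_def)
        qed
        then show ?thesis by (simp add: J_def)
      qed
    qed simp
  qed
  then show ?thesis using that[of "A + K0"] A K0(1) unfolding J_def by simp
qed

lemma phase_norm_bounds: "norm (fst q) \<le> norm q" "norm (snd q) \<le> norm q" for q :: phase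
  by (cases q; simp add: norm_Pair real_le_rsqrt)+

lemma cone_difference_bound:
  assumes P: "valid_params P" and "\<rho> \<ge> 0"
  obtains C where "C \<ge> 0"
    "\<And>x v v'. ennreal (norm v) * (\<integral>\<^sup>+ q.
        ennreal (\<bar>indicat_real (vision_cone P v) (fst q - x) - indicat_real (vision_cone P v') (fst q - x)\<bar>
          * region_ind P k (q - (x, v))) * indicator (cball 0 \<rho>) q \<partial>lborel)
      \<le> ennreal (C * (1 + norm v) * norm (v - v'))"
proof -
  let ?D = "\<lambda>v v' z. \<bar>indicat_real (vision_cone P v) z - indicat_real (vision_cone P v') z\<bar>"
  let ?J = "\<lambda>x v v'. \<integral>\<^sup>+ y. ennreal (?D v v' (y - x)) * ennreal (1 / (1 + norm (y - x))) * indicator (cball 0 \<rho>) y \<partial>lborel"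
  have [measurable]: "cball (0::plane) \<rho> \<in> sets borel" "cball (0::phase) \<rho> \<in> sets borel" by auto
  obtain C where C: "C \<ge> 0"
    "\<And>z v. (\<integral>\<^sup>+ w. indicator {w. z \<in> region P k (w - v)} w * indicator (cball 0 \<rho>) w \<partial>lborel)
        \<le> ennreal (C * (1 + norm v) / (1 + norm z))"
    by (rule region_slice_bound[OF assms, of k]) blast
  obtain A where A: "A \<ge> 0" "\<And>x v v'. ennreal (norm v) * ?J x v v' \<le> ennreal (A * norm (v - v'))"
    by (rule weighted_cone_difference[OF P, of \<rho>]) blast
  have I: "(\<integral>\<^sup>+ q. ennreal (?D v v' (fst q - x) * region_ind P k (q - (x, v))) * indicator (cball 0 \<rho>) q \<partial>lborel)
    \<le> ennreal (C * (1 + norm v)) * ?J x v v'" for x v v'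
  proof -
    let ?d = "\<lambda>y. ennreal (?D v v' (y - x)) * indicator (cball 0 \<rho>) y"
    let ?s = "\<lambda>z w. indicator {w. z \<in> region P k (w - v)} w * indicator (cball 0 \<rho>) w"
    let ?f = "\<lambda>q::phase. ?d (fst q) * ?s (fst q - x) (snd q)"
    have "(\<integral>\<^sup>+ q. ennreal (?D v v' (fst q - x) * region_ind P k (q - (x, v))) * indicator (cball 0 \<rho>) q \<partial>lborel)
      \<le> (\<integral>\<^sup>+ q. ?f q \<partial>lborel)"
    proof (intro nn_integral_mono)
      fix q :: phase
      show "ennreal (?D v v' (fst q - x) * region_ind P k (q - (x, v))) * indicator (cball 0 \<rho>) q \<le> ?f q"
        using phase_norm_bounds[of q] by (auto simp: indicator_def)
    qed
    also have "\<dots> = (\<integral>\<^sup>+ q. ?f q \<partial>(lborel \<Otimes>\<^sub>M lborel))" by (simp add: lborel_prod)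
    also have "\<dots> = (\<integral>\<^sup>+ y. (\<integral>\<^sup>+ w. ?f (y, w) \<partial>lborel) \<partial>lborel)"
    proof (rule lborel.nn_integral_fst[symmetric])
      have [measurable]: "(\<lambda>q::phase. indicator {w. fst q - x \<in> region P k (w - v)} (snd q) :: ennreal) \<in> borel_measurable borel"
        unfolding indicator_def by measurable
      have "?f \<in> borel_measurable borel" by measurable
      then show "?f \<in> borel_measurable (lborel \<Otimes>\<^sub>M lborel)" by (simp add: lborel_prod)
    qed
    also have "\<dots> \<le> (\<integral>\<^sup>+ y. ?d y * ennreal (C * (1 + norm v) / (1 + norm (y - x))) \<partial>lborel)"
    proof (rule nn_integral_mono)
      fix y
      have "(\<integral>\<^sup>+ w. ?f (y, w) \<partial>lborel) = ?d y * (\<integral>\<^sup>+ w. ?s (y - x) w \<partial>lborel)"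
        unfolding fst_conv snd_conv by (rule nn_integral_cmult) measurable
      also have "\<dots> \<le> ?d y * ennreal (C * (1 + norm v) / (1 + norm (y - x)))" by (intro mult_left_mono C(2)) auto
      finally show "(\<integral>\<^sup>+ w. ?f (y, w) \<partial>lborel) \<le> ?d y * ennreal (C * (1 + norm v) / (1 + norm (y - x)))" .
    qed
    also have "\<dots> = (\<integral>\<^sup>+ y. ennreal (C * (1 + norm v)) * (ennreal (?D v v' (y - x)) * ennreal (1 / (1 + norm (y - x))) * indicator (cball 0 \<rho>) y) \<partial>lborel)"
    proof (rule nn_integral_cong)
      fix y
      have "ennreal (C * (1 + norm v) / (1 + norm (y - x))) = ennreal (C * (1 + norm v)) * ennreal (1 / (1 + norm (y - x)))"
        using C by (simp add: ennreal_mult[symmetric])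
      then show "?d y * ennreal (C * (1 + norm v) / (1 + norm (y - x))) =
          ennreal (C * (1 + norm v)) * (ennreal (?D v v' (y - x)) * ennreal (1 / (1 + norm (y - x))) * indicator (cball 0 \<rho>) y)"
        by (simp add: mult_ac)
    qed
    also have "\<dots> = ennreal (C * (1 + norm v)) * ?J x v v'" by (rule nn_integral_cmult) measurable
    finally show ?thesis .
  qed
  have "ennreal (norm v) * (\<integral>\<^sup>+ q. ennreal (?D v v' (fst q - x) * region_ind P k (q - (x, v))) * indicator (cball 0 \<rho>) q \<partial>lborel)
     \<le> ennreal (C * A * (1 + norm v) * norm (v - v'))" for x v v'
  proof -
    have "ennreal (norm v) * (ennreal (C * (1 + norm v)) * ?J x v v') \<le> ennreal (C * (1 + norm v)) * ennreal (A * norm (v - v'))"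
      unfolding mult.left_commute[of "ennreal (norm v)"] by (intro mult_left_mono A(2)) simp
    also have "\<dots> = ennreal (C * A * (1 + norm v) * norm (v - v'))"
      using C(1) A(1) by (simp add: ennreal_mult[symmetric] mult_ac)
    finally have "ennreal (norm v) * (ennreal (C * (1 + norm v)) * ?J x v v') \<le> ennreal (C * A * (1 + norm v) * norm (v - v'))" .
    then show ?thesis by (rule order_trans[rotated]) (intro mult_left_mono I, simp)
  qed
  then show ?thesis using that[of "C * A"] C(1) A(1) by simp
qed

section \<open>Mollified angular functions\<close>

lemma lborel_integral_shift:
  fixes f :: "'a::euclidean_space \<Rightarrow> real"
  assumes [measurable]: "f \<in> borel_measurable borel"
  shows "(LINT x|lborel. f (x + c)) = (LINT x|lborel. f x)"
proof -
  have "(LINT x|lborel. f x) = (LINT x|distr lborel borel ((+) c). f x)"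
    by (simp add: lborel_distr_plus)
  also have "\<dots> = (LINT x|lborel. f (c + x))" by (rule integral_distr) auto
  finally show ?thesis by (simp add: add.commute)
qed

lemma integrable_lborel_ball:
  fixes f :: "'a::euclidean_space \<Rightarrow> real"
  assumes [measurable]: "f \<in> borel_measurable borel"
    and "\<And>x. \<bar>f x\<bar> \<le> B" "\<And>x. x \<notin> cball 0 r \<Longrightarrow> f x = 0"
  shows "integrable lborel f"
proof (rule Bochner_Integration.integrable_bound)
  show "integrable lborel (\<lambda>x::'a. B * indicator (cball 0 r) x)"
    using emeasure_lborel_cball_finite[of "0::'a" r] by (intro integrable_mult_right integrable_real_indicator) auto
  show "AE x in lborel. norm (f x) \<le> norm (B * indicator (cball 0 r) x)"
  proof (intro AE_I2)
    fix x show "norm (f x) \<le> norm (B * indicator (cball 0 r) x)"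
      using order_trans[OF assms(2)[of x] abs_ge_self[of B]] assms(3)[of x] by (cases "x \<in> cball 0 r") simp_all
  qed
qed simp

text \<open>The mollifier is a decreasing function of \<open>\<parallel>y\<parallel>\<^sup>2 + \<parallel>w\<parallel>\<^sup>2\<close>, hence tame. Thus the bound on its increments in
  \<open>L\<^sup>1\<close>, from which the Lipschitz continuity of mollified functions follows, is a further instance of the
  principle that treats the kernels.\<close>

lemma mollifier_bounds:
  assumes e: "e > 0"
  obtains B A where "B \<ge> 0" "\<And>q. 0 \<le> mollifier e q" "\<And>q. mollifier e q \<le> B"
    "\<And>q. q \<notin> cball 0 e \<Longrightarrow> mollifier e q = 0"
    "A \<ge> 0" "line_variation A (mollifier e)"
proof -
  define c where "c = (LINT p|lborel. bump e p)"
  have bump0: "0 \<le> bump e q" for q using e by (cases q) (auto simp: bump_def)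
  have c: "c \<ge> 0" unfolding c_def by (intro integral_nonneg_AE AE_I2 bump0)
  define \<phi> where "\<phi> s = (if s < e\<^sup>2 then e powi (-4) * exp (1 / (s / e\<^sup>2 - 1)) else 0) / c" for s :: real
  define r :: "phase \<Rightarrow> real" where "r q = ((norm (fst q))\<^sup>2 + (norm (snd q))\<^sup>2) / 1" for q
  have m: "mollifier e = (\<lambda>q. \<phi> (r q))"
    by (auto simp: mollifier_def bump_def \<phi>_def r_def c_def fun_eq_iff split: prod.splits)
  have neg: "s / e\<^sup>2 - 1 < 0" if "s < e\<^sup>2" for s using that e by (simp add: divide_less_eq)
  have anti: "antimono \<phi>"
  proof (rule antimonoI)
    fix s t :: real assume "s \<le> t"
    have "e powi (-4) * exp (1 / (t / e\<^sup>2 - 1)) \<le> e powi (-4) * exp (1 / (s / e\<^sup>2 - 1))" if "t < e\<^sup>2"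
    proof -
      have "s / e\<^sup>2 - 1 \<le> t / e\<^sup>2 - 1" using \<open>s \<le> t\<close> e by (simp add: divide_right_mono)
      then have "1 / (t / e\<^sup>2 - 1) \<le> 1 / (s / e\<^sup>2 - 1)"
        using neg[OF that] neg[of s] that \<open>s \<le> t\<close>
        by (intro divide_left_mono mult_neg_neg) auto
      then show ?thesis using e by (intro mult_left_mono) auto
    qed
    then show "\<phi> t \<le> \<phi> s" using \<open>s \<le> t\<close> c e unfolding \<phi>_def by (auto intro!: divide_right_mono)
  qed
  have \<phi>0: "0 \<le> \<phi> s" for s using c e by (auto simp: \<phi>_def)
  define B where "B = e powi (-4) / c"
  have B0: "B \<ge> 0" using c e by (simp add: B_def)
  have \<phi>B: "\<phi> s \<le> B" for s
  proof (cases "s < e\<^sup>2")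
    case True
    then have "exp (1 / (s / e\<^sup>2 - 1)) \<le> 1" using neg[OF True] by (simp add: divide_nonneg_neg divide_le_0_iff)
    then have "e powi (-4) * exp (1 / (s / e\<^sup>2 - 1)) \<le> e powi (-4) * 1" using e by (intro mult_left_mono) auto
    then show ?thesis using c True unfolding \<phi>_def B_def by (auto intro!: divide_right_mono)
  qed (use B0 in \<open>simp add: \<phi>_def\<close>)
  have zero: "\<phi> (r q) = 0" if "q \<notin> cball 0 e" for q
  proof -
    have "e < norm q" using that by simp
    then have "e\<^sup>2 < (norm q)\<^sup>2" using e by (intro power_strict_mono) auto
    also have "(norm q)\<^sup>2 = r q" by (cases q) (simp add: norm_Pair r_def)
    finally show ?thesis by (simp add: \<phi>_def)
  qed
  have [measurable]: "r \<in> borel_measurable borel" unfolding r_def by measurable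
  have [measurable]: "\<phi> \<in> borel_measurable borel" unfolding \<phi>_def by measurable
  have "tame_fun (\<lambda>q. \<phi> (r q))"
    unfolding r_def by (intro tame_fun_antimono[OF tame_fun_ratio anti] line_poly_intros line_poly_products) auto
  then obtain A where "A \<ge> 0" "line_variation A (\<lambda>q. \<phi> (r q))"
    by (rule tame_fun_line_variation[where B = B]) (auto simp: \<phi>0 \<phi>B)
  then show ?thesis using that[of B A] unfolding m by (simp add: B0 \<phi>0 \<phi>B zero)
qed

text \<open>A displacement \<open>d\<close> of the argument can be moved onto the mollifier, whose increment has \<open>L\<^sup>1\<close> norm of
  order \<open>norm d\<close> by \<open>nn_integral_shift_ball\<close>. As long as \<open>norm d \<le> 1\<close>, the mollifier and its translate live
  in one fixed ball; for longer displacements boundedness is enough.\<close>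

lemma mollify_bounded_lipschitz:
  fixes h :: "plane \<Rightarrow> plane \<Rightarrow> real"
  assumes e: "e > 0" and [measurable]: "(\<lambda>(z, v). h z v) \<in> borel_measurable (borel \<Otimes>\<^sub>M borel)"
    and h1: "\<And>z v. \<bar>h z v\<bar> \<le> 1"
  obtains B L where "B \<ge> 0" "L \<ge> 0" "\<And>z v. \<bar>mollify e h z v\<bar> \<le> B"
    "\<And>z v z' v'. \<bar>mollify e h z v - mollify e h z' v'\<bar> \<le> L * norm ((z, v) - (z', v'))"
proof -
  obtain B A where m: "B \<ge> 0" "\<And>q. 0 \<le> mollifier e q" "\<And>q. mollifier e q \<le> B"
    "\<And>q. q \<notin> cball 0 e \<Longrightarrow> mollifier e q = 0" and A: "A \<ge> 0" "line_variation A (mollifier e)"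
    by (rule mollifier_bounds[OF e]) blast
  let ?m = "mollifier e"
  have [measurable]: "?m \<in> borel_measurable borel" using A(2) by (simp add: line_variation_def)
  define H :: "phase \<Rightarrow> real" where "H q = h (fst q) (snd q)" for q
  have Hm[measurable]: "H \<in> borel_measurable borel"
    using assms(2) unfolding H_def borel_prod by (simp add: case_prod_beta')
  have H1: "\<bar>H q\<bar> \<le> 1" for q by (simp add: H_def h1)
  have eq: "mollify e h z v = (LINT q|lborel. H ((z, v) - q) * ?m q)" for z v
    unfolding mollify_def H_def by (intro Bochner_Integration.integral_cong) auto
  obtain K where K: "K \<ge> 0" "emeasure lborel (cball (0::phase) (e + 2)) = ennreal K" by (rule ball_volume)
  have bd: "\<bar>H (p - q) * ?m q\<bar> \<le> B" for p q
    using mult_mono[OF H1[of "p - q"] m(3)[of q]] m(2)[of q] by (simp add: abs_mult)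
  have int: "integrable lborel (\<lambda>q. H (p - q) * ?m q)" for p
    by (rule integrable_lborel_ball[where B = B and r = e]) (use bd m(4) in auto)
  have nn: "(\<integral>\<^sup>+ q. ennreal \<bar>?m q\<bar> \<partial>lborel) \<le> ennreal (B * K)"
  proof -
    have "(\<integral>\<^sup>+ q. ennreal \<bar>?m q\<bar> \<partial>lborel) \<le> (\<integral>\<^sup>+ q. ennreal B * indicator (cball (0::phase) (e + 2)) q \<partial>lborel)"
    proof (intro nn_integral_mono)
      fix q show "ennreal \<bar>?m q\<bar> \<le> ennreal B * indicator (cball (0::phase) (e + 2)) q"
        using m(2)[of q] m(3)[of q] m(4)[of q] by (cases "q \<in> cball 0 e") (auto simp: indicator_def ennreal_leI)
    qed
    also have "\<dots> = ennreal B * ennreal K" using K by (subst nn_integral_cmult_indicator) auto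
    finally show ?thesis using m(1) K by (simp add: ennreal_mult)
  qed
  have b1: "\<bar>mollify e h z v\<bar> \<le> B * K" for z v
  proof -
    have "ennreal (norm (mollify e h z v)) \<le> (\<integral>\<^sup>+ q. ennreal (norm (H ((z, v) - q) * ?m q)) \<partial>lborel)"
      unfolding eq by (rule integral_norm_bound_ennreal[OF int])
    also have "\<dots> \<le> (\<integral>\<^sup>+ q. ennreal \<bar>?m q\<bar> \<partial>lborel)"
      using H1 by (intro nn_integral_mono ennreal_leI) (auto simp: abs_mult mult_left_le_one_le)
    also have "\<dots> \<le> ennreal (B * K)" by (rule nn)
    finally show ?thesis using m(1) K by simp
  qed
  define L where "L = A * K + 2 * (B * K)"
  have "\<bar>mollify e h z v - mollify e h z' v'\<bar> \<le> L * norm ((z, v) - (z', v'))" for z v z' v'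
  proof (cases "norm ((z, v) - (z', v')) \<le> 1")
    case True
    define d where "d = (z', v') - (z, v)"
    have d: "norm d \<le> 1" "norm ((z, v) - (z', v')) = norm d" using True norm_minus_commute[of "(z, v)" "(z', v')"] by (simp_all only: d_def)
    \<comment> \<open>Substituting \<open>q + d\<close> for \<open>q\<close> leaves \<open>H\<close> with the same argument as at \<open>(z, v)\<close>.\<close>
    have s: "(z', v') - (q + d) = (z, v) - q" for q by (simp add: d_def)
    have "mollify e h z' v' = (LINT q|lborel. H ((z', v') - (q + d)) * ?m (q + d))"
      unfolding eq by (rule lborel_integral_shift[symmetric]) measurable
    also have "\<dots> = (LINT q|lborel. H ((z, v) - q) * ?m (q + d))" unfolding s ..
    finally have z': "mollify e h z' v' = (LINT q|lborel. H ((z, v) - q) * ?m (q + d))" .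
    have int': "integrable lborel (\<lambda>q. H ((z, v) - q) * ?m (q + d))"
    proof (rule integrable_lborel_ball[where B = B and r = "e + 1"])
      fix q
      show "\<bar>H ((z, v) - q) * ?m (q + d)\<bar> \<le> B" using bd[of "(z', v')" "q + d"] by (simp only: s)
      show "H ((z, v) - q) * ?m (q + d) = 0" if "q \<notin> cball 0 (e + 1)"
        using that d(1) norm_triangle_ineq4[of "q + d" d] by (subst m(4)) auto
    qed measurable
    have "mollify e h z v - mollify e h z' v' = (LINT q|lborel. H ((z, v) - q) * ?m q - H ((z, v) - q) * ?m (q + d))"
      unfolding z' unfolding eq by (rule Bochner_Integration.integral_diff[symmetric]) (fact int int')+
    then have "ennreal (norm (mollify e h z v - mollify e h z' v')) \<le>
        (\<integral>\<^sup>+ q. ennreal (norm (H ((z, v) - q) * ?m q - H ((z, v) - q) * ?m (q + d))) \<partial>lborel)"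
      using integral_norm_bound_ennreal[OF Bochner_Integration.integrable_diff[OF int[of "(z, v)"] int']] by simp
    also have "\<dots> \<le> (\<integral>\<^sup>+ q. ennreal \<bar>?m (q + d) - ?m q\<bar> * indicator (cball 0 (e + 1)) q \<partial>lborel)"
    proof (intro nn_integral_mono)
      fix q
      show "ennreal (norm (H ((z, v) - q) * ?m q - H ((z, v) - q) * ?m (q + d)))
        \<le> ennreal \<bar>?m (q + d) - ?m q\<bar> * indicator (cball 0 (e + 1)) q"
      proof (cases "q \<in> cball 0 (e + 1)")
        case True
        have "norm (H ((z, v) - q) * ?m q - H ((z, v) - q) * ?m (q + d)) = \<bar>H ((z, v) - q)\<bar> * \<bar>?m (q + d) - ?m q\<bar>"
          by (simp add: right_diff_distrib[symmetric] abs_mult abs_minus_commute)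
        also have "\<dots> \<le> \<bar>?m (q + d) - ?m q\<bar>" using H1 by (simp add: mult_left_le_one_le)
        finally show ?thesis using True by (simp add: ennreal_leI)
      next
        case False
        then have "q \<notin> cball 0 e" "q + d \<notin> cball 0 e"
          using d(1) norm_triangle_ineq4[of "q + d" d] by auto
        then show ?thesis by (simp add: m(4))
      qed
    qed
    also have "\<dots> \<le> ennreal (A * norm d) * emeasure lborel (cball (0::phase) (e + 1 + 1))"
      by (rule nn_integral_shift_ball[OF A(2,1)])
    also have "\<dots> = ennreal (A * norm d * K)" using K A by (simp add: ennreal_mult add.assoc)
    finally have "\<bar>mollify e h z v - mollify e h z' v'\<bar> \<le> A * norm d * K" using A K by simp
    also have "\<dots> = A * K * norm d" by simp
    also have "\<dots> \<le> L * norm d" unfolding L_def using m(1) K by (intro mult_right_mono) auto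
    finally show ?thesis using d(2) by simp
  next
    case False
    have "\<bar>mollify e h z v - mollify e h z' v'\<bar> \<le> 2 * (B * K)" using b1[of z v] b1[of z' v'] by linarith
    also have "\<dots> \<le> 2 * (B * K) * norm ((z, v) - (z', v'))"
      using False m(1) K mult_left_mono[of 1 "norm ((z, v) - (z', v'))" "2 * (B * K)"] by simp
    also have "\<dots> \<le> L * norm ((z, v) - (z', v'))" unfolding L_def using A K by (intro mult_right_mono) auto
    finally show ?thesis .
  qed
  moreover have "L \<ge> 0" "B * K \<ge> 0" using A m(1) K by (auto simp: L_def)
  ultimately show ?thesis using that b1 by blast
qed

lemma plane_complex_measurable [measurable (raw)]:
  assumes [measurable]: "f \<in> borel_measurable M"
  shows "(\<lambda>x. plane_complex (f x)) \<in> borel_measurable M"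
  unfolding plane_complex_def complex_eq_iff Complex_eq by measurable

lemma cos_signed_angle_measurable:
  "(\<lambda>(z, v). cos (signed_angle z v)) \<in> borel_measurable (borel \<Otimes>\<^sub>M borel)"
proof -
  have "cos (signed_angle z v) = (let c = plane_complex z / plane_complex v in if c = 0 then 1 else Re c / norm c)" for z v
    by (auto simp: signed_angle_def Let_def cos_Arg Arg_zero)
  then show ?thesis unfolding Let_def by simp
qed

lemma sin_signed_angle_measurable:
  "(\<lambda>(z, v). sin (2 * signed_angle z v)) \<in> borel_measurable (borel \<Otimes>\<^sub>M borel)"
proof -
  have "sin (2 * signed_angle z v) = (let c = plane_complex z / plane_complex v in if c = 0 then 0 else 2 * (Im c / norm c) * (Re c / norm c))" for z v
    by (auto simp: signed_angle_def Let_def cos_Arg sin_Arg Arg_zero sin_double)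
  then show ?thesis unfolding Let_def by simp
qed

section \<open>Interaction integrals\<close>

text \<open>The common form of the rates and of the numerators of \<open>Omega\<close>. The position and velocity of the observer
  enter in three ways: through the Lipschitz factor \<open>a\<close>, through the axis of the vision cone, and through
  a translation of the argument of \<open>E\<close>.\<close>

definition interaction :: "params \<Rightarrow> (plane \<Rightarrow> plane \<Rightarrow> real) \<Rightarrow> (phase \<Rightarrow> real) \<Rightarrow> (phase \<Rightarrow> real) \<Rightarrow> plane \<Rightarrow> plane \<Rightarrow> real" where
  "interaction P a E h x v =
     (LINT q|lborel. a (fst q - x) v * indicat_real (vision_cone P v) (fst q - x) * E (q - (x, v)) * h q)"

definition bounded_density :: "real \<Rightarrow> real \<Rightarrow> (phase \<Rightarrow> real) \<Rightarrow> bool" where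
  "bounded_density \<rho> M h \<longleftrightarrow> h \<in> borel_measurable borel \<and> (AE q in lborel. \<bar>h q\<bar> \<le> M) \<and>
     (AE q in lborel. q \<notin> cball 0 \<rho> \<longrightarrow> h q = 0)"

lemma line_variation_translate:
  assumes "line_variation A F" shows "line_variation A (\<lambda>q. F (q - c))"
proof -
  have [measurable]: "F \<in> borel_measurable borel" using assms by (simp add: line_variation_def)
  have eq: "p + s *\<^sub>R e - c = (p - c) + s *\<^sub>R e" for p e and s :: real by simp
  have "(\<lambda>q. F (q - c)) \<in> borel_measurable borel" by measurable
  then show ?thesis
    using assms unfolding line_variation_def eq by blast
qed

text \<open>With \<open>c\<close> and \<open>c1\<close> the indicators of the cones of \<open>v\<close> and \<open>v'\<close>, and with primes marking values at the
  displaced point, \<open>a c e - a' c1' e' = (a - a') c e + a' (c - c1) e + a' (c1 e - c1' e')\<close>. The first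
  term is controlled by the Lipschitz constant of \<open>a\<close>, the second by \<open>cone_difference_bound\<close>, and the last
  one is an increment of the single function \<open>c1 e\<close> under a translation of phase space.\<close>

lemma interaction_lipschitz:
  assumes P: "valid_params P" and "\<rho> \<ge> 0"
    and a: "\<And>z v. \<bar>a z v\<bar> \<le> BA" "\<And>z v z' v'. \<bar>a z v - a z' v'\<bar> \<le> LA * norm ((z, v) - (z', v'))" "LA \<ge> 0"
      "\<And>v. (\<lambda>z. a z v) \<in> borel_measurable borel"
    and E: "line_variation A1 E" "A1 \<ge> 0" "\<And>q. \<bar>E q\<bar> \<le> BE * region_ind P k q" "BE \<ge> 0"
  obtains C where "C \<ge> 0"
    "\<And>h M x v x' v'. bounded_density \<rho> M h \<Longrightarrow> M \<ge> 0 \<Longrightarrow>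
       norm v * \<bar>interaction P a E h x v - interaction P a E h x' v'\<bar> \<le> C * M * (1 + norm v) * norm ((x, v) - (x', v')) \<and>
       \<bar>interaction P a E h x v\<bar> \<le> C * M"
proof -
  have BA: "BA \<ge> 0" using a(1)[of 0 0] by linarith
  obtain C1 where C1: "C1 \<ge> 0"
    "\<And>x v v'. ennreal (norm v) * (\<integral>\<^sup>+ q.
        ennreal (\<bar>indicat_real (vision_cone P v) (fst q - x) - indicat_real (vision_cone P v') (fst q - x)\<bar>
          * region_ind P k (q - (x, v))) * indicator (cball 0 \<rho>) q \<partial>lborel)
      \<le> ennreal (C1 * (1 + norm v) * norm (v - v'))"
    by (rule cone_difference_bound[OF P \<open>\<rho> \<ge> 0\<close>, of k]) blast
  obtain K where K: "K \<ge> 0" "emeasure lborel (cball (0::phase) (\<rho> + 1)) = ennreal K" by (rule ball_volume)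
  have K': "emeasure lborel (cball (0::phase) \<rho>) \<le> ennreal K"
    unfolding K(2)[symmetric] by (intro emeasure_mono) auto
  define A2 where "A2 = 1 * A1 + BE * 2"
  have A2: "A2 \<ge> 0" using E by (simp add: A2_def)
  have E1: "\<bar>E q\<bar> \<le> BE" for q using E(3)[of q] E(4)
    by (cases "fst q \<in> region P k (snd q)") (auto simp: indicator_def)
  have lv: "line_variation A2 (\<lambda>q. E q * indicat_real {q::phase. fst q \<in> vision_cone P v} q)" for v
    unfolding A2_def by (rule line_variation_mult[OF E(1) cone_line_variation E1 _ E(2)]) auto
  have [measurable]: "E \<in> borel_measurable borel" using E(1) by (simp add: line_variation_def)
  have [measurable]: "(\<lambda>z. a z v) \<in> borel_measurable borel" for v by (rule a(4))
  have am[measurable]: "(\<lambda>q::phase. a (fst q - x) v) \<in> borel_measurable borel" for x v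
    by (rule measurable_compose[OF _ a(4)]) measurable
  have [measurable]: "cball (0::phase) \<rho> \<in> sets borel" by auto
  define C where "C = BE * LA * K + BA * BE * C1 + BA * A2 * K + BA * BE * K"
  have "norm v * \<bar>interaction P a E h x v - interaction P a E h x' v'\<bar> \<le> C * M * (1 + norm v) * norm ((x, v) - (x', v')) \<and>
       \<bar>interaction P a E h x v\<bar> \<le> C * M"
    if h: "bounded_density \<rho> M h" and M: "M \<ge> 0" for h M x v x' v'
  proof -
    have hm[measurable]: "h \<in> borel_measurable borel" and hM: "AE q in lborel. \<bar>h q\<bar> \<le> M"
      and h0: "AE q in lborel. q \<notin> cball 0 \<rho> \<longrightarrow> h q = 0"
      using h by (auto simp: bounded_density_def)
    define \<delta> where "\<delta> = norm ((x, v) - (x', v'))"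
    define d where "d = (x, v) - (x', v')"
    have d: "norm d = \<delta>" "q - (x', v') = q - (x, v) + d" for q by (auto simp: d_def \<delta>_def)
    have dv: "norm (v - v') \<le> \<delta>" using phase_norm_bounds(2)[of "(x, v) - (x', v')"] by (simp add: \<delta>_def)
    have \<delta>0: "\<delta> \<ge> 0" by (simp add: \<delta>_def)
    let ?N = "interaction P a E h x v - interaction P a E h x' v'"
    let ?G = "\<lambda>x v q. a (fst q - x) v * indicat_real (vision_cone P v) (fst q - x) * E (q - (x, v))"
    have G1: "\<bar>?G x v q\<bar> \<le> BA * BE" for x v q
    proof -
      have "\<bar>a (fst q - x) v * indicat_real (vision_cone P v) (fst q - x)\<bar> \<le> BA"
        using a(1)[of "fst q - x" v] BA by (auto simp: indicator_def)
      then show ?thesis unfolding abs_mult[of _ "E _"] using E1[of "q - (x, v)"] BA by (intro mult_mono) auto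
    qed
    have hB: "AE q in lborel. ennreal \<bar>h q\<bar> \<le> ennreal M * indicator (cball 0 \<rho>) q"
      using hM h0 by eventually_elim (auto simp: indicator_def ennreal_leI)
    have hint: "(\<integral>\<^sup>+ q. ennreal \<bar>h q\<bar> \<partial>lborel) \<le> ennreal (M * K)"
    proof -
      have "(\<integral>\<^sup>+ q. ennreal \<bar>h q\<bar> \<partial>lborel) \<le> (\<integral>\<^sup>+ q. ennreal M * indicator (cball (0::phase) \<rho>) q \<partial>lborel)"
        by (rule nn_integral_mono_AE[OF hB])
      also have "\<dots> = ennreal M * emeasure lborel (cball (0::phase) \<rho>)" by (rule nn_integral_cmult_indicator) simp
      also have "\<dots> \<le> ennreal M * ennreal K" by (intro mult_left_mono K') simp
      finally show ?thesis using M K by (simp add: ennreal_mult)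
    qed
    have hI: "integrable lborel h"
      using hint by (intro integrableI_bounded) (auto simp: order_le_less_trans)
    have int: "integrable lborel (\<lambda>q. ?G x v q * h q)" for x v
    proof (rule Bochner_Integration.integrable_bound)
      show "integrable lborel (\<lambda>q. BA * BE * h q)" using hI by simp
      show "AE q in lborel. norm (?G x v q * h q) \<le> norm (BA * BE * h q)"
      proof (intro AE_I2)
        fix q show "norm (?G x v q * h q) \<le> norm (BA * BE * h q)"
          using mult_right_mono[OF G1[of q x v], of "\<bar>h q\<bar>"] BA E(4) by (simp add: abs_mult)
      qed
    qed measurable
    have bound: "\<bar>interaction P a E h x v\<bar> \<le> BA * BE * (M * K)"
    proof -
      have "ennreal (norm (interaction P a E h x v)) \<le> (\<integral>\<^sup>+ q. ennreal (norm (?G x v q * h q)) \<partial>lborel)"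
        unfolding interaction_def by (rule integral_norm_bound_ennreal[OF int])
      also have "\<dots> \<le> (\<integral>\<^sup>+ q. ennreal (BA * BE) * ennreal \<bar>h q\<bar> \<partial>lborel)"
        using G1 BA E(4) by (intro nn_integral_mono) (auto simp: abs_mult[of _ "h _"] ennreal_mult[symmetric] intro!: ennreal_leI mult_right_mono)
      also have "\<dots> = ennreal (BA * BE) * (\<integral>\<^sup>+ q. ennreal \<bar>h q\<bar> \<partial>lborel)" by (rule nn_integral_cmult) measurable
      also have "\<dots> \<le> ennreal (BA * BE) * ennreal (M * K)" by (intro mult_left_mono hint) simp
      finally show ?thesis using BA E(4) M K by (simp add: ennreal_mult[symmetric])
    qed
    let ?X = "\<lambda>q. \<bar>indicat_real (vision_cone P v) (fst q - x) - indicat_real (vision_cone P v') (fst q - x)\<bar>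
          * region_ind P k (q - (x, v))"
    let ?F = "\<lambda>q. E q * indicat_real {q::phase. fst q \<in> vision_cone P v'} q"
    let ?Y = "\<lambda>q. \<bar>?F (q - (x, v) + d) - ?F (q - (x, v))\<bar>"
    let ?IX = "\<integral>\<^sup>+ q. ennreal (?X q) * indicator (cball 0 \<rho>) q \<partial>lborel" and ?IY = "\<integral>\<^sup>+ q. ennreal (?Y q) * indicator (cball 0 \<rho>) q \<partial>lborel"
    let ?S = "\<lambda>q. ennreal (BE * LA * \<delta>) + ennreal (BA * BE) * ennreal (?X q) + ennreal BA * ennreal (?Y q)"
    have pt: "\<bar>?G x v q - ?G x' v' q\<bar> \<le> BE * LA * \<delta> + BA * BE * ?X q + BA * ?Y q" for q
    proof -
      define z where "z = fst q - x"
      define z' where "z' = fst q - x'"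
      define c where "c = indicat_real (vision_cone P v) z"
      define c1 where "c1 = indicat_real (vision_cone P v') z"
      define c1' where "c1' = indicat_real (vision_cone P v') z'"
      define e where "e = E (q - (x, v))"
      define e' where "e' = E (q - (x', v'))"
      have "norm ((z, v) - (z', v')) = \<delta>"
        by (simp add: z_def z'_def \<delta>_def norm_Pair norm_minus_commute)
      then have "\<bar>a z v - a z' v'\<bar> \<le> LA * \<delta>" using a(2)[of z v z' v'] by simp
      moreover have "\<bar>c * e\<bar> \<le> BE" using E1[of "q - (x, v)"] E(4) by (auto simp: c_def e_def indicator_def)
      ultimately have t1: "\<bar>(a z v - a z' v') * (c * e)\<bar> \<le> LA * \<delta> * BE"
        unfolding abs_mult[of "a z v - a z' v'"] using a(3) \<delta>0 by (intro mult_mono) auto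
      have "\<bar>a z' v' * (c - c1)\<bar> \<le> BA * \<bar>c - c1\<bar>" using a(1)[of z' v'] unfolding abs_mult by (intro mult_right_mono) auto
      moreover have "\<bar>e\<bar> \<le> BE * region_ind P k (q - (x, v))" unfolding e_def by (rule E(3))
      ultimately have "\<bar>a z' v' * (c - c1) * e\<bar> \<le> BA * \<bar>c - c1\<bar> * (BE * region_ind P k (q - (x, v)))"
        unfolding abs_mult[of _ e] using BA by (intro mult_mono) auto
      also have "\<dots> = BA * BE * ?X q" by (simp add: c_def c1_def z_def)
      finally have t2: "\<bar>a z' v' * (c - c1) * e\<bar> \<le> BA * BE * ?X q" .
      have "\<bar>a z' v' * (e * c1 - e' * c1')\<bar> \<le> BA * \<bar>e * c1 - e' * c1'\<bar>"
        using a(1)[of z' v'] unfolding abs_mult by (intro mult_right_mono) auto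
      also have "\<bar>e * c1 - e' * c1'\<bar> = ?Y q"
        unfolding d(2)[symmetric] by (simp add: e_def e'_def c1_def c1'_def z_def z'_def indicator_def abs_minus_commute)
      finally have t3: "\<bar>a z' v' * (e * c1 - e' * c1')\<bar> \<le> BA * ?Y q" .
      have "?G x v q - ?G x' v' q = a z v * c * e - a z' v' * c1' * e'"
        by (simp add: z_def z'_def c_def c1'_def e_def e'_def)
      also have "\<dots> = (a z v - a z' v') * (c * e) + a z' v' * (c - c1) * e + a z' v' * (e * c1 - e' * c1')"
        by (simp add: algebra_simps)
      finally have "\<bar>?G x v q - ?G x' v' q\<bar> \<le> LA * \<delta> * BE + BA * BE * ?X q + BA * ?Y q"
        using t1 t2 t3 by linarith
      then show ?thesis by (simp add: mult_ac)
    qed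
    have F_meas[measurable]: "?F \<in> borel_measurable borel" by measurable
    have "ennreal (norm (?N))
      \<le> (\<integral>\<^sup>+ q. ennreal (norm (?G x v q * h q - ?G x' v' q * h q)) \<partial>lborel)"
      unfolding interaction_def
      using integral_norm_bound_ennreal[OF Bochner_Integration.integrable_diff[OF int[of x v] int[of x' v']]]
      by (simp add: Bochner_Integration.integral_diff[OF int int])
    also have "\<dots> \<le> (\<integral>\<^sup>+ q. ?S q * (ennreal M * indicator (cball 0 \<rho>) q) \<partial>lborel)"
    proof (rule nn_integral_mono_AE)
      show "AE q in lborel. ennreal (norm (?G x v q * h q - ?G x' v' q * h q))
        \<le> ?S q * (ennreal M * indicator (cball 0 \<rho>) q)"
        using hB
      proof eventually_elim
        fix q assume hq: "ennreal \<bar>h q\<bar> \<le> ennreal M * indicator (cball 0 \<rho>) q"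
        have "ennreal (norm (?G x v q * h q - ?G x' v' q * h q)) = ennreal \<bar>?G x v q - ?G x' v' q\<bar> * ennreal \<bar>h q\<bar>"
          by (simp add: left_diff_distrib[symmetric] abs_mult ennreal_mult)
        also have "\<dots> \<le> ennreal (BE * LA * \<delta> + BA * BE * ?X q + BA * ?Y q) * (ennreal M * indicator (cball 0 \<rho>) q)"
          by (intro mult_mono hq ennreal_leI pt) auto
        also have "ennreal (BE * LA * \<delta> + BA * BE * ?X q + BA * ?Y q) = ?S q"
          using BA E(4) a(3) \<delta>0 by (simp add: ennreal_mult[symmetric] ennreal_plus[symmetric] del: ennreal_plus)
        finally show "ennreal (norm (?G x v q * h q - ?G x' v' q * h q))
        \<le> ?S q * (ennreal M * indicator (cball 0 \<rho>) q)" .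
      qed
    qed
    also have "\<dots> = (\<integral>\<^sup>+ q. ennreal (BE * LA * \<delta> * M) * indicator (cball 0 \<rho>) q
        + ennreal (BA * BE * M) * (ennreal (?X q) * indicator (cball 0 \<rho>) q)
        + ennreal (BA * M) * (ennreal (?Y q) * indicator (cball 0 \<rho>) q) \<partial>lborel)"
    proof -
      have alg: "(A + B * X + C * Y) * (m * i) = (A * m) * i + (B * m) * (X * i) + (C * m) * (Y * i)"
        for A B C X Y m i :: ennreal
        by (simp add: distrib_right distrib_left mult_ac)
      have "ennreal (BE * LA * \<delta> * M) = ennreal (BE * LA * \<delta>) * ennreal M"
        "ennreal (BA * BE * M) = ennreal (BA * BE) * ennreal M"
        "ennreal (BA * M) = ennreal BA * ennreal M"
        using BA E(4) a(3) \<delta>0 M by (simp_all add: ennreal_mult)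
      then show ?thesis by (simp only: alg)
    qed
    also have "\<dots> = ennreal (BE * LA * \<delta> * M) * emeasure lborel (cball (0::phase) \<rho>)
        + ennreal (BA * BE * M) * ?IX
        + ennreal (BA * M) * ?IY"
      by (subst nn_integral_add, measurable)+ (simp add: nn_integral_cmult nn_integral_cmult_indicator)
    finally have main: "ennreal (norm (?N)) \<le>
        ennreal (BE * LA * \<delta> * M) * emeasure lborel (cball (0::phase) \<rho>)
        + ennreal (BA * BE * M) * ?IX
        + ennreal (BA * M) * ?IY" .
    have Y: "?IY \<le> ennreal (A2 * \<delta> * K)"
    proof -
      have tr: "line_variation A2 (\<lambda>q. ?F (q - (x, v)))"
        by (rule line_variation_translate[OF lv])
      have sw: "q - (x, v) + d = q + d - (x, v)" for q by simp
      have "?IY \<le> ennreal (A2 * norm d) * emeasure lborel (cball (0::phase) (\<rho> + 1))"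
        using nn_integral_shift_ball[OF tr A2, of d 0 \<rho>] unfolding sw .
      then show ?thesis using A2 K \<delta>0 by (simp add: d(1) ennreal_mult)
    qed
    have "ennreal (norm v) * ennreal (norm (?N)) \<le>
      ennreal (norm v) * (ennreal (BE * LA * \<delta> * M) * ennreal K
        + ennreal (BA * BE * M) * ?IX
        + ennreal (BA * M) * ennreal (A2 * \<delta> * K))"
      by (intro mult_left_mono order_trans[OF main] add_mono K' Y) auto
    also have "\<dots> = ennreal (norm v) * ennreal (BE * LA * \<delta> * M * K)
       + ennreal (BA * BE * M) * (ennreal (norm v) * ?IX)
       + ennreal (norm v) * ennreal (BA * M * (A2 * \<delta> * K))"
      using BA E(4) M K A2 a(3) \<delta>0 by (simp add: distrib_left ennreal_mult[symmetric] mult_ac)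
    also have "\<dots> \<le> ennreal (norm v) * ennreal (BE * LA * \<delta> * M * K)
       + ennreal (BA * BE * M) * ennreal (C1 * (1 + norm v) * norm (v - v'))
       + ennreal (norm v) * ennreal (BA * M * (A2 * \<delta> * K))"
      by (intro add_mono mult_left_mono C1(2)) auto
    also have "\<dots> = ennreal (norm v * (BE * LA * \<delta> * M * K) + BA * BE * M * (C1 * (1 + norm v) * norm (v - v')) + norm v * (BA * M * (A2 * \<delta> * K)))"
      (is "_ = ennreal ?R")
      using BA E(4) M K A2 a(3) \<delta>0 C1(1) by (simp add: ennreal_mult[symmetric] ennreal_plus[symmetric] del: ennreal_plus)
    finally have "ennreal (norm v * norm (?N))
      \<le> ennreal ?R"
      by (simp only: ennreal_mult[OF norm_ge_zero norm_ge_zero])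
    moreover have "0 \<le> ?R"
      using BA E(4) M K A2 a(3) \<delta>0 C1(1) by (intro add_nonneg_nonneg mult_nonneg_nonneg) auto
    ultimately have "norm v * \<bar>?N\<bar> \<le> ?R"
      using ennreal_le_iff real_norm_def by metis
    also have "\<dots> \<le> (1 + norm v) * (BE * LA * \<delta> * M * K) + BA * BE * M * (C1 * (1 + norm v) * \<delta>) + (1 + norm v) * (BA * M * (A2 * \<delta> * K))"
      using BA E(4) M K A2 a(3) \<delta>0 C1(1) dv by (intro add_mono mult_left_mono mult_right_mono) auto
    also have "\<dots> = (BE * LA * K + BA * BE * C1 + BA * A2 * K) * M * (1 + norm v) * \<delta>" by (simp add: algebra_simps)
    also have "\<dots> \<le> C * M * (1 + norm v) * \<delta>"
      unfolding C_def using BA E(4) M K \<delta>0 by (intro mult_right_mono) auto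
    finally have 1: "norm v * \<bar>?N\<bar> \<le> C * M * (1 + norm v) * \<delta>" .
    have "BA * BE * (M * K) = BA * BE * K * M" by simp
    also have "\<dots> \<le> C * M" unfolding C_def using BA E(4) M K A2 a(3) C1(1) by (intro mult_right_mono) auto
    finally have 2: "\<bar>interaction P a E h x v\<bar> \<le> C * M" using bound by linarith
    show ?thesis using 1 2 by (simp add: \<delta>_def)
  qed
  moreover have "C \<ge> 0" using BA E(4) K A2 a(3) C1(1) by (simp add: C_def)
  ultimately show ?thesis using that by blast
qed

section \<open>Lipschitz bounds for the force\<close>

lemma inter_set_iff: "z \<in> inter_set P k v w \<longleftrightarrow> z \<in> region P k (w - v) \<and> z \<in> vision_cone P v"
  by (simp add: inter_set_def)

fun angular :: "params \<Rightarrow> interaction \<Rightarrow> plane \<Rightarrow> plane \<Rightarrow> real" where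
  "angular P Co z v = - C0 P * mollify (epsil P) (\<lambda>z v. cos (signed_angle z v)) z v"
| "angular P Imm z v = C2 P"
| "angular P Fo z v = C4 P * mollify (epsil P) (\<lambda>z v. sin (2 * signed_angle z v)) z v"

definition local_profile :: "params \<Rightarrow> interaction \<Rightarrow> phase \<Rightarrow> real" where
  "local_profile P k q = profile P k q * region_ind P k q"

lemma rate_eq: "rate P k h x v = interaction P (\<lambda>_ _. 1) (region_ind P k) h x v + beta P"
  unfolding rate_def interaction_def
  by (auto intro!: Bochner_Integration.integral_cong simp: inter_set_iff indicator_def)

text \<open>The factorisation that separates the three ways in which position and velocity enter the kernels.\<close>

lemma kernel_eq:
  "kernel P k z v w * indicat_real (inter_set P k v w) z =
     angular P k z v * indicat_real (vision_cone P v) z * local_profile P k (z, w - v)"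
  by (cases k) (auto simp: inter_set_iff indicator_def local_profile_def)

lemma Omega_eq: "Omega P k h x v = interaction P (angular P k) (local_profile P k) h x v / rate P k h x v"
proof -
  have "(LINT (y, w)|lborel. kernel P k (y - x) v w * indicat_real (inter_set P k v w) (y - x) * h (y, w))
      = interaction P (angular P k) (local_profile P k) h x v"
    unfolding interaction_def
    by (intro Bochner_Integration.integral_cong) (auto simp: kernel_eq)
  then show ?thesis by (simp add: Omega_def)
qed

lemma lipschitz_measurable_fst:
  assumes "\<And>z v z' v'. \<bar>a z v - a z' v'\<bar> \<le> L * norm ((z, v) - (z', v'))"
  shows "(\<lambda>z::plane. a z (v::plane) :: real) \<in> borel_measurable borel"
proof -
  have "\<bar>a z v - a z' v\<bar> \<le> L * norm (z - z')" for z z' using assms[of z v z' v] by (simp add: norm_Pair)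
  then have "\<bar>a z v - a z' v\<bar> \<le> max L 0 * norm (z - z')" for z z'
    by (rule order_trans) (simp add: mult_right_mono)
  then have "(max L 0)-lipschitz_on UNIV (\<lambda>z. a z v)"
    by (intro lipschitz_onI) (auto simp: dist_real_def dist_norm)
  from lipschitz_on_continuous_on[OF this] show ?thesis by (rule borel_measurable_continuous_onI)
qed

lemma angular_bounds:
  assumes P: "valid_params P"
  obtains B L where "L \<ge> 0" "\<And>z v. \<bar>angular P k z v\<bar> \<le> B"
    "\<And>z v z' v'. \<bar>angular P k z v - angular P k z' v'\<bar> \<le> L * norm ((z, v) - (z', v'))"
proof -
  have e: "epsil P > 0" "C0 P > 0" "C2 P > 0" "C4 P > 0" using P by (auto simp: valid_params_def)
  obtain B1 L1 where 1: "B1 \<ge> 0" "L1 \<ge> 0" "\<And>z v. \<bar>mollify (epsil P) (\<lambda>z v. cos (signed_angle z v)) z v\<bar> \<le> B1"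
    "\<And>z v z' v'. \<bar>mollify (epsil P) (\<lambda>z v. cos (signed_angle z v)) z v - mollify (epsil P) (\<lambda>z v. cos (signed_angle z v)) z' v'\<bar> \<le> L1 * norm ((z, v) - (z', v'))"
    by (rule mollify_bounded_lipschitz[OF e(1) cos_signed_angle_measurable]) (simp, blast)
  obtain B2 L2 where 2: "B2 \<ge> 0" "L2 \<ge> 0" "\<And>z v. \<bar>mollify (epsil P) (\<lambda>z v. sin (2 * signed_angle z v)) z v\<bar> \<le> B2"
    "\<And>z v z' v'. \<bar>mollify (epsil P) (\<lambda>z v. sin (2 * signed_angle z v)) z v - mollify (epsil P) (\<lambda>z v. sin (2 * signed_angle z v)) z' v'\<bar> \<le> L2 * norm ((z, v) - (z', v'))"
    by (rule mollify_bounded_lipschitz[OF e(1) sin_signed_angle_measurable]) (simp, blast)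
  have sc: "\<bar>c * x\<bar> \<le> \<bar>c\<bar> * b" if "\<bar>x\<bar> \<le> b" for c x b :: real
    using that by (simp add: abs_mult mult_left_mono)
  show ?thesis
  proof (cases k)
    case Co
    show ?thesis
    proof (rule that[of "\<bar>- C0 P\<bar> * L1" "\<bar>- C0 P\<bar> * B1"])
      show "\<bar>angular P k z v\<bar> \<le> \<bar>- C0 P\<bar> * B1" for z v
        unfolding Co angular.simps by (rule sc[OF 1(3)])
      show "\<bar>angular P k z v - angular P k z' v'\<bar> \<le> \<bar>- C0 P\<bar> * L1 * norm ((z, v) - (z', v'))" for z v z' v'
        unfolding Co angular.simps right_diff_distrib[symmetric] mult.assoc[of _ L1] by (rule sc[OF 1(4)])
    qed (use 1 in auto)
  next
    case Imm
    show ?thesis by (rule that[of 0 "C2 P"]) (use e in \<open>auto simp: Imm\<close>)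
  next
    case Fo
    show ?thesis
    proof (rule that[of "\<bar>C4 P\<bar> * L2" "\<bar>C4 P\<bar> * B2"])
      show "\<bar>angular P k z v\<bar> \<le> \<bar>C4 P\<bar> * B2" for z v
        unfolding Fo angular.simps by (rule sc[OF 2(3)])
      show "\<bar>angular P k z v - angular P k z' v'\<bar> \<le> \<bar>C4 P\<bar> * L2 * norm ((z, v) - (z', v'))" for z v z' v'
        unfolding Fo angular.simps right_diff_distrib[symmetric] mult.assoc[of _ L2] by (rule sc[OF 2(4)])
    qed (use 2 in auto)
  qed
qed

lemma local_profile_line_variation:
  assumes P: "valid_params P"
  obtains A where "A \<ge> 0" "line_variation A (local_profile P k)"
proof -
  obtain A1 where A1: "A1 \<ge> 0" "line_variation A1 (profile P k)" by (rule profile_line_variation[OF P])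
  obtain A2 where A2: "A2 \<ge> 0" "line_variation A2 (region_ind P k)" by (rule region_line_variation[OF P])
  have "delta1 P > 0" using P by (simp add: valid_params_def)
  then show ?thesis
    using that[of "1 * A1 + (1 + delta1 P) * A2"] A1(1) A2(1)
      line_variation_mult[OF A1(2) A2(2) profile_abs_le[OF P], of 1]
    unfolding local_profile_def[abs_def] by simp
qed

text \<open>The rate is at least \<open>beta P\<close>, so the quotient inherits the bounds of numerator and denominator. The
  factor \<open>norm v\<close> cannot be dropped, since the vision cone is discontinuous at \<open>v = 0\<close>; it is available
  because \<open>Omega\<close> enters the force multiplied by \<open>v\<close> or \<open>perp v\<close>.\<close>

lemma Omega_lipschitz:
  assumes P: "valid_params P" and \<rho>: "\<rho> \<ge> 0" and M: "M \<ge> 0"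
  obtains C where "C \<ge> 0"
    "\<And>h x v x' v'. bounded_density \<rho> M h \<Longrightarrow> (AE q in lborel. 0 \<le> h q) \<Longrightarrow>
       norm v * \<bar>Omega P k h x v - Omega P k h x' v'\<bar> \<le> C * (1 + norm v) * norm ((x, v) - (x', v')) \<and>
       \<bar>Omega P k h x v\<bar> \<le> C"
proof -
  have b: "beta P > 0" "delta1 P > 0" using P by (auto simp: valid_params_def)
  obtain B L where a: "L \<ge> 0" "\<And>z v. \<bar>angular P k z v\<bar> \<le> B"
    "\<And>z v z' v'. \<bar>angular P k z v - angular P k z' v'\<bar> \<le> L * norm ((z, v) - (z', v'))"
    by (rule angular_bounds[OF P, of k]) blast
  obtain A1 where A1: "A1 \<ge> 0" "line_variation A1 (local_profile P k)" by (rule local_profile_line_variation[OF P])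
  obtain A2 where A2: "A2 \<ge> 0" "line_variation A2 (region_ind P k)" by (rule region_line_variation[OF P])
  have lp: "\<bar>local_profile P k q\<bar> \<le> (1 + delta1 P) * region_ind P k q" for q
    using profile_abs_le[OF P, of k q] by (simp add: local_profile_def abs_mult mult_right_mono)
  let ?N = "interaction P (angular P k) (local_profile P k)"
  let ?J = "interaction P (\<lambda>_ _. 1) (region_ind P k)"
  obtain C1 where C1: "C1 \<ge> 0" "\<And>h M x v x' v'. bounded_density \<rho> M h \<Longrightarrow> M \<ge> 0 \<Longrightarrow>
       norm v * \<bar>?N h x v - ?N h x' v'\<bar> \<le> C1 * M * (1 + norm v) * norm ((x, v) - (x', v')) \<and> \<bar>?N h x v\<bar> \<le> C1 * M"
    by (rule interaction_lipschitz[OF P \<rho> a(2,3,1) lipschitz_measurable_fst[OF a(3)] A1(2,1) lp])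
      (use b in \<open>simp, blast\<close>)
  obtain C2 where C2: "C2 \<ge> 0" "\<And>h M x v x' v'. bounded_density \<rho> M h \<Longrightarrow> M \<ge> 0 \<Longrightarrow>
       norm v * \<bar>?J h x v - ?J h x' v'\<bar> \<le> C2 * M * (1 + norm v) * norm ((x, v) - (x', v')) \<and> \<bar>?J h x v\<bar> \<le> C2 * M"
    by (rule interaction_lipschitz[OF P \<rho> _ _ _ _ A2(2,1), of "\<lambda>_ _. 1" 1 0 1 k])
      (simp, simp, simp, simp, simp, simp, blast)
  define C where "C = C1 * M / beta P + C1 * M * (C2 * M) / (beta P)\<^sup>2"
  have C: "C1 * M / beta P \<le> C" "C \<ge> 0" using C1(1) C2(1) M b by (auto simp: C_def)
  have "norm v * \<bar>Omega P k h x v - Omega P k h x' v'\<bar> \<le> C * (1 + norm v) * norm ((x, v) - (x', v')) \<and>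
       \<bar>Omega P k h x v\<bar> \<le> C"
    if h: "bounded_density \<rho> M h" "AE q in lborel. 0 \<le> h q" for h x v x' v'
  proof -
    note N = C1(2)[OF h(1) M] and J = C2(2)[OF h(1) M]
    let ?\<delta> = "norm ((x, v) - (x', v'))"
    have "0 \<le> ?J h x v" for x v
      unfolding interaction_def using h(2) by (intro integral_nonneg_AE) (auto elim!: eventually_mono)
    then have r: "rate P k h x v \<ge> beta P" for x v by (simp add: rate_eq)
    have rd: "rate P k h x v - rate P k h x' v' = ?J h x v - ?J h x' v'" by (simp add: rate_eq)
    define n n' l l' where "n = ?N h x v" and "n' = ?N h x' v'" and "l = rate P k h x v" and "l' = rate P k h x' v'"
    have l: "l \<ge> beta P" "l' \<ge> beta P" "l > 0" "l' > 0" using r b by (auto simp: l_def l'_def less_le_trans)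
    have "n / l - n' / l' = (n - n') / l + n' * (l' - l) / (l * l')" using l by (simp add: field_simps)
    then have "\<bar>n / l - n' / l'\<bar> \<le> \<bar>(n - n') / l\<bar> + \<bar>n' * (l' - l) / (l * l')\<bar>"
      by (simp only: abs_triangle_ineq)
    also have "\<bar>(n - n') / l\<bar> \<le> \<bar>n - n'\<bar> / beta P"
      using l b by (simp add: abs_divide divide_left_mono)
    also have "\<bar>n' * (l' - l) / (l * l')\<bar> \<le> (C1 * M) * \<bar>l - l'\<bar> / (beta P)\<^sup>2"
    proof -
      have "\<bar>n' * (l' - l)\<bar> \<le> (C1 * M) * \<bar>l - l'\<bar>"
        using N[of v' x'] unfolding n'_def abs_mult abs_minus_commute[of l'] by (intro mult_right_mono) auto
      moreover have "(beta P)\<^sup>2 \<le> l * l'" unfolding power2_eq_square using l b by (intro mult_mono) auto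
      ultimately show ?thesis unfolding abs_divide using l b C1(1) M by (intro frac_le) (auto simp: abs_mult)
    qed
    finally have "norm v * \<bar>n / l - n' / l'\<bar> \<le> norm v * (\<bar>n - n'\<bar> / beta P + (C1 * M) * \<bar>l - l'\<bar> / (beta P)\<^sup>2)"
      by (simp add: mult_left_mono)
    also have "\<dots> = (norm v * \<bar>n - n'\<bar>) / beta P + (C1 * M) * (norm v * \<bar>l - l'\<bar>) / (beta P)\<^sup>2" by (simp add: algebra_simps)
    also have "\<dots> \<le> (C1 * M * (1 + norm v) * ?\<delta>) / beta P + (C1 * M) * (C2 * M * (1 + norm v) * ?\<delta>) / (beta P)\<^sup>2"
      using N J C1(1) M b unfolding n_def n'_def l_def l'_def rd
      by (intro add_mono divide_right_mono mult_left_mono) auto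
    also have "\<dots> = C * (1 + norm v) * ?\<delta>" by (simp add: C_def algebra_simps)
    finally have 1: "norm v * \<bar>Omega P k h x v - Omega P k h x' v'\<bar> \<le> C * (1 + norm v) * ?\<delta>"
      by (simp add: Omega_eq n_def n'_def l_def l'_def)
    have "\<bar>n / l\<bar> \<le> C1 * M / beta P"
      unfolding abs_divide using N[of v x] l b C1(1) M by (intro frac_le) (auto simp: n_def)
    then have "\<bar>Omega P k h x v\<bar> \<le> C" using C(1) by (simp add: Omega_eq n_def l_def)
    with 1 show ?thesis by simp
  qed
  then show ?thesis using that C(2) by blast
qed

lemma perp_diff: "perp u - perp v = perp (u - v)"
  by (simp add: vec_eq_iff forall_2)

lemma force_lipschitz:
  assumes P: "valid_params P" and \<rho>: "\<rho> \<ge> 0" and M: "M \<ge> 0" and V: "L-lipschitz_on UNIV (grad V)"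
  obtains C where "C > 0"
    "\<And>h x v x' v'. bounded_density \<rho> M h \<Longrightarrow> (AE q in lborel. 0 \<le> h q) \<Longrightarrow>
       norm (force P V h x v - force P V h x' v') \<le> C * (1 + norm v) * norm ((x, v) - (x', v'))"
proof -
  obtain c where c: "\<And>k. c k \<ge> 0"
    "\<And>k h x v x' v'. bounded_density \<rho> M h \<Longrightarrow> (AE q in lborel. 0 \<le> h q) \<Longrightarrow>
       norm v * \<bar>Omega P k h x v - Omega P k h x' v'\<bar> \<le> c k * (1 + norm v) * norm ((x, v) - (x', v')) \<and>
       \<bar>Omega P k h x v\<bar> \<le> c k"
  proof -
    have "\<forall>k. \<exists>C. C \<ge> 0 \<and> (\<forall>h x v x' v'. bounded_density \<rho> M h \<longrightarrow> (AE q in lborel. 0 \<le> h q) \<longrightarrow>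
       norm v * \<bar>Omega P k h x v - Omega P k h x' v'\<bar> \<le> C * (1 + norm v) * norm ((x, v) - (x', v')) \<and>
       \<bar>Omega P k h x v\<bar> \<le> C)"
      by (intro allI, rule Omega_lipschitz[OF P \<rho> M]) blast
    from choice[OF this] show ?thesis using that by blast
  qed
  have L: "L \<ge> 0" using V by (rule lipschitz_on_nonneg)
  have s: "sigma P > 0" using P by (simp add: valid_params_def)
  define C where "C = L + 2 * (c Co + c Imm + c Fo) + sigma P"
  have "norm (force P V h x v - force P V h x' v') \<le> C * (1 + norm v) * norm ((x, v) - (x', v'))"
    if h: "bounded_density \<rho> M h" "AE q in lborel. 0 \<le> h q" for h x v x' v'
  proof -
    note c = c(1) c(2)[OF h]
    define \<delta> where "\<delta> = norm ((x, v) - (x', v'))"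
    have dv: "norm (v - v') \<le> \<delta>" "norm (x - x') \<le> \<delta>"
      using phase_norm_bounds[of "(x, v) - (x', v')"] by (auto simp: \<delta>_def)
    have n1: "1 \<le> 1 + norm v" by simp
    have le: "\<delta> \<le> (1 + norm v) * \<delta>" using mult_right_mono[OF n1, of \<delta>] by (simp add: \<delta>_def)
    have om: "norm (Omega P k h x v *\<^sub>R g v - Omega P k h x' v' *\<^sub>R g v') \<le> 2 * c k * ((1 + norm v) * \<delta>)"
      if g: "\<And>u. norm (g u) = norm u" "\<And>u u'. g u - g u' = g (u - u')" for k and g :: "plane \<Rightarrow> plane"
    proof -
      have "Omega P k h x v *\<^sub>R g v - Omega P k h x' v' *\<^sub>R g v' =
        (Omega P k h x v - Omega P k h x' v') *\<^sub>R g v + Omega P k h x' v' *\<^sub>R g (v - v')"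
        by (simp add: g(2)[symmetric] algebra_simps)
      then have "norm (Omega P k h x v *\<^sub>R g v - Omega P k h x' v' *\<^sub>R g v') \<le>
          norm v * \<bar>Omega P k h x v - Omega P k h x' v'\<bar> + \<bar>Omega P k h x' v'\<bar> * norm (v - v')"
        using norm_triangle_ineq[of "(Omega P k h x v - Omega P k h x' v') *\<^sub>R g v" "Omega P k h x' v' *\<^sub>R g (v - v')"]
        by (simp add: g(1) mult.commute)
      also have "\<dots> \<le> c k * (1 + norm v) * \<delta> + c k * \<delta>"
      proof (rule add_mono)
        show "norm v * \<bar>Omega P k h x v - Omega P k h x' v'\<bar> \<le> c k * (1 + norm v) * \<delta>"
          using c(2)[of v k x x' v'] by (simp add: \<delta>_def)
        show "\<bar>Omega P k h x' v'\<bar> * norm (v - v') \<le> c k * \<delta>"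
          using c(2)[of v' k x'] c(1)[of k] dv by (intro mult_mono) auto
      qed
      also have "\<dots> \<le> 2 * c k * ((1 + norm v) * \<delta>)"
      proof -
        have "c k * (1 + norm v) * \<delta> = c k * ((1 + norm v) * \<delta>)"
          "2 * c k * ((1 + norm v) * \<delta>) = c k * ((1 + norm v) * \<delta>) + c k * ((1 + norm v) * \<delta>)" by simp_all
        then show ?thesis using mult_left_mono[OF le c(1)[of k]] by linarith
      qed
      finally show ?thesis .
    qed
    have gr: "norm (grad V x - grad V x') \<le> L * ((1 + norm v) * \<delta>)"
    proof -
      have "norm (grad V x - grad V x') \<le> L * norm (x - x')"
        using lipschitz_onD[OF V, of x x'] by (simp add: dist_norm)
      also have "\<dots> \<le> L * ((1 + norm v) * \<delta>)" using L dv le by (intro mult_left_mono) auto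
      finally show ?thesis .
    qed
    have si: "norm (sigma P *\<^sub>R v - sigma P *\<^sub>R v') \<le> sigma P * ((1 + norm v) * \<delta>)"
      using s dv(1) le unfolding scaleR_diff_right[symmetric] by (simp add: mult_left_mono)
    have tri: "norm (- a + b - c + d - e) \<le> norm a + norm b + norm c + norm d + norm e" for a b c d e :: plane
      using norm_triangle_ineq4[of "- a + b - c + d" e] norm_triangle_ineq[of "- a + b - c" d]
        norm_triangle_ineq4[of "- a + b" c] norm_triangle_ineq[of "- a" b] by simp
    have "force P V h x v - force P V h x' v' =
      - (grad V x - grad V x') + (Omega P Co h x v *\<^sub>R perp v - Omega P Co h x' v' *\<^sub>R perp v')
      - (Omega P Imm h x v *\<^sub>R v - Omega P Imm h x' v' *\<^sub>R v')
      + (Omega P Fo h x v *\<^sub>R perp v - Omega P Fo h x' v' *\<^sub>R perp v') - (sigma P *\<^sub>R v - sigma P *\<^sub>R v')"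
      by (simp add: force_def algebra_simps)
    also have "norm \<dots> \<le> norm (grad V x - grad V x') + norm (Omega P Co h x v *\<^sub>R perp v - Omega P Co h x' v' *\<^sub>R perp v')
      + norm (Omega P Imm h x v *\<^sub>R v - Omega P Imm h x' v' *\<^sub>R v')
      + norm (Omega P Fo h x v *\<^sub>R perp v - Omega P Fo h x' v' *\<^sub>R perp v') + norm (sigma P *\<^sub>R v - sigma P *\<^sub>R v')"
      by (rule tri)
    also have "\<dots> \<le> L * ((1 + norm v) * \<delta>) + 2 * c Co * ((1 + norm v) * \<delta>) + 2 * c Imm * ((1 + norm v) * \<delta>)
       + 2 * c Fo * ((1 + norm v) * \<delta>) + sigma P * ((1 + norm v) * \<delta>)"
      using om[of perp Co] om[of "\<lambda>v. v" Imm] om[of perp Fo] gr si by (intro add_mono) (auto simp: perp_diff)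
    also have "\<dots> = C * (1 + norm v) * \<delta>" by (simp add: C_def algebra_simps)
    finally show ?thesis by (simp add: \<delta>_def)
  qed
  moreover have "C > 0" using L c(1)[of Co] c(1)[of Imm] c(1)[of Fo] s by (simp add: C_def)
  ultimately show ?thesis using that by blast
qed

section \<open>Smooth test functions\<close>

lemma Ck_SucD: "Ck (Suc k) f \<Longrightarrow> Ck k f"
proof (induction k arbitrary: f)
  case 0
  then show ?case by (simp add: differentiable_imp_continuous_on)
next
  case (Suc k)
  then show ?case by simp
qed

lemma Ck_differentiable: "Ck (Suc k) f \<Longrightarrow> f differentiable (at x)"
  by (simp add: differentiable_on_def)

lemma Ck_SucI:
  assumes "\<And>x. (f has_derivative D x) (at x)" "\<And>h. Ck k (\<lambda>x. D x h)"
  shows "Ck (Suc k) f"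
proof -
  have "frechet_derivative f (at x) = D x" for x using frechet_derivative_at[OF assms(1)] by simp
  moreover have "f differentiable_on UNIV" using assms(1) unfolding differentiable_on_def differentiable_def by blast
  ultimately show ?thesis using assms(2) by simp
qed

lemma Ck_const: "Ck k (\<lambda>_. c)"
proof (induction k arbitrary: c)
  case (Suc k) show ?case by (rule Ck_SucI[OF has_derivative_const Suc])
qed simp

lemma Ck_linear:
  assumes "bounded_linear f" shows "Ck k f"
proof (cases k)
  case 0 then show ?thesis using assms by (simp add: linear_continuous_on)
next
  case (Suc j)
  show ?thesis unfolding Suc by (rule Ck_SucI[OF bounded_linear.has_derivative[OF assms has_derivative_ident] Ck_const])
qed

lemma Ck_add: "Ck k f \<Longrightarrow> Ck k g \<Longrightarrow> Ck k (\<lambda>x. f x + g x)"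
proof (induction k arbitrary: f g)
  case 0 then show ?case by (simp add: continuous_on_add)
next
  case (Suc k)
  show ?case
  proof (rule Ck_SucI)
    show "((\<lambda>x. f x + g x) has_derivative (\<lambda>h. frechet_derivative f (at x) h + frechet_derivative g (at x) h)) (at x)" for x
      using Suc.prems by (intro has_derivative_add) (auto simp: frechet_derivative_works[symmetric] intro: Ck_differentiable)
    show "Ck k (\<lambda>x. frechet_derivative f (at x) h + frechet_derivative g (at x) h)" for h
      using Suc.prems by (intro Suc.IH) simp_all
  qed
qed

lemma Ck_mult: "Ck k f \<Longrightarrow> Ck k g \<Longrightarrow> Ck k (\<lambda>x. f x * g x)"
proof (induction k arbitrary: f g)
  case 0 then show ?case by (simp add: continuous_on_mult)
next
  case (Suc k)
  show ?case
  proof (rule Ck_SucI)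
    show "((\<lambda>x. f x * g x) has_derivative (\<lambda>h. f x * frechet_derivative g (at x) h + frechet_derivative f (at x) h * g x)) (at x)" for x
      using Suc.prems by (intro has_derivative_mult) (auto simp: frechet_derivative_works[symmetric] intro: Ck_differentiable)
    show "Ck k (\<lambda>x. f x * frechet_derivative g (at x) h + frechet_derivative f (at x) h * g x)" for h
      using Suc.prems Ck_SucD by (intro Ck_add Suc.IH) (blast, simp, simp, blast)
  qed
qed

lemma Ck_compose:
  fixes g :: "real \<Rightarrow> real"
  shows "Ck k g \<Longrightarrow> Ck k f \<Longrightarrow> Ck k (\<lambda>x. g (f x))"
proof (induction k arbitrary: f g)
  case 0 then show ?case
    by (simp add: continuous_on_compose2[of UNIV g])
next
  case (Suc k)
  show ?case
  proof (rule Ck_SucI)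
    show "((\<lambda>x. g (f x)) has_derivative (\<lambda>h. frechet_derivative f (at x) h * frechet_derivative g (at (f x)) 1)) (at x)" for x
    proof (rule DERIV_compose_FDERIV[where f = g and g = f and g' = "frechet_derivative f (at x)"])
      define c where "c = frechet_derivative g (at (f x)) 1"
      have "linear (frechet_derivative g (at (f x)))"
        by (rule linear_frechet_derivative[OF Ck_differentiable[OF Suc.prems(1)]])
      then have "frechet_derivative g (at (f x)) h = c * h" for h
        using linear_scale[of "frechet_derivative g (at (f x))" h 1] by (simp add: c_def mult.commute)
      then have "frechet_derivative g (at (f x)) = (*) c" by (rule ext)
      moreover have "(g has_derivative frechet_derivative g (at (f x))) (at (f x))"
        using Suc.prems(1) by (auto simp: frechet_derivative_works[symmetric] intro: Ck_differentiable)
      ultimately show "(g has_real_derivative frechet_derivative g (at (f x)) 1) (at (f x))"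
        unfolding c_def[symmetric] by (simp add: has_field_derivative_def)
      show "(f has_derivative frechet_derivative f (at x)) (at x)"
        using Suc.prems(2) by (auto simp: frechet_derivative_works[symmetric] intro: Ck_differentiable)
    qed
    show "Ck k (\<lambda>x. frechet_derivative f (at x) h * frechet_derivative g (at (f x)) 1)" for h
      using Suc.prems Ck_SucD by (intro Ck_mult Suc.IH[of "\<lambda>y. frechet_derivative g (at y) 1"]) (simp, simp, blast)
  qed
qed

lemma Ck_exp: "Ck k (exp :: real \<Rightarrow> real)"
proof (induction k)
  case (Suc k)
  show ?case
  proof (rule Ck_SucI)
    show "(exp has_derivative (\<lambda>h. exp x * h)) (at x)" for x :: real
      using DERIV_exp[of x] by (simp add: has_field_derivative_def mult_commute_abs)
    show "Ck k (\<lambda>x. exp x * h)" for h :: real by (rule Ck_mult[OF Suc Ck_const])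
  qed
qed (simp add: continuous_on_exp)

lemma Ck_inner_self:
  assumes L: "bounded_linear (L :: 'a::euclidean_space \<Rightarrow> 'b::euclidean_space)"
  shows "Ck k (\<lambda>q. inner (L q) (L q))"
proof (cases k)
  case 0 then show ?thesis using linear_continuous_on[OF L, of UNIV] by (simp add: continuous_on_inner)
next
  case (Suc j)
  show ?thesis unfolding Suc
  proof (rule Ck_SucI)
    show "((\<lambda>q. inner (L q) (L q)) has_derivative (\<lambda>h. inner (L x) (L h) + inner (L h) (L x))) (at x)" for x
      by (intro has_derivative_inner bounded_linear.has_derivative[OF L] has_derivative_ident)
    have "bounded_linear (\<lambda>x. inner (L x) (L h) + inner (L h) (L x))" for h
      by (intro bounded_linear_add bounded_linear_compose[OF bounded_linear_inner_left L] bounded_linear_compose[OF bounded_linear_inner_right L])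
    then show "Ck j (\<lambda>x. inner (L x) (L h) + inner (L h) (L x))" for h by (rule Ck_linear)
  qed
qed

text \<open>For \<open>n = 0\<close> this is the standard smooth function that is flat at the origin; the powers are included
  because they make the family closed under differentiation.\<close>

definition flat :: "nat \<Rightarrow> real \<Rightarrow> real" where
  "flat n x = (if x \<le> 0 then 0 else inverse x ^ n * exp (- inverse x))"

lemma power_le_fact_exp:
  assumes "0 \<le> (u::real)" shows "u ^ n \<le> fact n * exp u"
proof -
  have "(\<Sum>k\<in>{n}. u ^ k /\<^sub>R fact k) \<le> (\<Sum>k. u ^ k /\<^sub>R fact k)"
    using assms summable_exp_generic[of u] by (intro sum_le_suminf) auto
  then have "u ^ n / fact n \<le> exp u" by (simp add: exp_def field_simps)
  then show ?thesis by (simp add: pos_divide_le_eq mult.commute)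
qed

lemma flat_bounds: "0 \<le> flat n x" "flat n x \<le> fact n"
proof -
  show "0 \<le> flat n x" by (simp add: flat_def)
  show "flat n x \<le> fact n"
  proof (cases "x \<le> 0")
    case False
    then have "inverse x ^ n * exp (- inverse x) \<le> fact n * exp (inverse x) * exp (- inverse x)"
      using power_le_fact_exp[of "inverse x" n] by (intro mult_right_mono) auto
    then show ?thesis using False by (simp add: flat_def mult.assoc flip: exp_add)
  qed (simp add: flat_def)
qed

text \<open>This bound provides the derivative at the origin.\<close>

lemma flat_le_square: "flat n x \<le> fact (n + 2) * x\<^sup>2"
proof (cases "x \<le> 0")
  case False
  then have "flat n x = flat (n + 2) x * x\<^sup>2" by (simp add: flat_def power_add field_simps power2_eq_square)
  then show ?thesis using flat_bounds(2)[of "n + 2" x] by (simp add: mult_right_mono del: fact_Suc)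
qed (simp add: flat_def)

lemma DERIV_flat: "(flat n has_real_derivative (flat (n + 2) x - real n * flat (n + 1) x)) (at x)"
proof -
  consider "x < 0" | "x = 0" | "x > 0" by linarith
  then show ?thesis
  proof cases
    case 1
    have "((\<lambda>_. 0) has_real_derivative 0) (at x)" by simp
    then have "(flat n has_real_derivative 0) (at x)"
      by (rule DERIV_cong_ev[THEN iffD1, OF refl _ refl, rotated])
        (use 1 in \<open>auto simp: flat_def eventually_nhds intro!: exI[of _ "{..<0}"]\<close>)
    then show ?thesis using 1 by (simp add: flat_def)
  next
    case 2
    have "(\<lambda>h. (flat n (0 + h) - flat n 0) / h) \<midarrow>0\<rightarrow> 0"
    proof (rule Lim_null_comparison)
      show "\<forall>\<^sub>F h in at 0. norm ((flat n (0 + h) - flat n 0) / h) \<le> fact (n + 2) * \<bar>h\<bar>"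
      proof (intro eventually_at_topological[THEN iffD2] exI[of _ UNIV] conjI ballI impI open_UNIV UNIV_I)
        fix h :: real assume "h \<noteq> 0"
        have "\<bar>flat n h\<bar> / \<bar>h\<bar> \<le> fact (n + 2) * h\<^sup>2 / \<bar>h\<bar>"
          using flat_le_square[of n h] flat_bounds(1)[of n h] by (intro divide_right_mono) auto
        also have "\<dots> = fact (n + 2) * \<bar>h\<bar>"
          using \<open>h \<noteq> 0\<close> by (simp add: power2_eq_square abs_if del: fact_Suc)
        finally show "norm ((flat n (0 + h) - flat n 0) / h) \<le> fact (n + 2) * \<bar>h\<bar>" by (simp add: flat_def[of n 0] del: fact_Suc)
      qed
      have "((\<lambda>h::real. fact (n + 2) * \<bar>h\<bar>) \<longlongrightarrow> fact (n + 2) * \<bar>0\<bar>) (at 0)" by (intro tendsto_intros)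
      then show "((\<lambda>h::real. fact (n + 2) * \<bar>h\<bar>) \<longlongrightarrow> 0) (at 0)" by simp
    qed
    then show ?thesis using 2 by (simp add: DERIV_def flat_def)
  next
    case 3
    have "((\<lambda>x. inverse x ^ n * exp (- inverse x)) has_real_derivative
       (flat (n + 2) x - real n * flat (n + 1) x)) (at x)"
    proof -
      define u where "u = inverse x"
      have p: "((\<lambda>u. u ^ n * exp (- u)) has_real_derivative (real n * u ^ (n - 1) * exp (- u) - u ^ n * exp (- u))) (at u)"
        by (auto intro!: derivative_eq_intros)
      have i: "(inverse has_real_derivative - (u\<^sup>2)) (at x)"
        using DERIV_inverse[of x] 3 by (simp add: u_def power2_eq_square)
      have "(real n * u ^ (n - 1) * exp (- u) - u ^ n * exp (- u)) * - (u\<^sup>2) = flat (n + 2) x - real n * flat (n + 1) x"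
        using 3 by (cases n) (simp_all add: flat_def u_def power2_eq_square algebra_simps)
      with DERIV_chain2[OF p[unfolded u_def] i] show ?thesis by (simp add: u_def)
    qed
    then show ?thesis
      by (rule DERIV_cong_ev[THEN iffD1, OF refl _ refl, rotated])
        (use 3 in \<open>auto simp: flat_def eventually_nhds intro!: exI[of _ "{0<..}"]\<close>)
  qed
qed

lemma Ck_flat: "Ck k (flat n)"
proof (induction k arbitrary: n)
  case 0
  show ?case using DERIV_isCont[OF DERIV_flat[of n]] by (simp add: continuous_on_eq_continuous_at)
next
  case (Suc k)
  show ?case
  proof (rule Ck_SucI)
    show "(flat n has_derivative (\<lambda>h. (flat (n + 2) x + (- real n) * flat (n + 1) x) * h)) (at x)" for x
      using DERIV_flat[of n x] by (simp add: has_field_derivative_def)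
    show "Ck k (\<lambda>x. (flat (n + 2) x + (- real n) * flat (n + 1) x) * h)" for h
      by (intro Ck_mult Ck_add Ck_const Suc)
  qed
qed

lemma flat_mono: "x \<le> y \<Longrightarrow> flat 0 x \<le> flat 0 y"
  by (auto simp: flat_def le_imp_inverse_le)

lemma flat_strict_mono: "0 < y \<Longrightarrow> x < y \<Longrightarrow> flat 0 x < flat 0 y"
  by (auto simp: flat_def)

lemma flat_pos_iff: "0 < flat n x \<longleftrightarrow> 0 < x"
  by (auto simp: flat_def)

text \<open>A smooth nonincreasing function that equals \<open>exp (- 1)\<close> up to \<open>1\<close> and vanishes from \<open>2\<close> on. The factor \<open>3\<close>
  serves the latter: \<open>3 * exp (- 1) \<ge> 1\<close>.\<close>

definition cutoff :: "real \<Rightarrow> real" where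
  "cutoff r = flat 0 (1 - 3 * flat 0 (r - 1))"

definition cutoff' :: "real \<Rightarrow> real" where
  "cutoff' r = - (3 * flat 2 (r - 1)) * flat 2 (1 - 3 * flat 0 (r - 1))"

lemma DERIV_cutoff: "(cutoff has_real_derivative cutoff' r) (at r)"
proof -
  have f: "(flat 0 has_real_derivative flat 2 x) (at x)" for x using DERIV_flat[of 0 x] by (simp add: numeral_2_eq_2)
  have "((\<lambda>r. flat 0 (r - 1)) has_real_derivative flat 2 (r - 1) * 1) (at r)"
    by (rule DERIV_chain2[OF f]) (auto intro!: derivative_eq_intros)
  then have "((\<lambda>r. 1 - 3 * flat 0 (r - 1)) has_real_derivative - (3 * flat 2 (r - 1))) (at r)"
    by (auto intro!: derivative_eq_intros)
  from DERIV_chain2[OF f this] show ?thesis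
    unfolding cutoff_def[abs_def] cutoff'_def by (simp add: mult.commute)
qed

lemma Ck_cutoff: "Ck k cutoff"
proof -
  have "Ck k (\<lambda>r. flat 0 (1 + (- 3) * flat 0 (r + (- 1))))"
    by (intro Ck_compose[OF Ck_flat] Ck_add Ck_mult Ck_const Ck_linear bounded_linear_ident)
  then show ?thesis by (simp add: cutoff_def[abs_def])
qed

lemma cutoff_props:
  "0 \<le> cutoff r" "antimono cutoff" "r \<le> 1 \<Longrightarrow> cutoff r = exp (- 1)" "r > 1 \<Longrightarrow> cutoff r < exp (- 1)"
  "r \<ge> 2 \<Longrightarrow> cutoff r = 0" "r \<ge> 2 \<Longrightarrow> cutoff' r = 0" "cutoff' r \<le> 0" "\<bar>cutoff' r\<bar> \<le> 12"
proof -
  show "0 \<le> cutoff r" by (simp add: cutoff_def flat_bounds)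
  show "antimono cutoff" by (auto simp: antimono_def cutoff_def intro!: flat_mono)
  show "r \<le> 1 \<Longrightarrow> cutoff r = exp (- 1)" by (simp add: cutoff_def flat_def)
  show "cutoff r < exp (- 1)" if "r > 1"
  proof -
    have "flat 0 (1 - 3 * flat 0 (r - 1)) < flat 0 1"
      using that flat_pos_iff[of 0 "r - 1"] by (intro flat_strict_mono) auto
    then show ?thesis by (simp add: cutoff_def flat_def[of 0 1])
  qed
  have neg: "1 - 3 * flat 0 (r - 1) \<le> 0" if "r \<ge> 2"
  proof -
    have "exp (1::real) \<le> 3" by (rule exp_le)
    then have "1 / 3 \<le> 1 / exp (1::real)" by (intro divide_left_mono) auto
    also have "\<dots> = flat 0 1" by (simp add: flat_def exp_minus inverse_eq_divide)
    also have "\<dots> \<le> flat 0 (r - 1)" using that by (intro flat_mono) auto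
    finally show ?thesis by simp
  qed
  show "r \<ge> 2 \<Longrightarrow> cutoff r = 0" "r \<ge> 2 \<Longrightarrow> cutoff' r = 0"
    using neg by (simp_all add: cutoff_def cutoff'_def flat_def[of _ "1 - _"])
  show "cutoff' r \<le> 0" using flat_bounds by (simp add: cutoff'_def)
  have "3 * flat 2 (r - 1) * flat 2 (1 - 3 * flat 0 (r - 1)) \<le> (3 * 2) * 2"
    using flat_bounds[of 2 "r - 1"] flat_bounds[of 2 "1 - 3 * flat 0 (r - 1)"]
    by (intro mult_mono) (auto simp: fact_numeral)
  then show "\<bar>cutoff' r\<bar> \<le> 12" using flat_bounds by (simp add: cutoff'_def abs_mult)
qed

text \<open>The first factor decreases strictly in time on \<open>(0, T)\<close>. The second one is a cutoff to the set where
  \<open>c * exp (s * t) * (1 + \<parallel>x\<parallel>\<^sup>2 + \<parallel>v\<parallel>\<^sup>2)\<close> is small, which expands if \<open>s < 0\<close> and shrinks if \<open>s > 0\<close>.\<close>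

definition wave :: "real \<Rightarrow> real \<Rightarrow> real \<Rightarrow> real \<times> phase \<Rightarrow> real" where
  "wave c s T = (\<lambda>q. flat 0 (T\<^sup>2 - (fst q)\<^sup>2) * cutoff (c * exp (s * fst q) * (1 + inner (snd q) (snd q))))"

lemma wave_test_function:
  assumes "c > 0" "0 < T'" "T' < T"
  shows "test_function ({..<T} \<times> UNIV) (wave c s T')"
  unfolding test_function_def
proof (intro conjI allI)
  fix k
  have "Ck k (\<lambda>q::real \<times> phase. flat 0 (T'\<^sup>2 + (- 1) * (fst q * fst q)) * cutoff (c * exp (s * fst q) * (1 + inner (snd q) (snd q))))"
    by (intro Ck_mult Ck_compose[OF Ck_flat] Ck_compose[OF Ck_cutoff] Ck_compose[OF Ck_exp] Ck_add Ck_const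
        Ck_inner_self Ck_linear bounded_linear_fst bounded_linear_snd)
  then show "Ck k (wave c s T')" by (simp add: wave_def power2_eq_square)
next
  let ?S = "{p. wave c s T' p \<noteq> 0}"
  define b where "b = 2 / (c * exp (- (\<bar>s\<bar> * T')))"
  have sub: "?S \<subseteq> {- T'..T'} \<times> cball 0 (sqrt b)"
  proof
    fix q assume "q \<in> ?S"
    then have ne: "flat 0 (T'\<^sup>2 - (fst q)\<^sup>2) \<noteq> 0" "cutoff (c * exp (s * fst q) * (1 + inner (snd q) (snd q))) \<noteq> 0"
      by (auto simp: wave_def)
    from ne(1) have "(fst q)\<^sup>2 \<le> T'\<^sup>2" by (auto simp: flat_def split: if_splits)
    then have t: "\<bar>fst q\<bar> \<le> T'" using assms by (simp add: abs_le_square_iff[symmetric])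
    have "c * exp (s * fst q) * (1 + inner (snd q) (snd q)) < 2" using cutoff_props(5) ne(2) by (meson not_le)
    moreover have "- (\<bar>s\<bar> * T') \<le> s * fst q"
    proof -
      have "\<bar>s * fst q\<bar> \<le> \<bar>s\<bar> * T'" using t by (simp add: abs_mult mult_left_mono)
      then show ?thesis by linarith
    qed
    then have "c * exp (- (\<bar>s\<bar> * T')) * (1 + inner (snd q) (snd q)) \<le> c * exp (s * fst q) * (1 + inner (snd q) (snd q))"
      using assms by (intro mult_right_mono mult_left_mono) auto
    ultimately have "(1 + inner (snd q) (snd q)) * (c * exp (- (\<bar>s\<bar> * T'))) < 2" by (simp add: mult.commute)
    then have "1 + inner (snd q) (snd q) < b" unfolding b_def using assms by (subst pos_less_divide_eq) auto
    then have "(norm (snd q))\<^sup>2 \<le> b" by (simp add: power2_norm_eq_inner)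
    then have "norm (snd q) \<le> sqrt b" by (rule real_le_rsqrt)
    then show "q \<in> {- T'..T'} \<times> cball 0 (sqrt b)" using t by (cases q) auto
  qed
  have cl: "closed ({- T'..T'} \<times> cball (0::phase) (sqrt b))" by (intro closed_Times) auto
  have bd: "bounded ({- T'..T'} \<times> cball (0::phase) (sqrt b))" by (intro bounded_Times) auto
  have clo: "closure ?S \<subseteq> {- T'..T'} \<times> cball 0 (sqrt b)" using sub cl by (rule closure_minimal)
  show "compact (closure ?S)"
    using bounded_subset[OF bd clo] by (simp add: compact_eq_bounded_closed)
  show "closure ?S \<subseteq> {..<T} \<times> UNIV" using clo assms by auto
qed

lemma wave_derivative:
  fixes t c s T \<tau> :: real and p \<xi> :: phase
  defines "r \<equiv> 1 + inner p p"
  defines "B \<equiv> c * exp (s * t) * r"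
  shows "frechet_derivative (wave c s T) (at (t, p)) (\<tau>, \<xi>) =
    - (2 * t * flat 2 (T\<^sup>2 - t\<^sup>2)) * \<tau> * cutoff B
    + flat 0 (T\<^sup>2 - t\<^sup>2) * cutoff' B * (c * exp (s * t)) * (s * \<tau> * r + 2 * inner p \<xi>)"
proof -
  have f: "(flat 0 has_real_derivative flat 2 x) (at x)" for x using DERIV_flat[of 0 x] by (simp add: numeral_2_eq_2)
  have A: "((\<lambda>q::real \<times> phase. T\<^sup>2 - (fst q)\<^sup>2) has_derivative (\<lambda>h. - (2 * t * fst h))) (at (t, p))"
    by (auto intro!: derivative_eq_intros simp: power2_eq_square)
  have E: "((\<lambda>q::real \<times> phase. c * exp (s * fst q) * (1 + inner (snd q) (snd q))) has_derivative
      (\<lambda>h. c * exp (s * t) * (s * fst h * r + 2 * inner p (snd h)))) (at (t, p))"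
    by (auto intro!: derivative_eq_intros simp: r_def inner_commute algebra_simps)
  have "(wave c s T has_derivative
      (\<lambda>h. flat 0 (T\<^sup>2 - t\<^sup>2) * (c * exp (s * t) * (s * fst h * r + 2 * inner p (snd h)) * cutoff' B)
        + - (2 * t * fst h) * flat 2 (T\<^sup>2 - t\<^sup>2) * cutoff B)) (at (t, p))"
    unfolding wave_def
    using has_derivative_mult[OF DERIV_compose_FDERIV[OF _ A, of "flat 0"] DERIV_compose_FDERIV[OF _ E, of cutoff]]
      f DERIV_cutoff unfolding B_def r_def by simp
  from fun_cong[OF frechet_derivative_at[OF this], of "(\<tau>, \<xi>)"] show ?thesis by (simp add: algebra_simps)
qed

section \<open>Essential supports\<close>

lemma in_L1_LinfD:
  assumes "in_L1_Linf h"
  shows "h \<in> borel_measurable borel" "integrable lborel h"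
    "L1_Linf_norm h \<le> N \<Longrightarrow> N < \<infinity> \<Longrightarrow> AE q in lborel. \<bar>h q\<bar> \<le> enn2real N"
proof -
  show m: "h \<in> borel_measurable borel" using assms by (simp add: in_L1_Linf_def)
  have "(\<integral>\<^sup>+ p. ennreal \<bar>h p\<bar> \<partial>lborel) \<le> L1_Linf_norm h"
    unfolding L1_Linf_norm_def by (rule add_increasing2) simp_all
  also have "\<dots> < \<infinity>" using assms by (simp add: in_L1_Linf_def)
  finally have "(\<integral>\<^sup>+ p. ennreal \<bar>h p\<bar> \<partial>lborel) < \<infinity>" .
  then show "integrable lborel h" using m by (intro integrableI_bounded) auto
  assume N: "L1_Linf_norm h \<le> N" "N < \<infinity>"
  have "esssup lborel (\<lambda>p. ennreal \<bar>h p\<bar>) \<le> L1_Linf_norm h"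
    unfolding L1_Linf_norm_def by (rule add_increasing) simp_all
  also have "\<dots> \<le> N" by (rule N(1))
  finally have ess: "esssup lborel (\<lambda>p. ennreal \<bar>h p\<bar>) \<le> N" .
  have "AE q in lborel. ennreal \<bar>h q\<bar> \<le> esssup lborel (\<lambda>p. ennreal \<bar>h p\<bar>)" by (rule esssup_AE)
  then show "AE q in lborel. \<bar>h q\<bar> \<le> enn2real N"
  proof eventually_elim
    case (elim q)
    then have "ennreal \<bar>h q\<bar> \<le> N" using ess by simp
    then show ?case using enn2real_mono[of "ennreal \<bar>h q\<bar>" N] N(2) by simp
  qed
qed

text \<open>By Lindelof's theorem countably many open sets on which \<open>h\<close> vanishes almost everywhere cover the
  complement of the essential support.\<close>

lemma AE_zero_outside_ess_supp: "AE q in lborel. q \<notin> ess_supp h \<longrightarrow> h q = 0"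
proof -
  let ?F = "{U. open U \<and> (AE q in lborel. q \<in> U \<longrightarrow> h q = 0)}"
  obtain F where F: "F \<subseteq> ?F" "countable F" "\<Union>F = \<Union>?F"
    by (rule Lindelof[of ?F]) auto
  have "AE q in lborel. \<forall>U\<in>F. q \<in> U \<longrightarrow> h q = 0"
    using F(1,2) by (subst AE_ball_countable) auto
  then show ?thesis
  proof eventually_elim
    case (elim q)
    show ?case
    proof
      assume "q \<notin> ess_supp h"
      then have "q \<in> \<Union>?F" by (auto simp: ess_supp_def)
      then show "h q = 0" using elim F(3) by blast
    qed
  qed
qed

text \<open>Countably many open sets cover the complement of \<open>phase_supp T f\<close>, so one null set of times serves all of
  them.\<close>

lemma AE_ess_supp_subset_phase_supp:
  "AE t in lborel. t \<in> {0..T} \<longrightarrow> ess_supp (f t) \<subseteq> phase_supp T f"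
proof -
  let ?F = "{U. open U \<and> (AE t in lborel. t \<in> {0..T} \<longrightarrow> (AE q in lborel. q \<in> U \<longrightarrow> f t q = 0))}"
  obtain F where F: "F \<subseteq> ?F" "countable F" "\<Union>F = \<Union>?F"
    by (rule Lindelof[of ?F]) auto
  have "AE t in lborel. \<forall>U\<in>F. t \<in> {0..T} \<longrightarrow> (AE q in lborel. q \<in> U \<longrightarrow> f t q = 0)"
    using F(1,2) by (subst AE_ball_countable) auto
  then show ?thesis
  proof eventually_elim
    case (elim t)
    show ?case
    proof (intro impI subsetI, rule ccontr)
      fix p assume t: "t \<in> {0..T}" and p: "p \<in> ess_supp (f t)" "p \<notin> phase_supp T f"
      then have "p \<in> \<Union>?F" by (auto simp: phase_supp_def)
      then obtain U where U: "U \<in> F" "p \<in> U" using F(3) by blast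
      then have "open U" "AE q in lborel. q \<in> U \<longrightarrow> f t q = 0" using F(1) elim t by auto
      then show False using p(1) U(2) by (auto simp: ess_supp_def)
    qed
  qed
qed

section \<open>Propagation of the support\<close>

lemma interaction_measurable:
  assumes [measurable]: "E \<in> borel_measurable borel" "h \<in> borel_measurable borel"
  shows "(\<lambda>p. interaction P (\<lambda>_ _. c) E h (fst p) (snd p)) \<in> borel_measurable borel"
proof -
  have "(\<lambda>p. LINT q|lborel. c * indicat_real (vision_cone P (snd p)) (fst q - fst p) * E (q - p) * h q) \<in> borel_measurable borel"
  proof (rule lborel.borel_measurable_lebesgue_integral)
    have [measurable]: "(\<lambda>z::phase \<times> phase. indicat_real (vision_cone P (snd (fst z))) (fst (snd z) - fst (fst z))) \<in> borel_measurable (borel \<Otimes>\<^sub>M borel)"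
      unfolding indicator_def by measurable
    show "(\<lambda>(p, q). c * indicat_real (vision_cone P (snd p)) (fst q - fst p) * E (q - p) * h q) \<in> borel_measurable (borel \<Otimes>\<^sub>M lborel)"
      by (simp add: case_prod_beta')
  qed
  then show ?thesis by (simp add: interaction_def)
qed

text \<open>The other two interactions act orthogonally to the velocity and leave \<open>\<parallel>x\<parallel>\<^sup>2 + \<parallel>v\<parallel>\<^sup>2\<close> unchanged, so
  that the propagation of the support involves \<open>Omega P Imm\<close> only.\<close>

lemma Omega_Imm_properties:
  assumes P: "valid_params P" and hm: "h \<in> borel_measurable borel"
    and nn: "AE q in lborel. 0 \<le> h q" and hI: "integrable lborel h"
  shows "(\<lambda>p. Omega P Imm h (fst p) (snd p)) \<in> borel_measurable borel"
    "0 \<le> Omega P Imm h x v" "Omega P Imm h x v \<le> C2 P"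
proof -
  note [measurable] = hm
  have pos: "C2 P > 0" "C3 P > 0" "beta P > 0" using P by (auto simp: valid_params_def)
  have lpm[measurable]: "local_profile P Imm \<in> borel_measurable borel"
    unfolding local_profile_def by measurable
  have lp: "0 \<le> local_profile P Imm q" "local_profile P Imm q \<le> region_ind P Imm q" for q
    using pos by (auto simp: local_profile_def profile_eq indicator_def)
  let ?N = "interaction P (\<lambda>_ _. C2 P) (local_profile P Imm) h"
  let ?J = "interaction P (\<lambda>_ _. 1) (region_ind P Imm) h"
  have eq: "Omega P Imm h x v = ?N x v / (?J x v + beta P)" for x v
  proof -
    have "angular P Imm = (\<lambda>_ _. C2 P)" by (simp add: fun_eq_iff)
    then show ?thesis by (simp add: Omega_eq rate_eq)
  qed
  show "(\<lambda>p. Omega P Imm h (fst p) (snd p)) \<in> borel_measurable borel"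
    unfolding eq by (intro borel_measurable_divide borel_measurable_add interaction_measurable) measurable
  have N0: "0 \<le> ?N x v" and J0: "0 \<le> ?J x v"
    unfolding interaction_def using nn lp(1) pos by (auto intro!: integral_nonneg_AE elim!: eventually_mono)
  have "?N x v \<le> (LINT q|lborel. C2 P * (1 * indicat_real (vision_cone P v) (fst q - x) * region_ind P Imm (q - (x, v)) * h q))"
    unfolding interaction_def
  proof (rule integral_mono_AE)
    have I: "integrable lborel (\<lambda>q. C2 P * indicat_real (vision_cone P v) (fst q - x) * E (q - (x, v)) * h q)"
      if [measurable]: "E \<in> borel_measurable borel" and E: "\<And>q. 0 \<le> E q" "\<And>q. E q \<le> 1" for E
    proof (rule Bochner_Integration.integrable_bound)
      show "integrable lborel (\<lambda>q. C2 P * h q)" using hI by simp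
      show "AE q in lborel. norm (C2 P * indicat_real (vision_cone P v) (fst q - x) * E (q - (x, v)) * h q) \<le> norm (C2 P * h q)"
      proof (intro AE_I2)
        fix q
        have "E (q - (x, v)) * \<bar>h q\<bar> \<le> \<bar>h q\<bar>" using E by (simp add: mult_left_le_one_le)
        then show "norm (C2 P * indicat_real (vision_cone P v) (fst q - x) * E (q - (x, v)) * h q) \<le> norm (C2 P * h q)"
          using E pos by (auto simp: indicator_def abs_mult)
      qed
      have [measurable]: "(\<lambda>q::phase. indicat_real (vision_cone P v) (fst q - x)) \<in> borel_measurable borel"
        unfolding indicator_def by measurable
      show "(\<lambda>q. C2 P * indicat_real (vision_cone P v) (fst q - x) * E (q - (x, v)) * h q) \<in> borel_measurable lborel" by measurable
    qed
    show "integrable lborel (\<lambda>q. C2 P * indicat_real (vision_cone P v) (fst q - x) * local_profile P Imm (q - (x, v)) * h q)"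
      using lp by (intro I) (auto intro: order_trans[OF lp(2)] simp: indicator_def)
    show "integrable lborel (\<lambda>q. C2 P * (1 * indicat_real (vision_cone P v) (fst q - x) * region_ind P Imm (q - (x, v)) * h q))"
      using I[of "region_ind P Imm"] by (simp add: mult_ac)
    show "AE q in lborel. C2 P * indicat_real (vision_cone P v) (fst q - x) * local_profile P Imm (q - (x, v)) * h q
      \<le> C2 P * (1 * indicat_real (vision_cone P v) (fst q - x) * region_ind P Imm (q - (x, v)) * h q)"
      using nn
    proof eventually_elim
      fix q assume "0 \<le> h q"
      then have "local_profile P Imm (q - (x, v)) * h q \<le> region_ind P Imm (q - (x, v)) * h q"
        by (intro mult_right_mono lp)
      then have "C2 P * indicat_real (vision_cone P v) (fst q - x) * (local_profile P Imm (q - (x, v)) * h q)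
        \<le> C2 P * indicat_real (vision_cone P v) (fst q - x) * (region_ind P Imm (q - (x, v)) * h q)"
        using pos by (intro mult_left_mono) auto
      then show "C2 P * indicat_real (vision_cone P v) (fst q - x) * local_profile P Imm (q - (x, v)) * h q
      \<le> C2 P * (1 * indicat_real (vision_cone P v) (fst q - x) * region_ind P Imm (q - (x, v)) * h q)"
        by (simp add: mult_ac)
    qed
  qed
  also have "\<dots> = C2 P * ?J x v" unfolding interaction_def by (rule integral_mult_right_zero)
  also have "\<dots> \<le> C2 P * (?J x v + beta P)" using pos by (intro mult_left_mono) auto
  finally show "Omega P Imm h x v \<le> C2 P" unfolding eq using J0 pos by (simp add: pos_divide_le_eq)
  show "0 \<le> Omega P Imm h x v" unfolding eq using N0 J0 pos by simp
qed

text \<open>The transport operator of the equation applied to \<open>wave c s T\<close>, as \<open>wave_transport\<close> shows.\<close>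

definition transported :: "params \<Rightarrow> (plane \<Rightarrow> real) \<Rightarrow> (phase \<Rightarrow> real) \<Rightarrow> real \<Rightarrow> real \<Rightarrow> real \<Rightarrow> real \<Rightarrow> phase \<Rightarrow> real" where
  "transported P V h c s T t p = (let B = c * exp (s * t) * (1 + inner p p) in
     - (2 * t * flat 2 (T\<^sup>2 - t\<^sup>2)) * cutoff B
     + flat 0 (T\<^sup>2 - t\<^sup>2) * cutoff' B * (c * exp (s * t)) *
       (s * (1 + inner p p) + 2 * inner (fst p) (snd p)
         - 2 * (inner (snd p) (grad V (fst p)) + (Omega P Imm h (fst p) (snd p) + sigma P) * inner (snd p) (snd p))))"

lemma inner_perp: "inner v (perp v) = 0"
  by (simp add: inner_plane)

lemma wave_transport:
  "(let D\<phi> = frechet_derivative (wave c s T) (at (t, x, v)) in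
      D\<phi> (1, 0, 0) + D\<phi> (0, v, 0)
      - D\<phi> (0, 0, grad V x - Omega P Co h x v *\<^sub>R perp v + Omega P Imm h x v *\<^sub>R v
                 - Omega P Fo h x v *\<^sub>R perp v + sigma P *\<^sub>R v)) = transported P V h c s T t (x, v)"
  unfolding Let_def wave_derivative transported_def
  by (simp add: zero_prod_def[symmetric] inner_Pair inner_perp inner_add_right inner_diff_right algebra_simps)

text \<open>The drift has at most linear growth, so it changes \<open>1 + \<parallel>x\<parallel>\<^sup>2 + \<parallel>v\<parallel>\<^sup>2\<close> at most at an exponential rate.\<close>

lemma drift_bound:
  assumes P: "valid_params P" and V: "L-lipschitz_on UNIV (grad V)" and om: "0 \<le> \<omega>" "\<omega> \<le> C2 P"
  shows "\<bar>2 * inner x v - 2 * (inner v (grad V x) + (\<omega> + sigma P) * inner v v)\<bar>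
     \<le> (1 + norm (grad V 0) + L + 2 * (C2 P + sigma P)) * (1 + inner (x, v) (x, v))"
proof -
  have L: "L \<ge> 0" using V by (rule lipschitz_on_nonneg)
  have s: "sigma P > 0" using P by (simp add: valid_params_def)
  have am: "2 * (a * b) \<le> a\<^sup>2 + b\<^sup>2" for a b :: real
    using zero_le_power2[of "a - b"] by (simp add: power2_eq_square algebra_simps)
  define X Y where "X = norm x" and "Y = norm v"
  have XY: "X \<ge> 0" "Y \<ge> 0" by (auto simp: X_def Y_def)
  have in1: "\<bar>2 * inner x v\<bar> \<le> X\<^sup>2 + Y\<^sup>2"
    using Cauchy_Schwarz_ineq2[of x v] am[of X Y] by (simp add: X_def Y_def)
  have "norm (grad V x) \<le> norm (grad V 0) + L * X"
    using lipschitz_onD[OF V, of x 0] norm_triangle_ineq2[of "grad V x" "grad V 0"] by (simp add: dist_norm X_def)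
  then have "Y * norm (grad V x) \<le> Y * (norm (grad V 0) + L * X)" using XY by (intro mult_left_mono)
  then have "\<bar>2 * inner v (grad V x)\<bar> \<le> norm (grad V 0) * (2 * (1 * Y)) + L * (2 * (X * Y))"
    using Cauchy_Schwarz_ineq2[of v "grad V x"] by (simp add: Y_def algebra_simps)
  also have "\<dots> \<le> norm (grad V 0) * (1\<^sup>2 + Y\<^sup>2) + L * (X\<^sup>2 + Y\<^sup>2)"
    using L by (intro add_mono mult_left_mono am) auto
  also have "\<dots> \<le> norm (grad V 0) * (1 + X\<^sup>2 + Y\<^sup>2) + L * (1 + X\<^sup>2 + Y\<^sup>2)"
    using L by (intro add_mono mult_left_mono) auto
  finally have in2: "\<bar>2 * inner v (grad V x)\<bar> \<le> norm (grad V 0) * (1 + X\<^sup>2 + Y\<^sup>2) + L * (1 + X\<^sup>2 + Y\<^sup>2)" .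
  have "\<bar>2 * ((\<omega> + sigma P) * inner v v)\<bar> = 2 * ((\<omega> + sigma P) * Y\<^sup>2)"
    using om s by (simp add: Y_def power2_norm_eq_inner abs_mult)
  also have "\<dots> \<le> 2 * ((C2 P + sigma P) * (1 + X\<^sup>2 + Y\<^sup>2))"
    using om s by (intro mult_left_mono mult_mono) auto
  finally have in3: "\<bar>2 * ((\<omega> + sigma P) * inner v v)\<bar> \<le> 2 * ((C2 P + sigma P) * (1 + X\<^sup>2 + Y\<^sup>2))" .
  have "inner (x, v) (x, v) = X\<^sup>2 + Y\<^sup>2" by (simp add: X_def Y_def power2_norm_eq_inner)
  moreover have "\<bar>2 * inner x v - 2 * (inner v (grad V x) + (\<omega> + sigma P) * inner v v)\<bar>
    \<le> X\<^sup>2 + Y\<^sup>2 + (norm (grad V 0) * (1 + X\<^sup>2 + Y\<^sup>2) + L * (1 + X\<^sup>2 + Y\<^sup>2)) + 2 * ((C2 P + sigma P) * (1 + X\<^sup>2 + Y\<^sup>2))"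
    using in1 in2 in3 unfolding distrib_left by linarith
  ultimately show ?thesis by (simp add: algebra_simps)
qed

text \<open>If the cutoff region expands at the maximal rate \<open>K\<close> of the drift, nothing leaves it, and if it shrinks at
  this rate, nothing enters it. Therefore the term with \<open>cutoff'\<close> has a sign in either case, and only
  the time derivative of the first factor of the wave remains.\<close>

lemma transported_bounds:
  assumes P: "valid_params P" and V: "L-lipschitz_on UNIV (grad V)"
    and h: "h \<in> borel_measurable borel" "AE q in lborel. 0 \<le> h q" "integrable lborel h"
    and K: "K = 1 + norm (grad V 0) + L + 2 * (C2 P + sigma P)" and c: "c > 0"
  shows "s \<in> {K, - K} \<Longrightarrow> integrable lborel (\<lambda>p. h p * transported P V h c s T t p)"
    "- (2 * t * flat 2 (T\<^sup>2 - t\<^sup>2)) * cutoff (c * exp (- K * t) * (1 + inner p p)) \<le> transported P V h c (- K) T t p"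
    "transported P V h c K T t p \<le> - (2 * t * flat 2 (T\<^sup>2 - t\<^sup>2)) * cutoff (c * exp (K * t) * (1 + inner p p))"
proof -
  define om where "om p = Omega P Imm h (fst p) (snd p)" for p
  have om: "0 \<le> om p" "om p \<le> C2 P" for p
    using Omega_Imm_properties(2,3)[OF P h] by (simp_all add: om_def)
  have omm[measurable]: "om \<in> borel_measurable borel"
    unfolding om_def[abs_def] by (rule Omega_Imm_properties(1)[OF P h])
  have [measurable]: "grad V \<in> borel_measurable borel"
    by (rule borel_measurable_continuous_onI[OF lipschitz_on_continuous_on[OF V]])
  have [measurable]: "cutoff \<in> borel_measurable borel" "flat n \<in> borel_measurable borel" for n
    using DERIV_isCont[OF DERIV_cutoff] DERIV_isCont[OF DERIV_flat]
    by (auto intro!: borel_measurable_continuous_onI simp: continuous_on_eq_continuous_at)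
  have [measurable]: "cutoff' \<in> borel_measurable borel" unfolding cutoff'_def[abs_def] by measurable
  define W where "W p = 2 * inner (fst p) (snd p) - 2 * (inner (snd p) (grad V (fst p)) + (om p + sigma P) * inner (snd p) (snd p))" for p
  have W: "\<bar>W p\<bar> \<le> K * (1 + inner p p)" for p
    using drift_bound[OF P V om, of "fst p" "snd p" p] by (simp add: W_def K)
  define a where "a = flat 0 (T\<^sup>2 - t\<^sup>2)"
  define a' where "a' = - (2 * t * flat 2 (T\<^sup>2 - t\<^sup>2))"
  have a0: "a \<ge> 0" by (simp add: a_def flat_bounds)
  define B where "B s p = c * exp (s * t) * (1 + inner p p)" for s and p :: phase
  have tr: "transported P V h c s T t p = a' * cutoff (B s p) + a * cutoff' (B s p) * (c * exp (s * t)) * (s * (1 + inner p p) + W p)" for s p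
    by (simp add: transported_def Let_def a_def a'_def B_def W_def om_def algebra_simps)
  have r: "0 < 1 + inner p p" for p :: phase by (simp add: add_pos_nonneg)
  have ce: "0 < c * exp (s * t)" for s using c by simp
  have neg: "a * cutoff' (B s p) * (c * exp (s * t)) \<le> 0" for s p
    using a0 ce[of s] cutoff_props(7)[of "B s p"] by (simp add: mult_nonpos_nonneg mult_nonneg_nonpos)
  have "0 \<le> a * cutoff' (B (- K) p) * (c * exp (- K * t)) * (- K * (1 + inner p p) + W p)"
    using neg[of "- K" p] W[of p] by (intro mult_nonpos_nonpos) auto
  then show "- (2 * t * flat 2 (T\<^sup>2 - t\<^sup>2)) * cutoff (c * exp (- K * t) * (1 + inner p p)) \<le> transported P V h c (- K) T t p"
    unfolding tr a'_def[symmetric] B_def[symmetric] by simp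
  have "a * cutoff' (B K p) * (c * exp (K * t)) * (K * (1 + inner p p) + W p) \<le> 0"
    by (rule mult_nonpos_nonneg[OF neg]) (use W[of p] in linarith)
  then show "transported P V h c K T t p \<le> - (2 * t * flat 2 (T\<^sup>2 - t\<^sup>2)) * cutoff (c * exp (K * t) * (1 + inner p p))"
    unfolding tr a'_def[symmetric] B_def[symmetric] by simp
  assume s: "s \<in> {K, - K}"
  have K0: "K \<ge> 0" using W[of 0] by (simp add: order_trans[OF abs_ge_zero])
  define Q where "Q = \<bar>a'\<bar> * cutoff 0 + a * 12 * (4 * K)"
  have bound: "\<bar>transported P V h c s T t p\<bar> \<le> Q" for p
  proof -
    have B0: "0 \<le> B s p" using ce[of s] r[of p] by (simp add: B_def)
    have "cutoff (B s p) \<le> cutoff 0" using cutoff_props(2) B0 by (simp add: antimono_def)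
    then have 1: "\<bar>a' * cutoff (B s p)\<bar> \<le> \<bar>a'\<bar> * cutoff 0"
      using cutoff_props(1) by (simp add: abs_mult mult_left_mono)
    have 2: "\<bar>cutoff' (B s p)\<bar> * (c * exp (s * t) * \<bar>s * (1 + inner p p) + W p\<bar>) \<le> 12 * (4 * K)"
    proof (cases "B s p \<ge> 2")
      case True then show ?thesis using cutoff_props(6) K0 by simp
    next
      case False
      have "\<bar>s * (1 + inner p p) + W p\<bar> \<le> 2 * K * (1 + inner p p)"
      proof -
        have "\<bar>s * (1 + inner p p)\<bar> = K * (1 + inner p p)" using s K0 r[of p] by (auto simp: abs_mult)
        then show ?thesis using W[of p] by linarith
      qed
      then have "c * exp (s * t) * \<bar>s * (1 + inner p p) + W p\<bar> \<le> c * exp (s * t) * (2 * K * (1 + inner p p))"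
        using ce[of s] by (intro mult_left_mono) auto
      also have "\<dots> = 2 * K * B s p" by (simp add: B_def)
      also have "\<dots> \<le> 2 * K * 2" using False K0 by (intro mult_left_mono) auto
      finally have "c * exp (s * t) * \<bar>s * (1 + inner p p) + W p\<bar> \<le> 4 * K" by simp
      then show ?thesis by (rule mult_mono[OF cutoff_props(8)]) (use c in simp_all)
    qed
    have "\<bar>a * cutoff' (B s p) * (c * exp (s * t)) * (s * (1 + inner p p) + W p)\<bar>
       = a * (\<bar>cutoff' (B s p)\<bar> * (c * exp (s * t) * \<bar>s * (1 + inner p p) + W p\<bar>))"
      using a0 c by (simp add: abs_mult)
    also have "\<dots> \<le> a * (12 * (4 * K))" using a0 2 by (rule mult_left_mono[rotated])
    finally show ?thesis using 1 unfolding tr Q_def by linarith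
  qed
  have mt[measurable]: "(\<lambda>p. transported P V h c s T t p) \<in> borel_measurable borel"
    unfolding tr B_def W_def by measurable
  note [measurable] = h(1)
  show "integrable lborel (\<lambda>p. h p * transported P V h c s T t p)"
  proof (rule Bochner_Integration.integrable_bound)
    show "integrable lborel (\<lambda>p. Q * h p)" using h(3) by simp
    show "AE p in lborel. norm (h p * transported P V h c s T t p) \<le> norm (Q * h p)"
    proof (intro AE_I2)
      fix p
      have "\<bar>h p\<bar> * \<bar>transported P V h c s T t p\<bar> \<le> \<bar>h p\<bar> * Q" by (intro mult_left_mono bound) simp
      also have "\<dots> \<le> \<bar>h p\<bar> * \<bar>Q\<bar>" by (intro mult_left_mono) auto
      finally show "norm (h p * transported P V h c s T t p) \<le> norm (Q * h p)" by (simp add: abs_mult mult.commute)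
    qed
  qed measurable
qed

lemma wave_transport_pair:
  "(let D\<phi> = frechet_derivative (wave c s T) (at (t, p)) in
      D\<phi> (1, 0, 0) + D\<phi> (0, snd p, 0)
      - D\<phi> (0, 0, grad V (fst p) - Omega P Co h (fst p) (snd p) *\<^sub>R perp (snd p) + Omega P Imm h (fst p) (snd p) *\<^sub>R snd p
                 - Omega P Fo h (fst p) (snd p) *\<^sub>R perp (snd p) + sigma P *\<^sub>R snd p)) = transported P V h c s T t p"
  using wave_transport[of c s T t "fst p" "snd p"] by simp

text \<open>The equation is tested with a wave whose region expands at rate \<open>K\<close> from the initial support, and with a
  wave whose much larger region shrinks at rate \<open>K\<close>. Both see the same initial mass, so the two time
  integrals provided by the weak formulation coincide. On the other hand the integrands are ordered by
  \<open>transported_bounds\<close>, hence they agree, and no mass can lie between the two regions. The outer one is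
  arbitrarily large.\<close>

lemma support_propagation:
  assumes P: "valid_params P" and V: "L-lipschitz_on UNIV (grad V)" and T: "0 < T"
    and f0: "LINT p|lborel. f0 p = 1" and f0c: "AE p in lborel. f0 p \<noteq> 0 \<longrightarrow> c1 * (1 + inner p p) \<le> 1" and c1: "c1 > 0"
    and good: "AE t in lborel. t \<in> {0..T} \<longrightarrow> f t \<in> borel_measurable borel \<and> (AE p in lborel. 0 \<le> f t p) \<and> integrable lborel (f t)"
    and weak: "weak_formulation P V T f0 f"
    and K: "K = 1 + norm (grad V 0) + L + 2 * (C2 P + sigma P)"
  shows "AE t in lborel. t \<in> {0..T} \<longrightarrow> (AE p in lborel. c1 * exp (- K * T) * (1 + inner p p) > 1 \<longrightarrow> f t p = 0)"
proof -
  have K0: "K \<ge> 0"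
    using P lipschitz_on_nonneg[OF V] unfolding K by (simp add: valid_params_def)
  have r: "0 < 1 + inner p p" for p :: phase by (simp add: add_pos_nonneg)
  \<comment> \<open>Chosen such that the shrinking region contains the expanding one up to time \<open>T\<close> and exhausts the phase space as \<open>n\<close> grows.\<close>
  define c2 where "c2 n = c1 * exp (- 2 * K * T) / (real n + 1)" for n :: nat
  have c2: "c2 n > 0" "c2 n \<le> c1 * exp (- 2 * K * T)" for n
    using c1 by (auto simp: c2_def divide_le_eq mult_left_le)
  let ?b1 = "\<lambda>t p. cutoff (c1 * exp (- K * t) * (1 + inner p p))" and ?b2 = "\<lambda>n t p. cutoff (c2 n * exp (K * t) * (1 + inner p p))"
  have step: "AE t in lborel. t \<in> {0<..<T'} \<longrightarrow> (AE p in lborel.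
      f t p * (?b2 n t p - ?b1 t p) = 0)"
    if T': "0 < T'" "T' < T" for T' n
  proof -
    define G where "G c s t = (LINT p|lborel. f t p * transported P V (f t) c s T' t p)" for c s t
    \<comment> \<open>The value of the waves at time \<open>0\<close> on the support of the initial datum.\<close>
    define k where "k = flat 0 (T'\<^sup>2) * exp (- 1)"
    have k: "k > 0" using T' flat_pos_iff[of 0 "T'\<^sup>2"] by (simp add: k_def)
    have wk: "(LINT t:{0..T}|lborel. G c s t) = - k" if "c > 0" "c \<le> c1" for c s
    proof -
      have "(LINT t:{0..T}|lborel. G c s t) + (LINT p|lborel. f0 p * wave c s T' (0, p)) = 0"
      proof -
        note w = weak[unfolded weak_formulation_def, rule_format, OF wave_test_function[OF \<open>c > 0\<close> T', of s]]
        show ?thesis using w by (simp only: case_prod_beta' prod.collapse wave_transport_pair G_def)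
      qed
      moreover have "(LINT p|lborel. f0 p * wave c s T' (0, p)) = (LINT p|lborel. f0 p * k)"
      proof (rule integral_cong_AE)
        have "f0 \<in> borel_measurable lborel"
          using f0 not_integrable_integral_eq[of lborel f0] by (intro borel_measurable_integrable) (cases "integrable lborel f0"; simp)
        moreover have "(\<lambda>p. wave c s T' (0, p)) \<in> borel_measurable lborel"
        proof -
          have "Ck 0 (wave c s T')" using wave_test_function[OF \<open>c > 0\<close> T', of s] by (simp add: test_function_def del: Ck.simps)
          then have "continuous_on UNIV (wave c s T')" by simp
          then have "wave c s T' \<in> borel_measurable borel" by (rule borel_measurable_continuous_onI)
          from measurable_compose[OF _ this, of "\<lambda>p. (0, p)" borel] show ?thesis
            by (simp add: borel_measurable_continuous_onI continuous_intros)
        qed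
        ultimately show "(\<lambda>p. f0 p * wave c s T' (0, p)) \<in> borel_measurable lborel" "(\<lambda>p. f0 p * k) \<in> borel_measurable lborel" by (rule borel_measurable_times, simp)+
        show "AE p in lborel. f0 p * wave c s T' (0, p) = f0 p * k"
          using f0c
        proof eventually_elim
          case (elim p)
          have "c * (1 + inner p p) \<le> c1 * (1 + inner p p)" using \<open>c \<le> c1\<close> r[of p] by (intro mult_right_mono) auto
          then show ?case using elim cutoff_props(3)[of "c * (1 + inner p p)"] by (auto simp: wave_def k_def)
        qed
      qed
      ultimately show ?thesis using f0 by simp
    qed
    \<comment> \<open>The integral of a nonintegrable function is \<open>0\<close>, but this one is \<open>- k\<close>.\<close>
    have int: "integrable lborel (\<lambda>t. indicat_real {0..T} t *\<^sub>R G c s t)" if "c > 0" "c \<le> c1" for c s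
    proof (rule ccontr)
      assume "\<not> integrable lborel (\<lambda>t. indicat_real {0..T} t *\<^sub>R G c s t)"
      then have "(LINT t:{0..T}|lborel. G c s t) = 0"
        unfolding set_lebesgue_integral_def by (rule not_integrable_integral_eq)
      then show False using wk[OF that, of s] k by linarith
    qed
    have cc: "c2 n \<le> c1"
    proof -
      have "exp (- 2 * K * T) \<le> 1" using K0 T by simp
      then have "c1 * exp (- 2 * K * T) \<le> c1 * 1" using c1 by (intro mult_left_mono) auto
      then show ?thesis using c2(2)[of n] by linarith
    qed
    define D where "D t = indicat_real {0..T} t *\<^sub>R G c1 (- K) t - indicat_real {0..T} t *\<^sub>R G (c2 n) K t" for t
    have Dint: "integrable lborel D" "(LINT t|lborel. D t) = 0"
      using int[OF c1 order_refl, of "- K"] int[OF c2(1) cc, of K] wk[OF c1 order_refl, of "- K"] wk[OF c2(1) cc, of K]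
      unfolding D_def[abs_def] set_lebesgue_integral_def by (auto simp: Bochner_Integration.integral_diff)
    let ?a' = "\<lambda>t. 2 * t * flat 2 (T'\<^sup>2 - t\<^sup>2)"
    have key: "integrable lborel (\<lambda>p. f t p * (?b2 n t p - ?b1 t p)) \<and> (AE p in lborel. 0 \<le> f t p * (?b2 n t p - ?b1 t p))
        \<and> ?a' t * (LINT p|lborel. f t p * (?b2 n t p - ?b1 t p)) \<le> D t"
      if t: "t \<in> {0..T}" and g: "f t \<in> borel_measurable borel" "AE p in lborel. 0 \<le> f t p" "integrable lborel (f t)" for t
    proof -
      note tb = transported_bounds[OF P V g K]
      note [measurable] = g(1)
      have [measurable]: "cutoff \<in> borel_measurable borel"
        using DERIV_isCont[OF DERIV_cutoff] by (auto intro!: borel_measurable_continuous_onI simp: continuous_on_eq_continuous_at)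
      have I: "integrable lborel (\<lambda>p. f t p * cutoff (c * exp (s * t) * (1 + inner p p)))" if "c > 0" for c s
      proof (rule Bochner_Integration.integrable_bound)
        show "integrable lborel (\<lambda>p. cutoff 0 * f t p)" using g(3) by simp
        show "AE p in lborel. norm (f t p * cutoff (c * exp (s * t) * (1 + inner p p))) \<le> norm (cutoff 0 * f t p)"
        proof (intro AE_I2)
          fix p :: phase
          have "0 \<le> c * exp (s * t) * (1 + inner p p)" using that r[of p] by simp
          then have "cutoff (c * exp (s * t) * (1 + inner p p)) \<le> cutoff 0" using cutoff_props(2) by (simp add: antimono_def)
          then have "\<bar>f t p\<bar> * cutoff (c * exp (s * t) * (1 + inner p p)) \<le> \<bar>f t p\<bar> * cutoff 0" by (rule mult_left_mono) simp
          then show "norm (f t p * cutoff (c * exp (s * t) * (1 + inner p p))) \<le> norm (cutoff 0 * f t p)"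
            using cutoff_props(1) by (simp add: abs_mult mult.commute)
        qed
      qed measurable
      have I1: "integrable lborel (\<lambda>p. f t p * ?b1 t p)" and I2: "integrable lborel (\<lambda>p. f t p * ?b2 n t p)"
        using I[OF c1, of "- K"] I[OF c2(1)[of n], of K] by simp_all
      have le: "?b1 t p \<le> ?b2 n t p" for p :: phase
      proof -
        have "c2 n * exp (K * t) \<le> c1 * exp (- 2 * K * T) * exp (K * t)" using c2(2) by (intro mult_right_mono) auto
        also have "\<dots> = c1 * exp (- 2 * K * T + K * t)" by (simp only: exp_add mult.assoc)
        also have "\<dots> \<le> c1 * exp (- K * t)"
        proof -
          have "K * t \<le> K * T" using t K0 by (intro mult_left_mono) auto
          then show ?thesis using c1 by (intro mult_left_mono) auto
        qed
        finally have "c2 n * exp (K * t) * (1 + inner p p) \<le> c1 * exp (- K * t) * (1 + inner p p)"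
          using r[of p] by (intro mult_right_mono) auto
        then show ?thesis using cutoff_props(2) by (simp add: antimono_def)
      qed
      have G1: "- ?a' t * (LINT p|lborel. f t p * ?b1 t p) \<le> G c1 (- K) t"
        unfolding G_def integral_mult_right_zero[symmetric]
      proof (rule integral_mono_AE)
        show "integrable lborel (\<lambda>p. - ?a' t * (f t p * ?b1 t p))" using I1 by simp
        show "integrable lborel (\<lambda>p. f t p * transported P V (f t) c1 (- K) T' t p)" by (rule tb(1)[OF c1]) simp
        show "AE p in lborel. - ?a' t * (f t p * ?b1 t p) \<le> f t p * transported P V (f t) c1 (- K) T' t p"
          using g(2)
        proof eventually_elim
          case (elim p)
          from mult_left_mono[OF tb(2)[OF c1, of t T' p] elim] show ?case by (simp add: mult_ac)
        qed
      qed
      have G2: "G (c2 n) K t \<le> - ?a' t * (LINT p|lborel. f t p * ?b2 n t p)"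
        unfolding G_def integral_mult_right_zero[symmetric]
      proof (rule integral_mono_AE)
        show "integrable lborel (\<lambda>p. - ?a' t * (f t p * ?b2 n t p))" using I2 by simp
        show "integrable lborel (\<lambda>p. f t p * transported P V (f t) (c2 n) K T' t p)" by (rule tb(1)[OF c2(1)]) simp
        show "AE p in lborel. f t p * transported P V (f t) (c2 n) K T' t p \<le> - ?a' t * (f t p * ?b2 n t p)"
          using g(2)
        proof eventually_elim
          case (elim p)
          from mult_left_mono[OF tb(3)[OF c2(1), of n T' t p] elim] show ?case by (simp add: mult_ac)
        qed
      qed
      have "(LINT p|lborel. f t p * (?b2 n t p - ?b1 t p)) = (LINT p|lborel. f t p * ?b2 n t p) - (LINT p|lborel. f t p * ?b1 t p)"
        using Bochner_Integration.integral_diff[OF I2 I1] by (simp add: right_diff_distrib)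
      then have "?a' t * (LINT p|lborel. f t p * (?b2 n t p - ?b1 t p)) \<le> G c1 (- K) t - G (c2 n) K t"
        using G1 G2 by (simp add: right_diff_distrib)
      moreover have "AE p in lborel. 0 \<le> f t p * (?b2 n t p - ?b1 t p)"
        using g(2) by eventually_elim (use le in simp)
      moreover have "integrable lborel (\<lambda>p. f t p * (?b2 n t p - ?b1 t p))"
        using Bochner_Integration.integrable_diff[OF I2 I1] by (simp add: right_diff_distrib)
      ultimately show ?thesis using t by (simp add: D_def)
    qed
    have "AE t in lborel. 0 \<le> D t"
      using good
    proof eventually_elim
      case (elim t)
      show ?case
      proof (cases "t \<in> {0..T}")
        case True
        then have k: "?a' t * (LINT p|lborel. f t p * (?b2 n t p - ?b1 t p)) \<le> D t" "AE p in lborel. 0 \<le> f t p * (?b2 n t p - ?b1 t p)"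
          using key[OF True] elim by blast+
        have "0 \<le> ?a' t" using True flat_bounds by simp
        then have "0 \<le> ?a' t * (LINT p|lborel. f t p * (?b2 n t p - ?b1 t p))"
          using k(2) by (intro mult_nonneg_nonneg[of "?a' t"] integral_nonneg_AE)
        then show ?thesis using k(1) by linarith
      qed (simp add: D_def)
    qed
    then have "AE t in lborel. D t = 0"
      using integral_nonneg_eq_0_iff_AE[OF Dint(1)] Dint(2) by simp
    with good show ?thesis
    proof eventually_elim
      case (elim t)
      show ?case
      proof
        assume t: "t \<in> {0<..<T'}"
        then have t2: "t \<in> {0..T}" using T' by simp
        let ?g = "\<lambda>p. f t p * (?b2 n t p - ?b1 t p)"
        have k: "integrable lborel ?g" "?a' t * (LINT p|lborel. ?g p) \<le> D t" "AE p in lborel. 0 \<le> ?g p"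
          using key[OF t2] elim(1) t2 by blast+
        have "t\<^sup>2 < T'\<^sup>2" using t by (intro power_strict_mono) auto
        then have "0 < ?a' t" using t by (simp add: flat_pos_iff)
        moreover have "0 \<le> (LINT p|lborel. ?g p)" using k(3) by (rule integral_nonneg_AE)
        moreover have "\<not> 0 < (LINT p|lborel. ?g p)"
          using mult_pos_pos[OF \<open>0 < ?a' t\<close>, of "LINT p|lborel. ?g p"] k(2) elim(2) by linarith
        ultimately have "(LINT p|lborel. ?g p) = 0" by linarith
        then show "AE p in lborel. ?g p = 0" using integral_nonneg_eq_0_iff_AE[OF k(1,3)] by simp
      qed
    qed
  qed
  \<comment> \<open>The time factor of the waves has to vanish before \<open>T\<close>, so \<open>T\<close> is exhausted from below.\<close>
  define T' where "T' m = T - T / (real m + 2)" for m :: nat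
  have T': "0 < T' m" "T' m < T" for m using T by (auto simp: T'_def field_simps intro: add_pos_nonneg)
  have "AE t in lborel. \<forall>m n. t \<in> {0<..<T' m} \<longrightarrow> (AE p in lborel.
      f t p * (?b2 n t p - ?b1 t p) = 0)"
    unfolding AE_all_countable using step[OF T'] by blast
  moreover have "AE t in lborel. t \<noteq> 0" "AE t in lborel. t \<noteq> T" by (rule AE_lborel_singleton)+
  ultimately show ?thesis
  proof eventually_elim
    case (elim t)
    show ?case
    proof
      assume t: "t \<in> {0..T}"
      obtain m where m: "t < T' m"
      proof -
        have "0 < (T - t) / T" using t elim T by simp
        then obtain m where "inverse (real (Suc m)) < (T - t) / T" using reals_Archimedean by blast
        moreover have "1 / (real m + 2) \<le> inverse (real (Suc m))" by (simp add: field_simps)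
        ultimately have "1 / (real m + 2) < (T - t) / T" by linarith
        then have "T / (real m + 2) < T - t" using T by (simp add: field_simps)
        then show ?thesis using that[of m] by (simp add: T'_def)
      qed
      have "t \<in> {0<..<T' m}" using m t elim by auto
      then have "AE p in lborel. \<forall>n. f t p * (?b2 n t p - ?b1 t p) = 0"
        using elim unfolding AE_all_countable by blast
      then show "AE p in lborel. c1 * exp (- K * T) * (1 + inner p p) > 1 \<longrightarrow> f t p = 0"
      proof eventually_elim
        case (elim p)
        show ?case
        proof
          assume far: "c1 * exp (- K * T) * (1 + inner p p) > 1"
          have Kt: "K * t \<le> K * T" using t K0 by (intro mult_left_mono) auto
          have "c1 * exp (- K * T) * (1 + inner p p) \<le> c1 * exp (- K * t) * (1 + inner p p)"
            using Kt c1 r[of p] by (intro mult_right_mono mult_left_mono) auto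
          then have 1: "?b1 t p < exp (- 1)"
            using far by (intro cutoff_props) auto
          obtain n where n: "c1 * (1 + inner p p) \<le> real n" using real_arch_simple by blast
          have "exp (- 2 * K * T) * exp (K * t) \<le> 1"
            using Kt mult_nonneg_nonneg[OF K0, of T] T unfolding exp_add[symmetric] by simp
          then have "c1 * (1 + inner p p) * (exp (- 2 * K * T) * exp (K * t)) \<le> c1 * (1 + inner p p) * 1"
            using c1 r[of p] by (intro mult_left_mono) auto
          then have "c1 * (1 + inner p p) * (exp (- 2 * K * T) * exp (K * t)) \<le> real n + 1" using n by simp
          then have "c2 n * exp (K * t) * (1 + inner p p) \<le> 1"
            by (simp add: c2_def divide_le_eq mult_ac)
          then have 2: "?b2 n t p = exp (- 1)" by (rule cutoff_props)
          have "?b2 n t p - ?b1 t p \<noteq> 0"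
            using 1 2 by simp
          then show "f t p = 0" using elim[rule_format, of n] by simp
        qed
      qed
    qed
  qed
qed

lemma weak_solution_AE:
  assumes "weak_solution P V T f0 f"
  shows "AE t in lborel. t \<in> {0..T} \<longrightarrow> (AE p in lborel. 0 \<le> f t p) \<and> in_L1_Linf (f t)"
proof -
  from assms obtain M where "AE t in lborel. t \<in> {0..T} \<longrightarrow>
        (AE p in lborel. 0 \<le> f t p) \<and> in_L1_Linf (f t) \<and>
        integrable lborel (\<lambda>(x, v). ((norm x)\<^sup>2 + (norm v)\<^sup>2) * f t (x, v)) \<and>
        (LINT (x, v)|lborel. ((norm x)\<^sup>2 + (norm v)\<^sup>2) * f t (x, v)) < M"
    unfolding weak_solution_def by blast
  then show ?thesis by eventually_elim simp
qed

lemma phase_supp_bounded: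
  assumes P: "valid_params P" and V: "L-lipschitz_on UNIV (grad V)" and T: "0 < T"
    and f0: "LINT p|lborel. f0 p = 1" "compact (ess_supp f0)"
    and weak: "weak_solution P V T f0 f"
  shows "bounded (phase_supp T f)"
proof -
  obtain R where R: "\<And>p. p \<in> ess_supp f0 \<Longrightarrow> norm p \<le> R"
    using compact_imp_bounded[OF f0(2)] unfolding bounded_iff by blast
  define c1 where "c1 = 1 / (1 + R\<^sup>2)"
  have c1: "c1 > 0" by (simp add: c1_def add_pos_nonneg)
  have f0c: "AE p in lborel. f0 p \<noteq> 0 \<longrightarrow> c1 * (1 + inner p p) \<le> 1"
    using AE_zero_outside_ess_supp[of f0]
  proof eventually_elim
    case (elim p)
    show ?case
    proof
      assume "f0 p \<noteq> 0"
      then have "norm p \<le> R" using elim R by blast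
      then have "(norm p)\<^sup>2 \<le> R\<^sup>2" by (intro power_mono) auto
      then show "c1 * (1 + inner p p) \<le> 1"
        by (simp add: c1_def power2_norm_eq_inner divide_le_eq add_pos_nonneg)
    qed
  qed
  have good: "AE t in lborel. t \<in> {0..T} \<longrightarrow> f t \<in> borel_measurable borel \<and> (AE p in lborel. 0 \<le> f t p) \<and> integrable lborel (f t)"
    using weak_solution_AE[OF weak] by eventually_elim (use in_L1_LinfD(1,2) in blast)
  have wf: "weak_formulation P V T f0 f" using weak by (simp add: weak_solution_def)
  define K where "K = 1 + norm (grad V 0) + L + 2 * (C2 P + sigma P)"
  define U where "U = {p::phase. c1 * exp (- K * T) * (1 + inner p p) > 1}"
  have "AE t in lborel. t \<in> {0..T} \<longrightarrow> (AE p in lborel. p \<in> U \<longrightarrow> f t p = 0)"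
    using support_propagation[OF P V T f0(1) f0c c1 good wf K_def] by (simp add: U_def)
  moreover have "open U" unfolding U_def by (intro open_Collect_less continuous_intros)
  ultimately have sub: "phase_supp T f \<subseteq> - U" by (auto simp: phase_supp_def)
  have "norm p \<le> sqrt (1 / (c1 * exp (- K * T)))" if "p \<in> - U" for p
  proof -
    have "(1 + inner p p) * (c1 * exp (- K * T)) \<le> 1" using that by (simp add: U_def mult.commute)
    then have "1 + inner p p \<le> 1 / (c1 * exp (- K * T))" using c1 by (subst pos_le_divide_eq) auto
    then have "(norm p)\<^sup>2 \<le> 1 / (c1 * exp (- K * T))" by (simp add: power2_norm_eq_inner)
    then show ?thesis by (rule real_le_rsqrt)
  qed
  then have "bounded (- U)" unfolding bounded_iff by blast
  then show ?thesis using sub by (rule bounded_subset)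
qed

section \<open>The force field of a weak solution\<close>

lemma AE_regular_time:
  assumes weak: "weak_solution P V T f0 f"
  shows "AE t in lborel. t \<in> {0..T} \<longrightarrow> regular_time T f t"
proof -
  have "AE t in restrict_space lborel {0..T}. L1_Linf_norm (f t) \<le> sup_L1_Linf_norm T f"
    unfolding sup_L1_Linf_norm_def by (rule esssup_AE)
  then have "AE t in lborel. t \<in> {0..T} \<longrightarrow> L1_Linf_norm (f t) \<le> sup_L1_Linf_norm T f"
    by (subst (asm) AE_restrict_space_iff) auto
  moreover note weak_solution_AE[OF weak]
  moreover note AE_ess_supp_subset_phase_supp[of T f]
  ultimately show ?thesis by eventually_elim (auto simp: regular_time_def)
qed

text \<open>The estimate is demanded for bounded \<open>S\<close> and finite \<open>M\<close> only, so that every \<open>M\<close> and \<open>S\<close> admit a constant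
  and the constants can be chosen as a function of \<open>M\<close> and \<open>S\<close>.\<close>

definition force_bound :: "params \<Rightarrow> (plane \<Rightarrow> real) \<Rightarrow> ennreal \<Rightarrow> phase set \<Rightarrow> real \<Rightarrow> bool" where
  "force_bound P V M S C \<longleftrightarrow> 0 < C \<and> (bounded S \<longrightarrow> M < \<infinity> \<longrightarrow> (\<forall>h. in_L1_Linf h \<longrightarrow> (AE p in lborel. 0 \<le> h p) \<longrightarrow>
      L1_Linf_norm h \<le> M \<longrightarrow> ess_supp h \<subseteq> S \<longrightarrow>
      (\<forall>x v x' v'. norm (force P V h x v - force P V h x' v') \<le> C * (1 + norm v) * norm ((x, v) - (x', v')))))"

lemma force_lipschitz_regular:
  assumes P: "valid_params P" and V: "L-lipschitz_on UNIV (grad V)"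
  shows "\<exists>C. force_bound P V M S C"
proof (cases "bounded S \<and> M < \<infinity>")
  case True
  then obtain \<rho> where "\<forall>p\<in>S. norm p \<le> \<rho>" unfolding bounded_iff by blast
  then have \<rho>: "S \<subseteq> cball 0 (max \<rho> 0)" by (auto simp: le_max_iff_disj)
  obtain C where C: "C > 0"
    "\<And>h x v x' v'. bounded_density (max \<rho> 0) (enn2real M) h \<Longrightarrow> (AE q in lborel. 0 \<le> h q) \<Longrightarrow>
       norm (force P V h x v - force P V h x' v') \<le> C * (1 + norm v) * norm ((x, v) - (x', v'))"
    by (rule force_lipschitz[OF P _ _ V, of "max \<rho> 0" "enn2real M"]) (simp, simp, blast)
  have "norm (force P V h x v - force P V h x' v') \<le> C * (1 + norm v) * norm ((x, v) - (x', v'))"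
    if h: "in_L1_Linf h" "AE p in lborel. 0 \<le> h p" "L1_Linf_norm h \<le> M" "ess_supp h \<subseteq> S" for h x v x' v'
  proof (rule C(2))
    have "AE q in lborel. q \<notin> cball 0 (max \<rho> 0) \<longrightarrow> h q = 0"
      using AE_zero_outside_ess_supp[of h] by eventually_elim (use h(4) \<rho> in blast)
    then show "bounded_density (max \<rho> 0) (enn2real M) h"
      using in_L1_LinfD(1)[OF h(1)] in_L1_LinfD(3)[OF h(1,3)] True by (simp add: bounded_density_def)
    show "AE p in lborel. 0 \<le> h p" by (rule h(2))
  qed
  with C(1) show ?thesis unfolding force_bound_def by blast
next
  case False
  then show ?thesis unfolding force_bound_def by (intro exI[of _ "1::real"] conjI impI) (simp, blast)
qed

theorem theorem2p15:
  fixes P :: params and V :: "plane \<Rightarrow> real"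
  assumes "valid_params P"
    and "V differentiable_on UNIV" and "continuous_on UNIV (grad V)"
    and "\<And>x. 0 \<le> V x"
    and "\<exists>L. L-lipschitz_on UNIV (grad V)"
  shows "\<exists>C :: ennreal \<Rightarrow> phase set \<Rightarrow> real. (\<forall>M S. 0 < C M S) \<and>
    (\<forall>(T :: real) (f0 :: phase \<Rightarrow> real) (f :: real \<Rightarrow> phase \<Rightarrow> real).
       0 < T \<and>
       in_L1_Linf f0 \<and> (AE p in lborel. 0 \<le> f0 p) \<and> (LINT p|lborel. f0 p) = 1 \<and>
       compact (ess_supp f0) \<and>
       weak_solution P V T f0 f \<and> sup_L1_Linf_norm T f < \<infinity> \<longrightarrow>
         (AE t in lborel. t \<in> {0..T} \<longrightarrow> regular_time T f t) \<and>
         (\<forall>p. \<exists>r>0. \<exists>L. \<forall>t\<in>{0..T}. regular_time T f t \<longrightarrow>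
            L-lipschitz_on (cball p r) (\<lambda>(x, v). force P V (f t) x v)) \<and>
         (\<forall>t\<in>{0..T}. regular_time T f t \<longrightarrow>
            (\<forall>x v x' v'.
               norm (force P V (f t) x v - force P V (f t) x' v')
               \<le> C (sup_L1_Linf_norm T f) (phase_supp T f) * (1 + norm v)
                 * norm ((x, v) - (x', v')))))"
proof -
  obtain L where V: "L-lipschitz_on UNIV (grad V)" using assms(5) by blast
  have "\<forall>M. \<exists>C. \<forall>S. force_bound P V M S (C S)"
    by (rule allI, rule choice, rule allI, rule force_lipschitz_regular[OF assms(1) V])
  from choice[OF this] obtain C where CC: "\<forall>M S. force_bound P V M S (C M S)" ..
  have C0: "0 < C M S" for M S using CC by (simp add: force_bound_def)
  have C: "norm (force P V h x v - force P V h x' v') \<le> C M S * (1 + norm v) * norm ((x, v) - (x', v'))"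
    if "bounded S" "M < \<infinity>" "in_L1_Linf h" "AE p in lborel. 0 \<le> h p" "L1_Linf_norm h \<le> M" "ess_supp h \<subseteq> S"
    for M S h x v x' v'
    using CC[THEN spec, THEN spec, unfolded force_bound_def, THEN conjunct2, THEN mp, THEN mp, OF that(1,2), THEN spec, THEN mp, THEN mp, THEN mp, THEN mp, OF that(3-6)]
    by (elim allE)
  show ?thesis
  proof (rule exI[of _ C], rule conjI, intro allI, rule C0, intro allI impI, elim conjE, goal_cases)
    case (1 T f0 f)
    then have T: "0 < T" and f0: "(LINT p|lborel. f0 p) = 1" "compact (ess_supp f0)"
      and weak: "weak_solution P V T f0 f" and fin: "sup_L1_Linf_norm T f < \<infinity>" by blast+
    let ?C = "C (sup_L1_Linf_norm T f) (phase_supp T f)"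
    have est: "norm (force P V (f t) x v - force P V (f t) x' v') \<le> ?C * (1 + norm v) * norm ((x, v) - (x', v'))"
      if "regular_time T f t" for t x v x' v'
      using that by (intro C phase_supp_bounded[OF assms(1) V T f0 weak] fin) (auto simp: regular_time_def)
    show ?case
    proof (rule conjI[OF _ conjI], goal_cases)
      case 1
      show ?case by (rule AE_regular_time[OF weak])
    next
      case 2
      show ?case
      proof
        fix p
        show "\<exists>r>0. \<exists>L. \<forall>t\<in>{0..T}. regular_time T f t \<longrightarrow> L-lipschitz_on (cball p r) (\<lambda>(x, v). force P V (f t) x v)"
        proof (rule exI[of _ 1], rule conjI[OF zero_less_one], rule exI[of _ "?C * (2 + norm p)"], intro ballI impI)
          fix t assume reg: "regular_time T f t"
          show "(?C * (2 + norm p))-lipschitz_on (cball p 1) (\<lambda>(x, v). force P V (f t) x v)"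
          proof (rule lipschitz_onI)
            fix q q' assume q: "q \<in> cball p 1"
            have "norm q \<le> norm p + 1"
              using q norm_triangle_ineq2[of q p] by (simp add: dist_norm norm_minus_commute)
            then have "1 + norm (snd q) \<le> 2 + norm p" using phase_norm_bounds(2)[of q] by linarith
            then have "?C * (1 + norm (snd q)) * norm (q - q') \<le> ?C * (2 + norm p) * norm (q - q')"
              using C0 by (intro mult_right_mono mult_left_mono) (auto intro: less_imp_le)
            moreover have "norm (force P V (f t) (fst q) (snd q) - force P V (f t) (fst q') (snd q')) \<le> ?C * (1 + norm (snd q)) * norm (q - q')"
              using est[OF reg, of "fst q" "snd q" "fst q'" "snd q'"] by simp
            ultimately show "dist (case q of (x, v) \<Rightarrow> force P V (f t) x v) (case q' of (x, v) \<Rightarrow> force P V (f t) x v) \<le> ?C * (2 + norm p) * dist q q'"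
              by (simp add: case_prod_beta' dist_norm)
          next
            show "0 \<le> ?C * (2 + norm p)" using C0 by (intro mult_nonneg_nonneg) (auto intro: less_imp_le)
          qed
        qed
      qed
    next
      case 3
      show ?case using est by blast
    qed
  qed
qed

end
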